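(* Let $(X,Y,Z)\sim P_{X,Y,Z}$ on finite alphabets $\mathcal X,\mathcal Y,\mathcal Z$ and let $\Delta$ be a real number. Then $$S_{\Delta}(X;Y\|Z)\le \Psi_{\Delta}(X;Y\|Z)\triangleq\inf_J\max_{(U,V)} \big[I(X;Y|J)+I(U;J|V)-I(U;Z|V)\big],$$ where the infimum is over finite-alphabet $J$ jointly distributed with $(X,Y,Z)$, and, for given $J$, the maximum is over all $(U,V)$ such that $(U,V)$ and $(J,Z)$ are conditionally independent given $(X,Y)$, such that $$I(V;Z)\le I(V;J)+H(Z)-\Delta,$$ and such that the alphabets satisfy $|\mathcal V|\le|\mathcal X||\mathcal Y|+1$ and $|\mathcal U|\le|\mathcal X||\mathcal Y|$. Moreover, if $Z=f(X,Y)$ for some function $f$, then in computing this upper bound one can additionally assume $H(X,Y|U,V,Z)=0$ (i.e. imposing this extra constraint in the inner maximum does not change its value).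
   Context: All random variables have finite alphabets; a maximum or supremum over an empty set is $-\infty$. $H$ and $I$ denote Shannon entropy and mutual information. Key agreement model. $(X^n,Y^n,Z^n)$ are $n$ i.i.d. copies of $(X,Y,Z)$; Alice, Bob, Eve observe $X^n$, $Y^n$, $Z^n$ respectively. In an interactive protocol with $r$ rounds ($r$ arbitrary), public messages $F_1,\dots,F_r$ are generated successively: for odd $i$, Alice generates $F_i$ according to some $P_{F_i|X^n,F_{1:i-1}}$; for even $i$, Bob generates $F_i$ according to some $P_{F_i|Y^n,F_{1:i-1}}$. Then Alice generates $K_A$ according to $P_{K_A|X^n,F_{1:r}}$ and Bob generates $K_B$ according to $P_{K_B|Y^n,F_{1:r}}$, both in an alphabet $\mathcal K$. Here $F_{1:r}=(F_1,\dots,F_r)$. This is an $(n,R,\delta)$ code if $R=\frac1nH(K_A)$ and $$\mathbb P[K_A=K_B]\ge1-\delta,\qquad R\ge\tfrac1n\log|\mathcal K|-\delta,\qquad \tfrac1n I(K_A;Z^n,F_{1:r})\le\delta.$$ $S_\Delta(X;Y\|Z)$ is the supremum of secret key rates corresponding to protocols satisfying $\lim_{n\to\infty}\frac1nH(Z^n|F_{1:r})\ge\Delta$; that is, the supremum of all $R$ for which there is a sequence of $(n_k,R_k,\delta_k)$ codes with $n_k\to\infty$, $\delta_k\to0$, $R_k\to R$, and $\lim_{k}\frac1{n_k}H(Z^{n_k}|F_{1:r})\ge\Delta$. *)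

theory Defs
  imports "HOL-Probability.Probability"
begin

section \<open>Shannon quantities of discrete random variables\<close>

text \<open>
  A random variable is a function on the sample space of a pmf.  The quantities are those of
  \<^theory>\<open>HOL-Probability.Information\<close>, to base 2.  The codomains are countable types carrying the
  counting measure on the whole type; the pmfs below all have finite support.
\<close>

definition pmf_entropy :: "'w pmf \<Rightarrow> ('w \<Rightarrow> 'a::countable) \<Rightarrow> real" where
  "pmf_entropy q A = prob_space.entropy (measure_pmf q) 2 (count_space UNIV) A"

definition pmf_cond_entropy ::
    "'w pmf \<Rightarrow> ('w \<Rightarrow> 'a::countable) \<Rightarrow> ('w \<Rightarrow> 'b::countable) \<Rightarrow> real" where
  "pmf_cond_entropy q A B =
     prob_space.conditional_entropy (measure_pmf q) 2 (count_space UNIV) (count_space UNIV) A B"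

definition pmf_mutual_info ::
    "'w pmf \<Rightarrow> ('w \<Rightarrow> 'a::countable) \<Rightarrow> ('w \<Rightarrow> 'b::countable) \<Rightarrow> real" where
  "pmf_mutual_info q A B =
     prob_space.mutual_information (measure_pmf q) 2 (count_space UNIV) (count_space UNIV) A B"

definition pmf_cond_mutual_info ::
    "'w pmf \<Rightarrow> ('w \<Rightarrow> 'a::countable) \<Rightarrow> ('w \<Rightarrow> 'b::countable) \<Rightarrow> ('w \<Rightarrow> 'c::countable) \<Rightarrow> real" where
  "pmf_cond_mutual_info q A B C =
     prob_space.conditional_mutual_information (measure_pmf q) 2
       (count_space UNIV) (count_space UNIV) (count_space UNIV) A B C"

definition pmf_cond_indep :: "'w pmf \<Rightarrow> ('w \<Rightarrow> 'a) \<Rightarrow> ('w \<Rightarrow> 'b) \<Rightarrow> ('w \<Rightarrow> 'c) \<Rightarrow> bool" where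
  "pmf_cond_indep q A B C \<longleftrightarrow>
     (\<forall>a b c. \<P>(w in q. A w = a \<and> B w = b \<and> C w = c) * \<P>(w in q. C w = c) =
              \<P>(w in q. A w = a \<and> C w = c) * \<P>(w in q. B w = b \<and> C w = c))"


section \<open>Interactive key agreement\<close>

text \<open>
  Message and key symbols are encoded as natural numbers.  The first argument of a kernel is the
  party's observed block, the second the public transcript so far; the index of the message being
  generated is read off from the length of the transcript.
\<close>

record ('x, 'y) protocol =
  rounds :: nat
  msg_alphabet :: "nat \<Rightarrow> nat set"
  msg_A :: "'x list \<Rightarrow> nat list \<Rightarrow> nat pmf"
  msg_B :: "'y list \<Rightarrow> nat list \<Rightarrow> nat pmf"
  key_alphabet :: "nat set"
  key_A :: "'x list \<Rightarrow> nat list \<Rightarrow> nat pmf"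
  key_B :: "'y list \<Rightarrow> nat list \<Rightarrow> nat pmf"

definition valid_protocol :: "('x, 'y) protocol \<Rightarrow> bool" where
  "valid_protocol C \<longleftrightarrow>
     (\<forall>i. finite (msg_alphabet C i)) \<and>
     (\<forall>xs f. set_pmf (msg_A C xs f) \<subseteq> msg_alphabet C (length f)) \<and>
     (\<forall>ys f. set_pmf (msg_B C ys f) \<subseteq> msg_alphabet C (length f)) \<and>
     finite (key_alphabet C) \<and>
     (\<forall>xs f. set_pmf (key_A C xs f) \<subseteq> key_alphabet C) \<and>
     (\<forall>ys f. set_pmf (key_B C ys f) \<subseteq> key_alphabet C)"

text \<open>Messages are counted from 0 here, so Alice speaks at the even positions.\<close>

primrec transcript :: "('x, 'y) protocol \<Rightarrow> 'x list \<Rightarrow> 'y list \<Rightarrow> nat \<Rightarrow> nat list pmf" where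
  "transcript C xs ys 0 = return_pmf []"
| "transcript C xs ys (Suc i) =
     do { f \<leftarrow> transcript C xs ys i;
          m \<leftarrow> (if even i then msg_A C xs f else msg_B C ys f);
          return_pmf (f @ [m]) }"

text \<open>The joint law of $(X^n, Y^n, Z^n, F_{1:r}, K_A, K_B)$.\<close>

definition run_protocol ::
    "('x \<times> 'y \<times> 'z) pmf \<Rightarrow> nat \<Rightarrow> ('x, 'y) protocol \<Rightarrow>
     ('x list \<times> 'y list \<times> 'z list \<times> nat list \<times> nat \<times> nat) pmf" where
  "run_protocol p n C =
     do { w \<leftarrow> replicate_pmf n p;
          let xs = map (\<lambda>(x, y, z). x) w;
          let ys = map (\<lambda>(x, y, z). y) w;
          let zs = map (\<lambda>(x, y, z). z) w;
          f \<leftarrow> transcript C xs ys (rounds C);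
          ka \<leftarrow> key_A C xs f;
          kb \<leftarrow> key_B C ys f;
          return_pmf (xs, ys, zs, f, ka, kb) }"

definition is_code ::
    "('x::finite \<times> 'y::finite \<times> 'z::finite) pmf \<Rightarrow> nat \<Rightarrow> real \<Rightarrow> real \<Rightarrow> ('x, 'y) protocol \<Rightarrow> bool" where
  "is_code p n R \<delta> C \<longleftrightarrow>
     n > 0 \<and> valid_protocol C \<and>
     (let q = run_protocol p n C in
        R = pmf_entropy q (\<lambda>(xs, ys, zs, f, ka, kb). ka) / n \<and>
        \<P>((xs, ys, zs, f, ka, kb) in q. ka = kb) \<ge> 1 - \<delta> \<and>
        R \<ge> log 2 (card (key_alphabet C)) / n - \<delta> \<and>
        pmf_mutual_info q (\<lambda>(xs, ys, zs, f, ka, kb). ka) (\<lambda>(xs, ys, zs, f, ka, kb). (zs, f)) / n \<le> \<delta>)"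

definition eve_equivocation ::
    "('x::finite \<times> 'y::finite \<times> 'z::finite) pmf \<Rightarrow> nat \<Rightarrow> ('x, 'y) protocol \<Rightarrow> real" where
  "eve_equivocation p n C =
     pmf_cond_entropy (run_protocol p n C)
       (\<lambda>(xs, ys, zs, f, ka, kb). zs) (\<lambda>(xs, ys, zs, f, ka, kb). f) / n"

definition achievable ::
    "('x::finite \<times> 'y::finite \<times> 'z::finite) pmf \<Rightarrow> real \<Rightarrow> real \<Rightarrow> bool" where
  "achievable p \<Delta> R \<longleftrightarrow>
     (\<exists>n Rs \<delta> C L.
        (\<forall>k. is_code p (n k) (Rs k) (\<delta> k) (C k)) \<and>
        filterlim n at_top sequentially \<and> \<delta> \<longlonglongrightarrow> 0 \<and> Rs \<longlonglongrightarrow> R \<and>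
        (\<lambda>k. eve_equivocation p (n k) (C k)) \<longlonglongrightarrow> L \<and> L \<ge> \<Delta>)"

text \<open>In \<^typ>\<open>ereal\<close> the supremum of the empty set is $-\infty$.\<close>

definition key_capacity ::
    "('x::finite \<times> 'y::finite \<times> 'z::finite) pmf \<Rightarrow> real \<Rightarrow> ereal" where
  "key_capacity p \<Delta> = (SUP R\<in>{R. achievable p \<Delta> R}. ereal R)"


section \<open>The upper bound\<close>

text \<open>The finite alphabet of $J$ is encoded as a finite set of natural numbers.\<close>

definition is_extension :: "('x \<times> 'y \<times> 'z) pmf \<Rightarrow> ('x \<times> 'y \<times> 'z \<times> nat) pmf \<Rightarrow> bool" where
  "is_extension p pJ \<longleftrightarrow>
     map_pmf (\<lambda>(x, y, z, j). (x, y, z)) pJ = p \<and> finite ((\<lambda>(x, y, z, j). j) ` set_pmf pJ)"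

text \<open>
  \<open>feasible \<Delta> pJ q\<close>: \<open>q\<close> is the joint law of $(X,Y,Z,J,U,V)$ for an admissible pair $(U,V)$, where
  \<open>pJ\<close> is the law of $(X,Y,Z,J)$.  An alphabet of size at most $m$ is relabelled as a subset
  of \<open>{..<m}\<close>.
\<close>

definition feasible ::
    "real \<Rightarrow> ('x::finite \<times> 'y::finite \<times> 'z::finite \<times> nat) pmf \<Rightarrow>
     ('x \<times> 'y \<times> 'z \<times> nat \<times> nat \<times> nat) pmf \<Rightarrow> bool" where
  "feasible \<Delta> pJ q \<longleftrightarrow>
     map_pmf (\<lambda>(x, y, z, j, u, v). (x, y, z, j)) q = pJ \<and>
     pmf_cond_indep q (\<lambda>(x, y, z, j, u, v). (u, v)) (\<lambda>(x, y, z, j, u, v). (j, z))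
                      (\<lambda>(x, y, z, j, u, v). (x, y)) \<and>
     pmf_mutual_info q (\<lambda>(x, y, z, j, u, v). v) (\<lambda>(x, y, z, j, u, v). z)
       \<le> pmf_mutual_info q (\<lambda>(x, y, z, j, u, v). v) (\<lambda>(x, y, z, j, u, v). j)
          + pmf_entropy q (\<lambda>(x, y, z, j, u, v). z) - \<Delta> \<and>
     (\<lambda>(x, y, z, j, u, v). v) ` set_pmf q \<subseteq> {..<CARD('x) * CARD('y) + 1} \<and>
     (\<lambda>(x, y, z, j, u, v). u) ` set_pmf q \<subseteq> {..<CARD('x) * CARD('y)}"

definition objective ::
    "('x::finite \<times> 'y::finite \<times> 'z::finite \<times> nat \<times> nat \<times> nat) pmf \<Rightarrow> real" where
  "objective q =
     pmf_cond_mutual_info q (\<lambda>(x, y, z, j, u, v). x) (\<lambda>(x, y, z, j, u, v). y) (\<lambda>(x, y, z, j, u, v). j)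
   + pmf_cond_mutual_info q (\<lambda>(x, y, z, j, u, v). u) (\<lambda>(x, y, z, j, u, v). j) (\<lambda>(x, y, z, j, u, v). v)
   - pmf_cond_mutual_info q (\<lambda>(x, y, z, j, u, v). u) (\<lambda>(x, y, z, j, u, v). z) (\<lambda>(x, y, z, j, u, v). v)"

text \<open>The additional constraint $H(X,Y|U,V,Z)=0$.\<close>

definition xy_determined ::
    "('x::finite \<times> 'y::finite \<times> 'z::finite \<times> nat \<times> nat \<times> nat) pmf \<Rightarrow> bool" where
  "xy_determined q \<longleftrightarrow>
     pmf_cond_entropy q (\<lambda>(x, y, z, j, u, v). (x, y)) (\<lambda>(x, y, z, j, u, v). (u, v, z)) = 0"

text \<open>\<open>is_max S m\<close>: the maximum of \<open>S\<close> is attained and equals \<open>m\<close>, or \<open>S\<close> is empty and $m=-\infty$.\<close>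

definition is_max :: "real set \<Rightarrow> ereal \<Rightarrow> bool" where
  "is_max S m \<longleftrightarrow>
     (if S = {} then m = -\<infinity> else \<exists>s\<in>S. m = ereal s \<and> (\<forall>t\<in>S. t \<le> s))"

definition inner_max :: "real \<Rightarrow> ('x::finite \<times> 'y::finite \<times> 'z::finite \<times> nat) pmf \<Rightarrow> ereal" where
  "inner_max \<Delta> pJ = (SUP q\<in>{q. feasible \<Delta> pJ q}. ereal (objective q))"

definition Psi :: "('x::finite \<times> 'y::finite \<times> 'z::finite) pmf \<Rightarrow> real \<Rightarrow> ereal" where
  "Psi p \<Delta> = (INF pJ\<in>{pJ. is_extension p pJ}. inner_max \<Delta> pJ)"

end

theory Submission
  imports Defs
begin

text \<open>
  Everything about \<open>(U, V)\<close> is expressed through the vectors \<open>a v u = (P(X = x, Y = y, U = u, V = v))\<close> indexed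
  by \<open>(x, y)\<close> and one positively homogeneous function \<open>phi = H(J) - H(Z)\<close> of such vectors: the objective is
  \<open>I(X;Y|J) + (\<Sum>v. phi (\<Sum>u. a v u)) - (\<Sum>v u. phi (a v u))\<close> and the constraint reads
  \<open>(\<Sum>v. phi (\<Sum>u. a v u)) \<le> H(J) - \<Delta>\<close>.  Hence the cardinality bounds are the sizes of basic solutions of two linear
  programs, one in dimension \<open>|\<X>||\<Y>| + 1\<close> for \<open>V\<close> and one in dimension \<open>|\<X>||\<Y>|\<close> for \<open>U\<close>.  If
  \<open>Z = f(X,Y)\<close>, the vectors can first be split into ones with a single \<open>(x, y)\<close> in each fibre of \<open>f\<close>.

  For the converse, \<open>J\<^sup>n\<close> is attached to a code memorylessly.  Conditioned on \<open>J\<^sup>n\<close>, public discussion does not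
  increase the mutual information of the parties, so with Fano's inequality \<open>H(K|F,J\<^sup>n)\<close> is at most
  \<open>n I(X;Y|J)\<close> up to \<open>o(n)\<close>.  The remaining terms telescope along the hybrids \<open>(J\<^sub>1, \<dots>, J\<^sub>i, Z\<^sub>i\<^sub>+\<^sub>1, \<dots>, Z\<^sub>n)\<close>, which yields
  \<open>U = K\<close> and \<open>V = (i, F, J\<^sub>1, \<dots>, J\<^sub>i\<^sub>-\<^sub>1, Z\<^sub>i\<^sub>+\<^sub>1, \<dots>, Z\<^sub>n)\<close> with \<open>i\<close> uniform.  After the cardinality reduction all
  these pairs live in one compact set, and a limit point gives the bound.
\<close>

section \<open>Entropy of finitely supported distributions\<close>

text \<open>The program for \<open>V\<close> has to keep the law of \<open>(X, Y)\<close>, which is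
  |X||Y| numbers with the normalisation among them, and one further number,
  \<open>\<Sum>v. phi (\<Sum>u. a v u)\<close>: it occurs in the objective and is all that the
  constraint sees of \<open>(U, V)\<close>. Given \<open>V = v\<close>, the program for
  \<open>U\<close> only has to keep the vector \<open>\<Sum>u. a v u\<close>, since its
  \<open>phi\<close>-value is kept with it. The last sum of the objective is linear in the weights
  and is what both programs optimise. The obstacle in the converse is that the natural
  \<open>V\<close> carries a transcript and n - 1 letters, so its alphabet grows with n and no limit
  of these pairs makes sense before the reduction. The kernel from \<open>(X, Y)\<close> to
  \<open>(Z, J)\<close> stays fixed throughout: the Markov condition says that \<open>(U, V)\<close>
  adds nothing to it, and therefore vectors over \<open>(x, y)\<close> suffice to compute all
  entropy differences involved.\<close>

definition ent :: "'a pmf \<Rightarrow> real" where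
  "ent p = - (\<Sum>a\<in>set_pmf p. pmf p a * log 2 (pmf p a))"

lemma distributed_map_pmf:
  fixes A :: "'w \<Rightarrow> 'a"
  shows "distributed (measure_pmf q) (count_space UNIV) A (\<lambda>x. ennreal (pmf (map_pmf A q) x))"
proof -
  have "distr (measure_pmf q) (count_space UNIV) A = density (count_space UNIV) (\<lambda>x. ennreal (pmf (map_pmf A q) x))"
    by (simp only: map_pmf_rep_eq[symmetric] measure_pmf_eq_density[symmetric])
  thus ?thesis unfolding distributed_def by auto
qed

lemma integrable_pmf_times:
  assumes "finite (set_pmf p)"
  shows "integrable (count_space UNIV) (\<lambda>x. pmf p x * (g x :: real))"
proof -
  have "integrable (measure_pmf p) g"
    using assms by (rule integrable_measure_pmf_finite)
  thus ?thesis
    by (simp add: measure_pmf_eq_density integrable_density)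
qed

lemma finite_set_map_pmf: "finite (set_pmf q) \<Longrightarrow> finite (set_pmf (map_pmf A q))"
  by simp

lemma information_space_pmf: "information_space (measure_pmf q) 2"
  by unfold_locales auto

lemma entropy_pmf:
  assumes "finite (set_pmf q)"
  shows "prob_space.entropy (measure_pmf q) 2 (count_space UNIV) A = ent (map_pmf A q)"
proof -
  let ?p = "map_pmf A q"
  have "prob_space.entropy (measure_pmf q) 2 (count_space UNIV) A = - (\<integral>x. pmf ?p x * log 2 (pmf ?p x) \<partial>count_space UNIV)"
    by (rule information_space.entropy_distr[OF information_space_pmf distributed_map_pmf]) simp
  also have "(\<integral>x. pmf ?p x * log 2 (pmf ?p x) \<partial>count_space UNIV)
      = (\<Sum>a | a \<in> UNIV \<and> pmf ?p a * log 2 (pmf ?p a) \<noteq> 0. pmf ?p a * log 2 (pmf ?p a))"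
    by (rule lebesgue_integral_count_space_finite_support, rule finite_subset[of _ "set_pmf ?p"])
       (auto simp: set_pmf_iff finite_set_map_pmf assms simp del: set_map_pmf)
  also have "\<dots> = (\<Sum>a\<in>set_pmf ?p. pmf ?p a * log 2 (pmf ?p a))"
    using assms by (intro sum.mono_neutral_left)
      (auto simp: set_pmf_iff finite_set_map_pmf simp del: set_map_pmf)
  finally show ?thesis by (simp add: ent_def)
qed

lemma pmf_entropy_eq:
  "finite (set_pmf q) \<Longrightarrow> pmf_entropy q A = ent (map_pmf A q)"
  by (simp add: pmf_entropy_def entropy_pmf)

text \<open>Countability of both types makes the product of counting measures a counting measure
  again, so the library quantities for pairs become entropies on one discrete space.\<close>

lemma pair_count_space_UNIV:
  "count_space (UNIV :: 'a::countable set) \<Otimes>\<^sub>M count_space (UNIV :: 'b::countable set) = count_space UNIV"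
  by (subst pair_measure_countable) auto

lemma pmf_mutual_info_eq:
  assumes "finite (set_pmf q)"
  shows "pmf_mutual_info q A B = ent (map_pmf A q) + ent (map_pmf B q) - ent (map_pmf (\<lambda>w. (A w, B w)) q)"
proof -
  have "prob_space.mutual_information (measure_pmf q) 2 (count_space UNIV) (count_space UNIV) A B
    = prob_space.entropy (measure_pmf q) 2 (count_space UNIV) A + prob_space.entropy (measure_pmf q) 2 (count_space UNIV) B
      - prob_space.entropy (measure_pmf q) 2 (count_space UNIV \<Otimes>\<^sub>M count_space UNIV) (\<lambda>w. (A w, B w))"
    by (rule information_space.mutual_information_eq_entropy_conditional_entropy_distr
          [OF information_space_pmf _ _ distributed_map_pmf _ distributed_map_pmf _ distributed_map_pmf[of q "\<lambda>w. (A w, B w)", folded pair_count_space_UNIV]])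
       (simp_all only: pair_count_space_UNIV pmf_nonneg integrable_pmf_times finite_set_map_pmf assms sigma_finite_measure_count_space_countable countableI_type)
  thus ?thesis
    by (simp add: pmf_mutual_info_def pair_count_space_UNIV entropy_pmf assms)
qed

lemma pmf_cond_entropy_eq:
  assumes "finite (set_pmf q)"
  shows "pmf_cond_entropy q A B = ent (map_pmf (\<lambda>w. (A w, B w)) q) - ent (map_pmf B q)"
proof -
  have "prob_space.conditional_entropy (measure_pmf q) 2 (count_space UNIV) (count_space UNIV) A B
    = prob_space.entropy (measure_pmf q) 2 (count_space UNIV \<Otimes>\<^sub>M count_space UNIV) (\<lambda>w. (A w, B w)) - prob_space.entropy (measure_pmf q) 2 (count_space UNIV) B"
    by (rule information_space.conditional_entropy_eq_entropy
          [OF information_space_pmf _ _ distributed_map_pmf _ distributed_map_pmf[of q "\<lambda>w. (A w, B w)", folded pair_count_space_UNIV]])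
       (simp_all only: pair_count_space_UNIV pmf_nonneg integrable_pmf_times finite_set_map_pmf assms sigma_finite_measure_count_space_countable countableI_type)
  thus ?thesis
    by (simp add: pmf_cond_entropy_def pair_count_space_UNIV entropy_pmf assms)
qed

lemma pmf_cond_mutual_info_eq:
  assumes "finite (set_pmf q)"
  shows "pmf_cond_mutual_info q A B C =
    ent (map_pmf (\<lambda>w. (A w, C w)) q) + ent (map_pmf (\<lambda>w. (B w, C w)) q)
    - ent (map_pmf (\<lambda>w. (A w, B w, C w)) q) - ent (map_pmf C q)"
proof -
  \<comment> \<open>This difference is the library definition of conditional mutual information, so
    only the unconditional case needs densities.\<close>
  have "pmf_cond_mutual_info q A B C
      = pmf_mutual_info q A (\<lambda>w. (B w, C w)) - pmf_mutual_info q A C"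
    by (simp add: pmf_cond_mutual_info_def pmf_mutual_info_def prob_space.conditional_mutual_information_def[OF measure_pmf.prob_space_axioms]
        pair_count_space_UNIV)
  thus ?thesis by (simp add: pmf_mutual_info_eq assms)
qed

lemma pmf_map_eq_sum:
  assumes "finite (set_pmf q)"
  shows "pmf (map_pmf f q) x = (\<Sum>w | w \<in> set_pmf q \<and> f w = x. pmf q w)"
proof -
  have "pmf (map_pmf f q) x = measure (measure_pmf q) (f -` {x})" by (simp add: pmf_map)
  also have "\<dots> = measure (measure_pmf q) {w. w \<in> set_pmf q \<and> f w = x}"
    by (subst measure_Int_set_pmf[symmetric]) (auto intro!: arg_cong[where f="measure _"])
  also have "\<dots> = (\<Sum>w | w \<in> set_pmf q \<and> f w = x. pmf q w)"
    using assms by (intro measure_measure_pmf_finite) auto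
  finally show ?thesis .
qed

lemma sum_map_pmf:
  assumes "finite (set_pmf q)"
  shows "(\<Sum>a\<in>set_pmf (map_pmf A q). pmf (map_pmf A q) a * (f a :: real)) = (\<Sum>w\<in>set_pmf q. pmf q w * f (A w))"
proof -
  have "(\<Sum>w\<in>set_pmf q. pmf q w * f (A w)) = (\<Sum>a\<in>A ` set_pmf q. \<Sum>w | w \<in> set_pmf q \<and> A w = a. pmf q w * f (A w))"
    using assms by (rule sum.image_gen)
  also have "\<dots> = (\<Sum>a\<in>A ` set_pmf q. pmf (map_pmf A q) a * f a)"
    by (intro sum.cong) (auto simp: pmf_map_eq_sum assms sum_distrib_right)
  finally show ?thesis by simp
qed

text \<open>Summing over sample points instead of values puts the entropies of different variables
  over one common index set.\<close>

lemma ent_map_eq: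
  assumes "finite (set_pmf q)"
  shows "ent (map_pmf A q) = - (\<Sum>w\<in>set_pmf q. pmf q w * log 2 (pmf (map_pmf A q) (A w)))"
  unfolding ent_def by (subst sum_map_pmf[OF assms]) simp

text \<open>Entropy only depends on the partition that a variable induces on the support. This is
  the tool for reordering tuples and for passing to equivalent variables.\<close>

lemma ent_map_cong:
  assumes "finite (set_pmf q)"
    and "\<And>w w'. w \<in> set_pmf q \<Longrightarrow> w' \<in> set_pmf q \<Longrightarrow> A w = A w' \<longleftrightarrow> B w = B w'"
  shows "ent (map_pmf A q) = ent (map_pmf B q)"
proof -
  have "pmf (map_pmf A q) (A w) = pmf (map_pmf B q) (B w)" if "w \<in> set_pmf q" for w
    unfolding pmf_map_eq_sum[OF assms(1)] using assms(2) that by (intro sum.cong) auto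
  thus ?thesis by (simp add: ent_map_eq assms)
qed

section \<open>Gibbs' inequality, submodularity and Fano's inequality\<close>

lemma sum_set_pmf: "finite (set_pmf p) \<Longrightarrow> (\<Sum>a\<in>set_pmf p. pmf p a) = 1"
  by (rule sum_pmf_eq_1) auto

lemma pmf_map_pos: "w \<in> set_pmf q \<Longrightarrow> pmf (map_pmf A q) (A w) > 0"
  by (simp add: pmf_positive)

text \<open>Follows termwise from \<open>ln t \<le> t - 1\<close> at
  \<open>t = r a / pmf p a\<close>.\<close>

lemma gibbs_inequality:
  assumes "finite (set_pmf p)" "\<And>a. a \<in> set_pmf p \<Longrightarrow> r a > 0" "(\<Sum>a\<in>set_pmf p. r a) \<le> 1"
  shows "ent p \<le> - (\<Sum>a\<in>set_pmf p. pmf p a * log 2 (r a))"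
proof -
  have *: "pmf p a * ln (r a) - pmf p a * ln (pmf p a) \<le> r a - pmf p a" if a: "a \<in> set_pmf p" for a
  proof -
    have pa: "pmf p a > 0" using a by (simp add: pmf_positive)
    have "ln (r a / pmf p a) \<le> r a / pmf p a - 1"
      using pa assms(2)[OF a] by (intro ln_le_minus_one) auto
    hence "pmf p a * ln (r a / pmf p a) \<le> pmf p a * (r a / pmf p a - 1)"
      using pa by (intro mult_left_mono) auto
    thus ?thesis using pa assms(2)[OF a] by (simp add: ln_div right_diff_distrib)
  qed
  have "(\<Sum>a\<in>set_pmf p. pmf p a * ln (r a) - pmf p a * ln (pmf p a)) \<le> (\<Sum>a\<in>set_pmf p. r a - pmf p a)"
    by (intro sum_mono *)
  also have "\<dots> \<le> 0" using assms by (simp add: sum_subtractf sum_set_pmf)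
  finally have "(\<Sum>a\<in>set_pmf p. pmf p a * ln (r a)) / ln 2 \<le> (\<Sum>a\<in>set_pmf p. pmf p a * ln (pmf p a)) / ln 2"
    by (intro divide_right_mono) (auto simp: sum_subtractf)
  thus ?thesis by (simp add: ent_def log_def sum_divide_distrib)
qed

lemma pmf_marginal:
  assumes "finite (set_pmf q)" "finite S" "A ` set_pmf q \<subseteq> S"
  shows "(\<Sum>a\<in>S. pmf (map_pmf (\<lambda>w. (A w, B w)) q) (a, b)) = pmf (map_pmf B q) b"
proof -
  have "pmf (map_pmf B q) b = (\<Sum>w | w \<in> set_pmf q \<and> B w = b. pmf q w)"
    by (rule pmf_map_eq_sum[OF assms(1)])
  also have "\<dots> = (\<Sum>a\<in>S. \<Sum>w\<in>{w\<in>{w. w \<in> set_pmf q \<and> B w = b}. A w = a}. pmf q w)"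
    using assms by (intro sum.group[symmetric]) auto
  also have "\<dots> = (\<Sum>a\<in>S. pmf (map_pmf (\<lambda>w. (A w, B w)) q) (a, b))"
    unfolding pmf_map_eq_sum[OF assms(1)] by (intro sum.cong) auto
  finally show ?thesis by simp
qed

text \<open>Gibbs' inequality for the joint law against \<open>r a b * pmf (map_pmf B q) b\<close>,
  whose second factor contributes exactly \<open>H(B)\<close>. Here \<open>r a b\<close> is a guess
  at the conditional law of \<open>A\<close> given \<open>B\<close>: the true law given less
  information yields submodularity, a guess centred at \<open>b\<close> yields Fano's
  inequality.\<close>

lemma conditional_gibbs:
  assumes fin: "finite (set_pmf q)" and nn: "\<And>a b. r a b \<ge> 0"
    and pos: "\<And>w. w \<in> set_pmf q \<Longrightarrow> r (A w) (B w) > 0"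
    and le: "\<And>w. w \<in> set_pmf q \<Longrightarrow> (\<Sum>a\<in>A ` set_pmf q. r a (B w)) \<le> 1"
  shows "ent (map_pmf (\<lambda>w. (A w, B w)) q) - ent (map_pmf B q)
     \<le> - (\<Sum>w\<in>set_pmf q. pmf q w * log 2 (r (A w) (B w)))"
proof -
  let ?p = "map_pmf (\<lambda>w. (A w, B w)) q" and ?B = "map_pmf B q"
  let ?r = "\<lambda>(a, b). r a b * pmf ?B b"
  have "(\<Sum>x\<in>set_pmf ?p. ?r x) \<le> (\<Sum>x\<in>A ` set_pmf q \<times> B ` set_pmf q. ?r x)"
    using fin nn by (intro sum_mono2) auto
  also have "\<dots> = (\<Sum>a\<in>A ` set_pmf q. \<Sum>b\<in>B ` set_pmf q. r a b * pmf ?B b)"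
    by (simp add: sum.cartesian_product)
  also have "\<dots> = (\<Sum>b\<in>B ` set_pmf q. (\<Sum>a\<in>A ` set_pmf q. r a b) * pmf ?B b)"
    by (subst sum.swap) (simp add: sum_distrib_right)
  also have "\<dots> \<le> (\<Sum>b\<in>B ` set_pmf q. 1 * pmf ?B b)"
    using le by (intro sum_mono mult_right_mono) auto
  also have "\<dots> = 1" using sum_set_pmf[of ?B] fin by simp
  finally have "ent ?p \<le> - (\<Sum>x\<in>set_pmf ?p. pmf ?p x * log 2 (?r x))"
    using fin pos by (intro gibbs_inequality) (auto intro!: mult_pos_pos pmf_map_pos)
  also have "\<dots> = - (\<Sum>w\<in>set_pmf q. pmf q w * log 2 (?r (A w, B w)))"
    by (subst sum_map_pmf[OF fin]) simp
  also have "(\<Sum>w\<in>set_pmf q. pmf q w * log 2 (?r (A w, B w))) =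
     (\<Sum>w\<in>set_pmf q. pmf q w * log 2 (r (A w) (B w)) + pmf q w * log 2 (pmf ?B (B w)))"
    using pos pmf_map_pos[of _ q B] by (intro sum.cong) (auto simp: log_mult distrib_left less_imp_neq[symmetric])
  also have "- \<dots> = ent ?B - (\<Sum>w\<in>set_pmf q. pmf q w * log 2 (r (A w) (B w)))"
    by (simp add: sum.distrib ent_map_eq[OF fin])
  finally show ?thesis by simp
qed

text \<open>This is \<open>H(A|B,C) \<le> H(A|C)\<close>: the conditional law of \<open>A\<close>
  given \<open>C\<close> alone is an admissible guess when \<open>(B, C)\<close> is known.\<close>

lemma ent_submodular:
  assumes fin: "finite (set_pmf q)"
  shows "ent (map_pmf (\<lambda>w. (A w, B w, C w)) q) + ent (map_pmf C q)
     \<le> ent (map_pmf (\<lambda>w. (A w, C w)) q) + ent (map_pmf (\<lambda>w. (B w, C w)) q)"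
proof -
  let ?AC = "map_pmf (\<lambda>w. (A w, C w)) q" and ?C = "map_pmf C q"
  have pos: "pmf ?AC (A w, C w) > 0" "pmf ?C (C w) > 0" if "w \<in> set_pmf q" for w
    using pmf_map_pos[OF that, of "\<lambda>w. (A w, C w)"] pmf_map_pos[OF that, of C] by auto
  have "ent (map_pmf (\<lambda>w. (A w, (B w, C w))) q) - ent (map_pmf (\<lambda>w. (B w, C w)) q)
    \<le> - (\<Sum>w\<in>set_pmf q. pmf q w * log 2 ((\<lambda>a (b, c). pmf ?AC (a, c) / pmf ?C c) (A w) (B w, C w)))"
  proof (rule conditional_gibbs[OF fin])
    fix w assume w: "w \<in> set_pmf q"
    have "(\<Sum>a\<in>A ` set_pmf q. pmf ?AC (a, C w) / pmf ?C (C w)) = pmf ?C (C w) / pmf ?C (C w)"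
      using pmf_marginal[OF fin, of "A ` set_pmf q" A C "C w"] fin
      by (simp add: sum_divide_distrib[symmetric])
    thus "(\<Sum>a\<in>A ` set_pmf q. case (B w, C w) of (b, c) \<Rightarrow> pmf ?AC (a, c) / pmf ?C c) \<le> 1"
      using pos[OF w] by simp
  qed (auto simp: pos)
  also have "\<dots> = - (\<Sum>w\<in>set_pmf q. pmf q w * log 2 (pmf ?AC (A w, C w)) - pmf q w * log 2 (pmf ?C (C w)))"
    using pos by (intro arg_cong[where f=uminus] sum.cong) (auto simp: log_divide right_diff_distrib less_imp_neq[symmetric])
  also have "\<dots> = ent ?AC - ent ?C"
    by (simp add: sum_subtractf ent_map_eq[OF fin])
  finally show ?thesis by simp
qed

lemma ent_return [simp]: "ent (return_pmf c) = 0"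
  by (simp add: ent_def)

lemma ent_pair_le:
  assumes fin: "finite (set_pmf q)"
  shows "ent (map_pmf (\<lambda>w. (A w, B w)) q) \<le> ent (map_pmf A q) + ent (map_pmf B q)"
proof -
  have "ent (map_pmf (\<lambda>w. (A w, B w, ())) q) = ent (map_pmf (\<lambda>w. (A w, B w)) q)"
    "ent (map_pmf (\<lambda>w. (A w, ())) q) = ent (map_pmf A q)" "ent (map_pmf (\<lambda>w. (B w, ())) q) = ent (map_pmf B q)"
    by (rule ent_map_cong; auto simp: fin)+
  with ent_submodular[OF fin, of A B "\<lambda>_. ()"] show ?thesis by simp
qed

text \<open>A form with the constant 1 in place of the binary entropy of the error probability; the
  constant disappears after division by n.\<close>

lemma fano:
  assumes fin: "finite (set_pmf q)" and K: "finite K" "A ` set_pmf q \<subseteq> K"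
  shows "ent (map_pmf (\<lambda>w. (A w, B w)) q) - ent (map_pmf B q)
     \<le> 1 + measure_pmf.prob q {w. A w \<noteq> B w} * log 2 (card K)"
proof -
  have cK: "card K > 0" using K set_pmf_not_empty[of q] by (subst card_gt_0_iff) auto
  \<comment> \<open>The guess mixes the point mass at \<open>b\<close> and the uniform law on
    \<open>K\<close>, each with weight 1/2: it costs at most 1 bit when \<open>A = B\<close> and
    exactly \<open>1 + log 2 (card K)\<close> bits otherwise.\<close>
  let ?r = "\<lambda>a b. (if a = b then 1/2 else 0) + 1 / (2 * real (card K))"
  have "ent (map_pmf (\<lambda>w. (A w, B w)) q) - ent (map_pmf B q)
     \<le> - (\<Sum>w\<in>set_pmf q. pmf q w * log 2 (?r (A w) (B w)))"
  proof (rule conditional_gibbs[OF fin])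
    fix w
    have "(\<Sum>a\<in>A ` set_pmf q. ?r a (B w)) \<le> (\<Sum>a\<in>K. ?r a (B w))"
      using K by (intro sum_mono2) auto
    also have "\<dots> \<le> 1" using K cK by (simp add: sum.distrib sum.delta')
    finally show "(\<Sum>a\<in>A ` set_pmf q. ?r a (B w)) \<le> 1" .
  qed (use cK in \<open>auto intro!: add_pos_pos\<close>)
  also have "\<dots> = (\<Sum>w\<in>set_pmf q. pmf q w * - log 2 (?r (A w) (B w)))" by (simp add: sum_negf)
  also have "\<dots> \<le> (\<Sum>w\<in>set_pmf q. pmf q w * (1 + (if A w \<noteq> B w then log 2 (card K) else 0)))"
  proof (intro sum_mono mult_left_mono)
    fix w
    show "- log 2 (?r (A w) (B w)) \<le> 1 + (if A w \<noteq> B w then log 2 (card K) else 0)"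
    proof (cases "A w = B w")
      case True
      have "- 1 = log 2 (1/2::real)" by (simp add: log_divide)
      also have "\<dots> \<le> log 2 (1/2 + 1 / (2 * real (card K)))" using cK by (subst log_le_cancel_iff) (auto intro!: add_pos_pos)
      finally show ?thesis using True by simp
    next
      case False
      thus ?thesis using cK by (simp add: log_divide log_mult)
    qed
  qed auto
  also have "\<dots> = 1 + (\<Sum>w\<in>set_pmf q. (if A w \<noteq> B w then pmf q w else 0) * log 2 (card K))"
    by (simp add: distrib_left sum.distrib sum_set_pmf fin if_distrib[of "\<lambda>x. _ * x"] if_distrib[of "\<lambda>x. x * _"] cong: if_cong)
  also have "(\<Sum>w\<in>set_pmf q. (if A w \<noteq> B w then pmf q w else 0) * log 2 (card K))
     = (\<Sum>w\<in>set_pmf q. if A w \<noteq> B w then pmf q w else 0) * log 2 (card K)"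
    by (rule sum_distrib_right[symmetric])
  also have "(\<Sum>w\<in>set_pmf q. if A w \<noteq> B w then pmf q w else 0) = (\<Sum>w\<in>{w\<in>set_pmf q. A w \<noteq> B w}. pmf q w)"
    by (rule sum.inter_filter[symmetric, OF fin])
  also have "\<dots> = measure_pmf.prob q {w\<in>set_pmf q. A w \<noteq> B w}"
    using fin by (intro measure_measure_pmf_finite[symmetric]) auto
  also have "\<dots> = measure_pmf.prob q {w. A w \<noteq> B w}"
    by (subst (2) measure_Int_set_pmf[symmetric]) (auto intro!: arg_cong[where f="measure _"])
  finally show ?thesis .
qed

section \<open>Chain rule and i.i.d. blocks\<close>

lemma pmf_bind_Pair:
  "pmf (bind_pmf P (\<lambda>a. map_pmf (Pair a) (k a))) (a, m) = pmf P a * pmf (k a) m"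
proof -
  have "pmf (map_pmf (Pair x) (k x)) (a, m) = indicator {a} x * pmf (k a) m" for x
  proof (cases "x = a")
    case True
    thus ?thesis by (simp add: pmf_map_inj' inj_on_def)
  next
    case False
    hence "(a, m) \<notin> set_pmf (map_pmf (Pair x) (k x))" by auto
    hence "pmf (map_pmf (Pair x) (k x)) (a, m) = 0" by (simp only: set_pmf_iff not_not)
    thus ?thesis using False by simp
  qed
  thus ?thesis by (simp add: pmf_bind measure_pmf_single)
qed

text \<open>Chain rule: the joint mass is \<open>pmf P a * pmf (k a) m\<close>, so its logarithm
  splits, and the second part averages the entropies of the kernel.\<close>

lemma ent_bind_Pair:
  assumes "finite (set_pmf P)" "\<And>a. a \<in> set_pmf P \<Longrightarrow> finite (set_pmf (k a))"
  shows "ent (bind_pmf P (\<lambda>a. map_pmf (Pair a) (k a))) = ent P + (\<Sum>a\<in>set_pmf P. pmf P a * ent (k a))"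
proof -
  let ?q = "bind_pmf P (\<lambda>a. map_pmf (Pair a) (k a))"
  have S: "set_pmf ?q = Sigma (set_pmf P) (\<lambda>a. set_pmf (k a))" by auto
  have "(\<Sum>x\<in>set_pmf ?q. pmf ?q x * log 2 (pmf ?q x)) =
    (\<Sum>(a,m)\<in>Sigma (set_pmf P) (\<lambda>a. set_pmf (k a)). pmf P a * pmf (k a) m * log 2 (pmf P a * pmf (k a) m))"
    unfolding S by (intro sum.cong) (auto simp: pmf_bind_Pair)
  also have "\<dots> = (\<Sum>a\<in>set_pmf P. \<Sum>m\<in>set_pmf (k a). pmf P a * pmf (k a) m * log 2 (pmf P a * pmf (k a) m))"
    using assms by (subst sum.Sigma) auto
  also have "\<dots> = (\<Sum>a\<in>set_pmf P. pmf P a * log 2 (pmf P a) + pmf P a * (- ent (k a)))"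
  proof (intro sum.cong refl)
    fix a assume a: "a \<in> set_pmf P"
    have "(\<Sum>m\<in>set_pmf (k a). pmf P a * pmf (k a) m * log 2 (pmf P a * pmf (k a) m)) =
      (\<Sum>m\<in>set_pmf (k a). pmf (k a) m * (pmf P a * log 2 (pmf P a)) + pmf P a * (pmf (k a) m * log 2 (pmf (k a) m)))"
      using a by (intro sum.cong) (auto simp: log_mult set_pmf_iff algebra_simps)
    also have "\<dots> = (\<Sum>m\<in>set_pmf (k a). pmf (k a) m) * (pmf P a * log 2 (pmf P a)) + pmf P a * (- ent (k a))"
      by (simp add: sum.distrib sum_distrib_right sum_distrib_left ent_def)
    finally show "(\<Sum>m\<in>set_pmf (k a). pmf P a * pmf (k a) m * log 2 (pmf P a * pmf (k a) m)) = 
       pmf P a * log 2 (pmf P a) + pmf P a * (- ent (k a))"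
      using assms(2)[OF a] by (simp add: sum_set_pmf)
  qed
  finally show ?thesis by (simp add: ent_def[of ?q] ent_def[of P] sum.distrib sum_negf sum_subtractf)
qed

lemma map_replicate_pmf: "map_pmf (map f) (replicate_pmf n p) = replicate_pmf n (map_pmf f p)"
proof (induction n)
  case (Suc n)
  show ?case by (simp add: map_bind_pmf bind_map_pmf Suc[symmetric])
qed simp

lemma finite_set_replicate_pmf: "finite (set_pmf p) \<Longrightarrow> finite (set_pmf (replicate_pmf n p))"
  unfolding set_replicate_pmf lists_eq_set using finite_lists_length_eq[of "set_pmf p" n] by simp

lemma ent_replicate:
  assumes "finite (set_pmf p)"
  shows "ent (replicate_pmf n p) = n * ent p"
proof (induction n)
  case 0
  show ?case by (simp add: ent_def)
next
  case (Suc n)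
  let ?q = "bind_pmf p (\<lambda>x. map_pmf (Pair x) (replicate_pmf n p))"
  have fin: "finite (set_pmf ?q)" using assms by (auto simp: finite_set_replicate_pmf)
  have "replicate_pmf (Suc n) p = map_pmf (\<lambda>(x, xs). x # xs) ?q"
    by (simp add: map_bind_pmf map_pmf_def bind_assoc_pmf bind_return_pmf)
  also have "ent \<dots> = ent (map_pmf (\<lambda>x. x) ?q)"
    by (rule ent_map_cong[OF fin]) auto
  also have "\<dots> = ent p + (\<Sum>a\<in>set_pmf p. pmf p a * ent (replicate_pmf n p))"
    using assms by (simp add: ent_bind_Pair finite_set_replicate_pmf)
  also have "\<dots> = Suc n * ent p"
    using assms by (simp add: Suc sum_distrib_right[symmetric] sum_set_pmf distrib_right)
  finally show ?case .
qed

section \<open>Basic solutions of linear programs\<close>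

text \<open>More vectors than dimensions admit a nontrivial linear relation, and moving the weights
  along it keeps the weighted sum. Since \<open>l\<close> is positive on every vector, the relation
  has a negative coefficient, so the motion reaches the boundary of the nonnegative orthant.\<close>

lemma linear_program_pivot:
  fixes a :: "'i \<Rightarrow> 'e::euclidean_space"
  assumes fin: "finite I" and card: "card I > DIM('e)"
    and pos: "\<And>i. i \<in> I \<Longrightarrow> l (a i) > (0::real)" and lin: "linear l"
    and w: "\<And>i. i \<in> I \<Longrightarrow> w i > (0::real)"
  shows "\<exists>w'. (\<forall>i\<in>I. w' i \<ge> 0) \<and> (\<exists>i\<in>I. w' i = 0) \<and>
    (\<Sum>i\<in>I. w' i *\<^sub>R a i) = (\<Sum>i\<in>I. w i *\<^sub>R a i) \<and> (\<Sum>i\<in>I. w' i * g i) \<ge> (\<Sum>i\<in>I. w i * g i)"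
proof -
  \<comment> \<open>A repeated vector is not visible in the image of \<open>I\<close>, so this case
    is separate: two indices with the same vector give the relation directly.\<close>
  obtain c where c: "(\<Sum>i\<in>I. c i *\<^sub>R a i) = 0" and c0: "\<exists>i\<in>I. c i \<noteq> 0"
  proof (cases "inj_on a I")
    case True
    have "card (a ` I) > DIM('e)" using card_image[OF True] card by simp
    hence "dependent (a ` I)" using dependent_biggerset[of "a ` I"] fin by auto
    then obtain u v where uv: "(\<Sum>x\<in>a ` I. u x *\<^sub>R x) = 0" "v \<in> a ` I" "u v \<noteq> 0"
      using fin dependent_finite[of "a ` I"] by auto
    show ?thesis
      by (rule that[of "\<lambda>i. u (a i)"]) (use uv in \<open>auto simp: sum.reindex[OF True]\<close>)
  next
    case False
    then obtain i j where ij: "i \<in> I" "j \<in> I" "i \<noteq> j" "a i = a j" by (auto simp: inj_on_def)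
    let ?c = "\<lambda>k. if k = i then 1 else if k = j then - 1 else (0::real)"
    have "(\<Sum>k\<in>I. ?c k *\<^sub>R a k) = (\<Sum>k\<in>{i,j}. ?c k *\<^sub>R a k)"
      using fin ij by (intro sum.mono_neutral_right) auto
    also have "\<dots> = 0" using ij by simp
    finally show ?thesis using ij by (intro that[of ?c]) auto
  qed
  \<comment> \<open>Of the two directions along the relation, the one that does not decrease the
    objective is taken.\<close>
  define d where "d = (if (\<Sum>i\<in>I. c i * g i) \<ge> 0 then c else (\<lambda>i. - c i))"
  have d: "(\<Sum>i\<in>I. d i *\<^sub>R a i) = 0" and d0: "\<exists>i\<in>I. d i \<noteq> 0" and dg: "(\<Sum>i\<in>I. d i * g i) \<ge> 0"
    using c c0 by (auto simp: d_def sum_negf)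
  have "(\<Sum>i\<in>I. d i * l (a i)) = 0"
    using arg_cong[OF d, of l] lin by (simp add: linear_sum linear_cmul linear_0)
  have "\<exists>i\<in>I. d i < 0"
  proof (rule ccontr)
    assume "\<not> ?thesis"
    hence nn: "\<And>i. i \<in> I \<Longrightarrow> d i \<ge> 0" by force
    hence "\<forall>i\<in>I. d i * l (a i) = 0"
      using \<open>(\<Sum>i\<in>I. d i * l (a i)) = 0\<close> pos
      by (subst (asm) sum_nonneg_eq_0_iff) (auto simp: fin less_imp_le)
    with d0 pos show False by force
  qed
  define N where "N = {i\<in>I. d i < 0}"
  have N: "finite N" "N \<noteq> {}" using \<open>\<exists>i\<in>I. d i < 0\<close> fin by (auto simp: N_def)
  \<comment> \<open>The ratio test: \<open>t\<close> is the largest step that keeps all weights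
    nonnegative, and the minimising index ends with weight zero.\<close>
  define t where "t = Min ((\<lambda>i. w i / - d i) ` N)"
  have "t \<in> (\<lambda>i. w i / - d i) ` N" unfolding t_def using N by (intro Min_in) auto
  then obtain k where k: "k \<in> N" "t = w k / - d k" by auto
  have t0: "t \<ge> 0" using k w by (auto simp: N_def divide_nonneg_neg less_imp_le)
  have tle: "t \<le> w i / - d i" if "i \<in> N" for i using that N by (auto simp: t_def)
  show ?thesis
  proof (intro exI[of _ "\<lambda>i. w i + t * d i"] conjI ballI bexI[of _ k])
    fix i assume i: "i \<in> I"
    show "w i + t * d i \<ge> 0"
    proof (cases "d i < 0")
      case True
      hence "t * - d i \<le> w i" using tle[of i] i by (auto simp: N_def field_simps)
      thus ?thesis by simp
    qed (use t0 w[OF i] in auto)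
  next
    show "w k + t * d k = 0" "k \<in> I" using k by (auto simp: N_def field_simps)
  next
    have "(\<Sum>i\<in>I. (w i + t * d i) *\<^sub>R a i) = (\<Sum>i\<in>I. w i *\<^sub>R a i) + t *\<^sub>R (\<Sum>i\<in>I. d i *\<^sub>R a i)"
      by (simp add: scaleR_add_left sum.distrib scaleR_sum_right)
    thus "(\<Sum>i\<in>I. (w i + t * d i) *\<^sub>R a i) = (\<Sum>i\<in>I. w i *\<^sub>R a i)" using d by simp
  next
    have "(\<Sum>i\<in>I. (w i + t * d i) * g i) = (\<Sum>i\<in>I. w i * g i) + t * (\<Sum>i\<in>I. d i * g i)"
      by (simp add: distrib_right sum.distrib sum_distrib_left mult.assoc)
    thus "(\<Sum>i\<in>I. (w i + t * d i) * g i) \<ge> (\<Sum>i\<in>I. w i * g i)" using dg t0 by simp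
  qed
qed

lemma linear_program_basic_solution:
  fixes a :: "'i \<Rightarrow> 'e::euclidean_space"
  assumes fin: "finite I"
    and pos: "\<And>i. i \<in> I \<Longrightarrow> l (a i) > (0::real)" and lin: "linear l"
    and w: "\<And>i. i \<in> I \<Longrightarrow> w i \<ge> (0::real)"
  shows "\<exists>w' K. K \<subseteq> I \<and> card K \<le> DIM('e) \<and> (\<forall>i\<in>K. w' i \<ge> 0) \<and>
    (\<Sum>i\<in>K. w' i *\<^sub>R a i) = (\<Sum>i\<in>I. w i *\<^sub>R a i) \<and> (\<Sum>i\<in>K. w' i * g i) \<ge> (\<Sum>i\<in>I. w i * g i)"
  using assms
proof (induction "card I" arbitrary: I w rule: less_induct)
  case less
  show ?case
  proof (cases "card I \<le> DIM('e)")
    case True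
    thus ?thesis using less.prems by (intro exI[of _ w] exI[of _ I]) auto
  next
    case False
    have "\<exists>w'. (\<forall>i\<in>I. w' i \<ge> 0) \<and> (\<exists>i\<in>I. w' i = 0) \<and>
      (\<Sum>i\<in>I. w' i *\<^sub>R a i) = (\<Sum>i\<in>I. w i *\<^sub>R a i) \<and> (\<Sum>i\<in>I. w' i * g i) \<ge> (\<Sum>i\<in>I. w i * g i)"
    proof (cases "\<exists>i\<in>I. w i = 0")
      case True
      thus ?thesis using less.prems by (intro exI[of _ w]) auto
    next
      case pos: False
      show ?thesis
        using less.prems pos False
        by (intro linear_program_pivot[where l=l]) (auto simp: less_le)
    qed
    then obtain w' k where w': "\<forall>i\<in>I. w' i \<ge> 0" "k \<in> I" "w' k = 0"
      "(\<Sum>i\<in>I. w' i *\<^sub>R a i) = (\<Sum>i\<in>I. w i *\<^sub>R a i)" "(\<Sum>i\<in>I. w' i * g i) \<ge> (\<Sum>i\<in>I. w i * g i)"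
      by blast
    have eq: "(\<Sum>i\<in>I - {k}. w' i *\<^sub>R a i) = (\<Sum>i\<in>I. w' i *\<^sub>R a i)" "(\<Sum>i\<in>I - {k}. w' i * g i) = (\<Sum>i\<in>I. w' i * g i)"
      using w'(3) less.prems(1) by (intro sum.mono_neutral_left; auto)+
    have "card (I - {k}) < card I" using w'(2) less.prems(1) by (rule card_Diff1_less[rotated])
    from less.hyps[OF this, of w'] less.prems w' obtain w'' K where
      "K \<subseteq> I - {k}" "card K \<le> DIM('e)" "\<forall>i\<in>K. w'' i \<ge> 0"
      "(\<Sum>i\<in>K. w'' i *\<^sub>R a i) = (\<Sum>i\<in>I - {k}. w' i *\<^sub>R a i)"
      "(\<Sum>i\<in>K. w'' i * g i) \<ge> (\<Sum>i\<in>I - {k}. w' i * g i)" by auto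
    with eq w' show ?thesis by (intro exI[of _ w''] exI[of _ K]) auto
  qed
qed

lemma ex_bij_betw_subset_lessThan:
  fixes m :: nat
  assumes "finite K" "card K \<le> m"
  obtains h :: "nat \<Rightarrow> 'i" and B where "B \<subseteq> {..<m}" "bij_betw h B K"
proof -
  obtain h where "bij_betw h {..<card K} K"
    using assms(1) ex_bij_betw_nat_finite[of K] by (auto simp: atLeast0LessThan)
  with assms show ?thesis by (intro that[of "{..<card K}" h]) auto
qed

text \<open>Weights can be absorbed into the vectors because \<open>\<phi>\<close> is positively homogeneous, so a basic
  solution of the linear program is again a family of vectors.\<close>

definition reduction :: "(real ^ 's \<Rightarrow> real) \<Rightarrow> (real ^ 's \<Rightarrow> bool) \<Rightarrow> bool" where
  "reduction \<phi> D \<longleftrightarrow>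
     (\<forall>c a. c \<ge> 0 \<longrightarrow> \<phi> (c *\<^sub>R a) = c * \<phi> a) \<and>
     (\<forall>c a. c \<ge> 0 \<longrightarrow> D a \<longrightarrow> D (c *\<^sub>R a)) \<and>
     (\<forall>a. (\<forall>s. a $ s \<ge> 0) \<longrightarrow> (\<exists>(n::nat) d. (\<forall>i<n. D (d i) \<and> (\<forall>s. d i $ s \<ge> 0)) \<and>
       (\<Sum>i<n. d i) = a \<and> (\<Sum>i<n. \<phi> (d i)) \<le> \<phi> a))"

lemma reductionI:
  assumes "\<And>c a. c \<ge> 0 \<Longrightarrow> \<phi> (c *\<^sub>R a) = c * \<phi> a"
    and "\<And>c a. c \<ge> 0 \<Longrightarrow> D a \<Longrightarrow> D (c *\<^sub>R a)"
    and "\<And>a. (\<And>s. a $ s \<ge> 0) \<Longrightarrow> \<exists>(n::nat) d. (\<forall>i<n. D (d i) \<and> (\<forall>s. d i $ s \<ge> 0)) \<and>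
       (\<Sum>i<n. d i) = a \<and> (\<Sum>i<n. \<phi> (d i)) \<le> \<phi> a"
  shows "reduction \<phi> D"
  using assms unfolding reduction_def by (intro conjI allI impI) (assumption | blast)+

lemma reductionD:
  assumes "reduction \<phi> D"
  shows "c \<ge> 0 \<Longrightarrow> \<phi> (c *\<^sub>R a) = c * \<phi> a"
    and "c \<ge> 0 \<Longrightarrow> D a \<Longrightarrow> D (c *\<^sub>R a)"
    and "(\<And>s. a $ s \<ge> 0) \<Longrightarrow> \<exists>(n::nat) d. (\<forall>i<n. D (d i) \<and> (\<forall>s. d i $ s \<ge> 0)) \<and>
       (\<Sum>i<n. d i) = a \<and> (\<Sum>i<n. \<phi> (d i)) \<le> \<phi> a"
  using assms unfolding reduction_def by blast+

lemma reduction_0: "reduction \<phi> D \<Longrightarrow> \<phi> 0 = 0"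
  using reductionD(1)[of \<phi> D 0 0] by simp

lemma linear_total: "linear (\<lambda>a :: real ^ 's. \<Sum>s\<in>UNIV. a $ s)"
  by (intro linearI) (auto simp: sum.distrib sum_distrib_left)

lemma total_pos:
  assumes "\<And>s. (a :: real ^ 's) $ s \<ge> 0" "a \<noteq> 0"
  shows "(\<Sum>s\<in>UNIV. a $ s) > 0"
proof -
  obtain s where "a $ s \<noteq> 0" using assms(2) by (auto simp: vec_eq_iff)
  with assms(1)[of s] have "a $ s > 0" by simp
  thus ?thesis using assms(1) by (intro sum_pos2[of _ s]) auto
qed

lemma reduction_D_0:
  fixes D :: "real ^ 's \<Rightarrow> bool"
  assumes red: "reduction \<phi> D"
  shows "D 0"
proof -
  note D_scale = reductionD(2)[OF red] and dec = reductionD(3)[OF red]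
  \<comment> \<open>Decomposing the all-ones vector yields at least one piece, because an empty sum
    is 0; scaling that piece by 0 gives \<open>D 0\<close>.\<close>
  obtain n :: nat and d where nd: "\<forall>i<n. D (d i) \<and> (\<forall>s. d i $ s \<ge> 0)" "(\<Sum>i<n. d i) = (1 :: real ^ 's)"
    using dec[of 1] by auto
  have "n \<noteq> 0" using nd(2) by (intro notI) simp
  hence "D (d 0)" using nd by auto
  from D_scale[OF _ this, of 0] show ?thesis by simp
qed

text \<open>The program for \<open>U\<close>. Every vector is broken into pieces satisfying
  \<open>D\<close>; a basic solution uses at most \<open>CARD('s)\<close> of all pieces, and its
  weights are absorbed by homogeneity.\<close>

lemma split_reduce:
  fixes a :: "_ \<Rightarrow> real ^ 's"
  assumes red: "reduction \<phi> D" and fin: "finite U" and nn: "\<And>u s. u \<in> U \<Longrightarrow> a u $ s \<ge> 0"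
  obtains b :: "nat \<Rightarrow> real ^ 's" where "\<And>u s. b u $ s \<ge> 0" "\<And>u. D (b u)"
    "(\<Sum>u<CARD('s). b u) = (\<Sum>u\<in>U. a u)" "(\<Sum>u<CARD('s). \<phi> (b u)) \<le> (\<Sum>u\<in>U. \<phi> (a u))"
proof -
  note hom = reductionD(1)[OF red] and D_scale = reductionD(2)[OF red] and dec = reductionD(3)[OF red]
    and phi_0 = reduction_0[OF red] and D_0 = reduction_D_0[OF red]
  have "\<forall>u\<in>U. \<exists>n d. (\<forall>i<n::nat. D (d i) \<and> (\<forall>s. d i $ s \<ge> 0)) \<and>
       (\<Sum>i<n. d i) = a u \<and> (\<Sum>i<n. \<phi> (d i)) \<le> \<phi> (a u)"
    using nn by (intro ballI dec)
  from bchoice[OF this] obtain n :: "_ \<Rightarrow> nat" where "\<forall>u\<in>U. \<exists>d. (\<forall>i<n u. D (d i) \<and> (\<forall>s. d i $ s \<ge> 0)) \<and>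
       (\<Sum>i<n u. d i) = a u \<and> (\<Sum>i<n u. \<phi> (d i)) \<le> \<phi> (a u)" ..
  from bchoice[OF this] obtain d where "\<forall>u\<in>U. (\<forall>i<n u. D (d u i) \<and> (\<forall>s. d u i $ s \<ge> 0)) \<and>
       (\<Sum>i<n u. d u i) = a u \<and> (\<Sum>i<n u. \<phi> (d u i)) \<le> \<phi> (a u)" ..
  hence nd: "\<And>u i. u \<in> U \<Longrightarrow> i < n u \<Longrightarrow> D (d u i)" 
    "\<And>u i s. u \<in> U \<Longrightarrow> i < n u \<Longrightarrow> d u i $ s \<ge> 0"
    "\<And>u. u \<in> U \<Longrightarrow> (\<Sum>i<n u. d u i) = a u" "\<And>u. u \<in> U \<Longrightarrow> (\<Sum>i<n u. \<phi> (d u i)) \<le> \<phi> (a u)"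
    by auto
  \<comment> \<open>The total mass is the positive functional of the linear program, so zero pieces
    have to go; they contribute nothing to either sum.\<close>
  define I where "I = Sigma U (\<lambda>u. {..<n u}) - {(u,i). d u i = 0}"
  have finI: "finite I" using fin by (auto simp: I_def)
  let ?a = "\<lambda>(u,i). d u i"
  have ex: "\<exists>w' K. K \<subseteq> I \<and> card K \<le> DIM(real ^ 's) \<and> (\<forall>i\<in>K. w' i \<ge> 0) \<and>
    (\<Sum>i\<in>K. w' i *\<^sub>R ?a i) = (\<Sum>i\<in>I. 1 *\<^sub>R ?a i) \<and> (\<Sum>i\<in>K. w' i * (- \<phi> (?a i))) \<ge> (\<Sum>i\<in>I. 1 * (- \<phi> (?a i)))"
    by (rule linear_program_basic_solution[OF finI _ linear_total])
       (auto simp: I_def intro!: total_pos nd(2))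
  have S1: "(\<Sum>i\<in>I. ?a i) = (\<Sum>u\<in>U. a u)"
  proof -
    have "(\<Sum>i\<in>I. ?a i) = (\<Sum>i\<in>Sigma U (\<lambda>u. {..<n u}). ?a i)"
      unfolding I_def using fin by (intro sum.mono_neutral_left) auto
    also have "\<dots> = (\<Sum>u\<in>U. \<Sum>i<n u. d u i)"
      using fin by (subst sum.Sigma) auto
    finally show ?thesis using nd by simp
  qed
  have S2: "(\<Sum>i\<in>I. \<phi> (?a i)) \<le> (\<Sum>u\<in>U. \<phi> (a u))"
  proof -
    have "(\<Sum>i\<in>I. \<phi> (?a i)) = (\<Sum>i\<in>Sigma U (\<lambda>u. {..<n u}). \<phi> (?a i))"
      unfolding I_def using fin by (intro sum.mono_neutral_left) (auto simp: phi_0)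
    also have "\<dots> = (\<Sum>i\<in>Sigma U (\<lambda>u. {..<n u}). case i of (u,i) \<Rightarrow> \<phi> (d u i))"
      by (simp add: case_prod_beta)
    also have "\<dots> = (\<Sum>u\<in>U. \<Sum>i<n u. \<phi> (d u i))"
      using fin by (subst sum.Sigma) auto
    finally show ?thesis using nd by (simp add: sum_mono)
  qed
  from ex obtain w K where K: "K \<subseteq> I" "card K \<le> CARD('s)" "\<forall>i\<in>K. w i \<ge> 0"
    "(\<Sum>i\<in>K. w i *\<^sub>R ?a i) = (\<Sum>u\<in>U. a u)" "(\<Sum>i\<in>K. w i * \<phi> (?a i)) \<le> (\<Sum>u\<in>U. \<phi> (a u))"
    using S1 S2 by (auto simp: sum_negf)
  obtain h :: "nat \<Rightarrow> _" and B where h: "B \<subseteq> {..<CARD('s)}" "bij_betw h B K"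
    using ex_bij_betw_subset_lessThan[of K] K finite_subset[OF _ finI] by metis
  have hK: "h u \<in> K" if "u \<in> B" for u using h that by (auto simp: bij_betw_def)
  \<comment> \<open>Labels without a selected piece receive the zero vector, which satisfies
    \<open>D\<close> and has \<open>\<phi>\<close>-value 0.\<close>
  define b where "b u = (if u \<in> B then w (h u) *\<^sub>R ?a (h u) else 0)" for u
  have D: "D (?a i)" "?a i $ s \<ge> 0" if "i \<in> K" for i s
    using K(1) that nd(1,2) by (auto simp: I_def)
  have b1: "b u $ s \<ge> 0" "D (b u)" for u s
    using hK[of u] D[of "h u"] K(3) by (auto simp del: split_paired_All simp: b_def D_0 intro!: D_scale mult_nonneg_nonneg)
  have "(\<Sum>u<CARD('s). b u) = (\<Sum>u\<in>B. w (h u) *\<^sub>R ?a (h u))"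
    using h by (intro sum.mono_neutral_cong_right) (auto simp: b_def)
  also have "\<dots> = (\<Sum>i\<in>K. w i *\<^sub>R ?a i)"
    by (rule sum.reindex_bij_betw[OF h(2)])
  finally have b2: "(\<Sum>u<CARD('s). b u) = (\<Sum>u\<in>U. a u)" using K by simp
  have "(\<Sum>u<CARD('s). \<phi> (b u)) = (\<Sum>u\<in>B. w (h u) * \<phi> (?a (h u)))"
    using h hK K by (intro sum.mono_neutral_cong_right) (auto simp: b_def phi_0 hom)
  also have "\<dots> = (\<Sum>i\<in>K. w i * \<phi> (?a i))"
    by (rule sum.reindex_bij_betw[OF h(2)])
  finally have b3: "(\<Sum>u<CARD('s). \<phi> (b u)) \<le> (\<Sum>u\<in>U. \<phi> (a u))" using K by simp
  show ?thesis by (rule that[OF b1 b2 b3])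
qed

text \<open>The program for \<open>V\<close> acts on whole columns: a weight on \<open>v\<close>
  scales all \<open>a v u\<close> at once, hence \<open>A v\<close>, \<open>\<phi> (A v)\<close> and
  \<open>G v\<close> together. The sum of the \<open>\<phi> (A v)\<close> is kept with equality
  because it enters the constraint as well as the objective; only the last sum may drop.\<close>

lemma reduction_family:
  fixes a :: "_ \<Rightarrow> _ \<Rightarrow> real ^ 's"
  assumes red: "reduction \<phi> D" and finV: "finite V" and finU: "\<And>v. v \<in> V \<Longrightarrow> finite (U v)"
    and nn: "\<And>v u s. v \<in> V \<Longrightarrow> u \<in> U v \<Longrightarrow> a v u $ s \<ge> 0"
  obtains b :: "nat \<Rightarrow> nat \<Rightarrow> real ^ 's" where "\<And>v u s. b v u $ s \<ge> 0" "\<And>v u. D (b v u)"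
    "(\<Sum>v<CARD('s)+1. \<Sum>u<CARD('s). b v u) = (\<Sum>v\<in>V. \<Sum>u\<in>U v. a v u)"
    "(\<Sum>v<CARD('s)+1. \<phi> (\<Sum>u<CARD('s). b v u)) = (\<Sum>v\<in>V. \<phi> (\<Sum>u\<in>U v. a v u))"
    "(\<Sum>v<CARD('s)+1. \<Sum>u<CARD('s). \<phi> (b v u)) \<le> (\<Sum>v\<in>V. \<Sum>u\<in>U v. \<phi> (a v u))"
proof -
  note hom = reductionD(1)[OF red] and D_scale = reductionD(2)[OF red]
    and phi_0 = reduction_0[OF red] and D_0 = reduction_D_0[OF red]
  define A where "A v = (\<Sum>u\<in>U v. a v u)" for v
  define G where "G v = (\<Sum>u\<in>U v. \<phi> (a v u))" for v
  have A0: "A v $ s \<ge> 0" if "v \<in> V" for v s using that nn by (auto simp: A_def sum_nonneg)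
  \<comment> \<open>Nonnegative vectors with sum zero all vanish, so discarding the columns with
    \<open>A v = 0\<close> changes none of the sums.\<close>
  have G0: "G v = 0" if "v \<in> V" "A v = 0" for v
  proof -
    have "\<forall>u\<in>U v. a v u = 0"
    proof (intro ballI, rule ccontr)
      fix u assume u: "u \<in> U v" "a v u \<noteq> 0"
      then obtain s where "a v u $ s \<noteq> 0" by (auto simp: vec_eq_iff)
      hence "a v u $ s > 0" using nn[OF that(1) u(1), of s] by simp
      hence "(\<Sum>u\<in>U v. a v u $ s) > 0" using u nn that finU by (intro sum_pos2[of _ u]) auto
      with that(2) show False by (auto simp: A_def vec_eq_iff)
    qed
    thus ?thesis by (simp add: G_def phi_0)
  qed
  define I where "I = V - {v. A v = 0}"
  have finI: "finite I" using finV by (simp add: I_def)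
  \<comment> \<open>The value of \<open>\<phi>\<close> is an extra coordinate, so its sum is
    preserved exactly; this is the origin of the \<open>+ 1\<close> in the bound for
    \<open>V\<close>.\<close>
  let ?a = "\<lambda>v. (A v, \<phi> (A v))"
  let ?l = "\<lambda>x :: (real ^ 's) \<times> real. \<Sum>s\<in>UNIV. fst x $ s"
  have lin: "linear ?l"
    by (intro linearI) (auto simp: sum.distrib sum_distrib_left)
  have ex: "\<exists>w' K. K \<subseteq> I \<and> card K \<le> DIM((real ^ 's) \<times> real) \<and> (\<forall>i\<in>K. w' i \<ge> 0) \<and>
    (\<Sum>i\<in>K. w' i *\<^sub>R ?a i) = (\<Sum>i\<in>I. 1 *\<^sub>R ?a i) \<and> (\<Sum>i\<in>K. w' i * (- G i)) \<ge> (\<Sum>i\<in>I. 1 * (- G i))"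
    by (rule linear_program_basic_solution[OF finI _ lin])
       (auto simp: I_def intro!: total_pos A0)
  have "(\<Sum>i\<in>I. A i) = (\<Sum>v\<in>V. A v)" "(\<Sum>i\<in>I. \<phi> (A i)) = (\<Sum>v\<in>V. \<phi> (A v))" "(\<Sum>i\<in>I. G i) = (\<Sum>v\<in>V. G v)"
    using finV by (auto simp: I_def phi_0 G0 intro!: sum.mono_neutral_left)
  with ex obtain w K where K: "K \<subseteq> I" "card K \<le> CARD('s) + 1" "\<forall>i\<in>K. w i \<ge> 0"
    "(\<Sum>i\<in>K. w i *\<^sub>R A i) = (\<Sum>v\<in>V. A v)" "(\<Sum>i\<in>K. w i * \<phi> (A i)) = (\<Sum>v\<in>V. \<phi> (A v))"
    "(\<Sum>i\<in>K. w i * G i) \<le> (\<Sum>v\<in>V. G v)"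
    by (auto simp: sum_negf sum_prod)
  obtain h :: "nat \<Rightarrow> _" and B where h: "B \<subseteq> {..<CARD('s)+1}" "bij_betw h B K"
    using ex_bij_betw_subset_lessThan[of K] K finite_subset[OF _ finI] by metis
  have hK: "h u \<in> K" "h u \<in> V" if "u \<in> B" for u using h K(1) that by (auto simp: bij_betw_def I_def)
  have "\<forall>v\<in>V. \<exists>b :: nat \<Rightarrow> real ^ 's. (\<forall>u s. b u $ s \<ge> 0) \<and> (\<forall>u. D (b u)) \<and> 
     (\<Sum>u<CARD('s). b u) = A v \<and> (\<Sum>u<CARD('s). \<phi> (b u)) \<le> G v"
    unfolding A_def G_def
  proof (intro ballI)
    fix v assume v: "v \<in> V"
    show "\<exists>b :: nat \<Rightarrow> real ^ 's. (\<forall>u s. b u $ s \<ge> 0) \<and> (\<forall>u. D (b u)) \<and>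
      (\<Sum>u<CARD('s). b u) = (\<Sum>u\<in>U v. a v u) \<and> (\<Sum>u<CARD('s). \<phi> (b u)) \<le> (\<Sum>u\<in>U v. \<phi> (a v u))"
      by (rule split_reduce[OF red finU[OF v] nn[OF v], of "\<lambda>u. u"]) blast+
  qed
  then obtain b0 where b0: "\<And>v u s. v \<in> V \<Longrightarrow> b0 v u $ s \<ge> 0" "\<And>v u. v \<in> V \<Longrightarrow> D (b0 v u)"
    "\<And>v. v \<in> V \<Longrightarrow> (\<Sum>u<CARD('s). b0 v u) = A v" "\<And>v. v \<in> V \<Longrightarrow> (\<Sum>u<CARD('s). \<phi> (b0 v u)) \<le> G v"
    by metis
  define b where "b v u = (if v \<in> B then w (h v) *\<^sub>R b0 (h v) u else 0)" for v u
  have b1: "b v u $ s \<ge> 0" "D (b v u)" for v u s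
    using hK K b0(1,2) by (auto simp: b_def D_0 intro!: D_scale mult_nonneg_nonneg)
  have bs: "(\<Sum>u<CARD('s). b v u) = (if v \<in> B then w (h v) *\<^sub>R A (h v) else 0)" for v
    using hK by (auto simp: b_def scaleR_sum_right[symmetric] b0(3))
  have "(\<Sum>v<CARD('s)+1. \<Sum>u<CARD('s). b v u) = (\<Sum>v\<in>B. w (h v) *\<^sub>R A (h v))"
    unfolding bs using h by (intro sum.mono_neutral_cong_right) auto
  also have "\<dots> = (\<Sum>i\<in>K. w i *\<^sub>R A i)"
    by (rule sum.reindex_bij_betw[OF h(2)])
  finally have b2: "(\<Sum>v<CARD('s)+1. \<Sum>u<CARD('s). b v u) = (\<Sum>v\<in>V. A v)" using K by simp
  have "(\<Sum>v<CARD('s)+1. \<phi> (\<Sum>u<CARD('s). b v u)) = (\<Sum>v\<in>B. w (h v) * \<phi> (A (h v)))"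
    unfolding bs using h hK K by (intro sum.mono_neutral_cong_right) (auto simp: phi_0 hom)
  also have "\<dots> = (\<Sum>i\<in>K. w i * \<phi> (A i))"
    by (rule sum.reindex_bij_betw[OF h(2)])
  finally have b3: "(\<Sum>v<CARD('s)+1. \<phi> (\<Sum>u<CARD('s). b v u)) = (\<Sum>v\<in>V. \<phi> (A v))" using K by simp
  have "(\<Sum>v<CARD('s)+1. \<Sum>u<CARD('s). \<phi> (b v u)) = (\<Sum>v\<in>B. w (h v) * (\<Sum>u<CARD('s). \<phi> (b0 (h v) u)))"
    using h hK K by (intro sum.mono_neutral_cong_right) (auto simp: phi_0 b_def hom sum_distrib_left)
  also have "\<dots> \<le> (\<Sum>v\<in>B. w (h v) * G (h v))"
    using hK K b0(4) by (intro sum_mono mult_left_mono) auto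
  also have "\<dots> = (\<Sum>i\<in>K. w i * G i)"
    by (rule sum.reindex_bij_betw[OF h(2)])
  finally have b4: "(\<Sum>v<CARD('s)+1. \<Sum>u<CARD('s). \<phi> (b v u)) \<le> (\<Sum>v\<in>V. G v)" using K by simp
  show ?thesis by (rule that[OF b1 b2[unfolded A_def] b3[unfolded A_def] b4[unfolded G_def]])
qed

section \<open>Entropy differences as functions of weight vectors\<close>

definition neg_xlogx :: "real \<Rightarrow> real" where "neg_xlogx t = - (t * log 2 t)"

lemma neg_xlogx_0 [simp]: "neg_xlogx 0 = 0" by (simp add: neg_xlogx_def)

lemma neg_xlogx_mult: "neg_xlogx (c * t) = c * neg_xlogx t + t * neg_xlogx c"
  by (simp add: neg_xlogx_def log_mult algebra_simps)

lemma neg_xlogx_concave: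
  assumes "0 \<le> l" "l \<le> 1" "0 \<le> x" "0 \<le> y"
  shows "l * neg_xlogx x + (1 - l) * neg_xlogx y \<le> neg_xlogx (l * x + (1 - l) * y)"
proof -
  define m where "m = l * x + (1 - l) * y"
  have "m \<ge> 0" using assms by (simp add: m_def)
  \<comment> \<open>The tangent line of \<open>u ln u\<close> at the mean \<open>m\<close>;
    averaging over \<open>x\<close> and \<open>y\<close> makes the linear part vanish.\<close>
  have *: "u * ln u - u * ln m \<ge> u - m" if "u \<ge> 0" "m > 0" for u
  proof (cases "u = 0")
    case False
    hence "u > 0" using that by simp
    hence "u * ln (m / u) \<le> u * (m / u - 1)" using that by (intro mult_left_mono ln_le_minus_one) auto
    thus ?thesis using \<open>u > 0\<close> that by (simp add: ln_div algebra_simps)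
  qed (use that in simp)
  show ?thesis
  proof (cases "m > 0")
    case True
    have "l * (x * ln x - x * ln m) + (1 - l) * (y * ln y - y * ln m) \<ge> l * (x - m) + (1 - l) * (y - m)"
      using assms * True by (intro add_mono mult_left_mono) auto
    also have "l * (x - m) + (1 - l) * (y - m) = 0" by (simp add: m_def algebra_simps)
    also have "l * (x * ln x - x * ln m) + (1 - l) * (y * ln y - y * ln m) =
      l * (x * ln x) + (1 - l) * (y * ln y) - m * ln m" by (simp add: m_def algebra_simps)
    finally have "(m * ln m) / ln 2 \<le> (l * (x * ln x) + (1 - l) * (y * ln y)) / ln 2"
      by (intro divide_right_mono) auto
    thus ?thesis by (simp add: neg_xlogx_def log_def m_def[symmetric] add_divide_distrib)
  next
    case False
    with \<open>m \<ge> 0\<close> have "m = 0" by simp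
    hence "l * x = 0" "(1 - l) * y = 0"
      using assms add_nonneg_eq_0_iff[of "l * x" "(1 - l) * y"] by (auto simp: m_def)
    hence "l * neg_xlogx x = 0" "(1 - l) * neg_xlogx y = 0" by (auto simp: neg_xlogx_def)
    hence "l * neg_xlogx x + (1 - l) * neg_xlogx y = 0" by linarith
    thus ?thesis using \<open>m = 0\<close> by (simp only: m_def neg_xlogx_0)
  qed
qed

lemma ent_eq_sum_neg_xlogx:
  assumes "finite S" "set_pmf p \<subseteq> S"
  shows "ent p = (\<Sum>a\<in>S. neg_xlogx (pmf p a))"
proof -
  have "ent p = (\<Sum>a\<in>set_pmf p. neg_xlogx (pmf p a))" by (simp add: ent_def neg_xlogx_def sum_negf)
  also have "\<dots> = (\<Sum>a\<in>S. neg_xlogx (pmf p a))"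
    using assms by (intro sum.mono_neutral_left) (auto simp: set_pmf_iff)
  finally show ?thesis .
qed

text \<open>The entropy functional at the output of the channel \<open>g\<close> for an unnormalised
  input \<open>a\<close>. Taken at the slices of a joint law, these values add up to a joint entropy
  without any division by slice masses.\<close>

definition kernel_ent :: "('s::finite \<Rightarrow> 'c pmf) \<Rightarrow> real ^ 's \<Rightarrow> real" where
  "kernel_ent g a = (\<Sum>c\<in>(\<Union>s. set_pmf (g s)). neg_xlogx (\<Sum>s\<in>UNIV. a $ s * pmf (g s) c))"

lemma sum_kernel:
  assumes "\<And>s. finite (set_pmf (g s))"
  shows "(\<Sum>c\<in>(\<Union>s. set_pmf (g s)). \<Sum>s\<in>UNIV. a $ s * pmf (g s) c) = (\<Sum>s\<in>UNIV. (a :: real ^ 's::finite) $ s)"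
proof -
  have "(\<Sum>c\<in>(\<Union>s. set_pmf (g s)). pmf (g s) c) = 1" for s
    using assms by (intro sum_pmf_eq_1) auto
  thus ?thesis by (subst sum.swap) (simp add: sum_distrib_left[symmetric])
qed

text \<open>The correction term depends on \<open>c\<close> and the mass of \<open>a\<close>, not on
  the kernel. This is why a difference of two such entropies is homogeneous.\<close>

lemma kernel_ent_scale:
  assumes "\<And>s. finite (set_pmf (g s))"
  shows "kernel_ent g (c *\<^sub>R a) = c * kernel_ent g a + neg_xlogx c * (\<Sum>s\<in>UNIV. a $ s)"
proof -
  have "kernel_ent g (c *\<^sub>R a) = (\<Sum>x\<in>(\<Union>s. set_pmf (g s)). neg_xlogx (c * (\<Sum>s\<in>UNIV. a $ s * pmf (g s) x)))"
    by (simp add: kernel_ent_def sum_distrib_left mult.assoc)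
  also have "\<dots> = c * kernel_ent g a + (\<Sum>x\<in>(\<Union>s. set_pmf (g s)). \<Sum>s\<in>UNIV. a $ s * pmf (g s) x) * neg_xlogx c"
    unfolding neg_xlogx_mult sum.distrib kernel_ent_def
    by (simp only: sum_distrib_left[symmetric] sum_distrib_right[symmetric])
  finally show ?thesis by (simp add: sum_kernel assms mult.commute)
qed

text \<open>The channel output is linear in \<open>a\<close>, so concavity of
  \<open>neg_xlogx\<close> passes to the sum.\<close>

lemma kernel_ent_concave:
  assumes "0 \<le> l" "l \<le> 1" "\<And>s. a $ s \<ge> 0" "\<And>s. b $ s \<ge> 0"
  shows "l * kernel_ent g a + (1 - l) * kernel_ent g b \<le> kernel_ent g (l *\<^sub>R a + (1 - l) *\<^sub>R b)"
proof -
  have "l * kernel_ent g a + (1 - l) * kernel_ent g b =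
     (\<Sum>c\<in>(\<Union>s. set_pmf (g s)). l * neg_xlogx (\<Sum>s\<in>UNIV. a $ s * pmf (g s) c) + (1 - l) * neg_xlogx (\<Sum>s\<in>UNIV. b $ s * pmf (g s) c))"
    by (simp add: kernel_ent_def sum_distrib_left sum.distrib)
  also have "\<dots> \<le> (\<Sum>c\<in>(\<Union>s. set_pmf (g s)). neg_xlogx (l * (\<Sum>s\<in>UNIV. a $ s * pmf (g s) c) + (1 - l) * (\<Sum>s\<in>UNIV. b $ s * pmf (g s) c)))"
    using assms by (intro sum_mono neg_xlogx_concave sum_nonneg) auto
  also have "\<dots> = kernel_ent g (l *\<^sub>R a + (1 - l) *\<^sub>R b)"
    by (simp add: kernel_ent_def sum_distrib_left sum.distrib[symmetric] algebra_simps)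
  finally show ?thesis .
qed

lemma pmf_bind_kernel:
  fixes M :: "('a \<times> 's::finite) pmf"
  shows "pmf (bind_pmf M (\<lambda>(a, s). map_pmf (Pair a) (g s))) (a, c) = (\<Sum>s\<in>UNIV. pmf M (a, s) * pmf (g s) c)"
proof -
  have *: "pmf (map_pmf (Pair a') (g s)) (a, c) = (if a' = a then pmf (g s) c else 0)" for a' s
  proof (cases "a' = a")
    case True
    thus ?thesis by (simp add: pmf_map_inj' inj_on_def)
  next
    case False
    hence "(a, c) \<notin> set_pmf (map_pmf (Pair a') (g s))" by auto
    hence "pmf (map_pmf (Pair a') (g s)) (a, c) = 0" by (simp only: set_pmf_iff not_not)
    thus ?thesis using False by simp
  qed
  have "pmf (bind_pmf M (\<lambda>(a, s). map_pmf (Pair a) (g s))) (a, c) =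
    measure_pmf.expectation M (\<lambda>(a', s). if a' = a then pmf (g s) c else 0)"
    by (simp add: pmf_bind * case_prod_unfold)
  also have "\<dots> = (\<Sum>x\<in>{a} \<times> UNIV. (case x of (a', s) \<Rightarrow> if a' = a then pmf (g s) c else 0) * pmf M x)"
    by (intro integral_measure_pmf_real) (auto split: if_splits)
  also have "\<dots> = (\<Sum>s\<in>UNIV. pmf M (a, s) * pmf (g s) c)"
  proof -
    have "{a} \<times> UNIV = Pair a ` (UNIV :: 's set)" by auto
    thus ?thesis by (simp add: sum.reindex inj_on_def mult.commute)
  qed
  finally show ?thesis .
qed

text \<open>The slice of \<open>M\<close> at \<open>a\<close>, sent through the channel, produces
  exactly the masses of the pairs \<open>(a, c)\<close>.\<close>

lemma ent_bind_kernel: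
  fixes M :: "('a \<times> 's::finite) pmf"
  assumes fin: "\<And>s. finite (set_pmf (g s))" and A: "finite A" "fst ` set_pmf M \<subseteq> A"
  shows "ent (bind_pmf M (\<lambda>(a, s). map_pmf (Pair a) (g s))) = (\<Sum>a\<in>A. kernel_ent g (\<chi> s. pmf M (a, s)))"
proof -
  let ?C = "\<Union>s. set_pmf (g s)"
  have "ent (bind_pmf M (\<lambda>(a, s). map_pmf (Pair a) (g s))) = 
     (\<Sum>x\<in>A \<times> ?C. neg_xlogx (pmf (bind_pmf M (\<lambda>(a, s). map_pmf (Pair a) (g s))) x))"
    using A fin by (intro ent_eq_sum_neg_xlogx) force+
  also have "\<dots> = (\<Sum>a\<in>A. \<Sum>c\<in>?C. neg_xlogx (pmf (bind_pmf M (\<lambda>(a, s). map_pmf (Pair a) (g s))) (a, c)))"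
    by (simp add: sum.cartesian_product)
  finally show ?thesis by (simp add: pmf_bind_kernel kernel_ent_def)
qed

definition phi :: "('s::finite \<Rightarrow> ('z \<times> 'j) pmf) \<Rightarrow> real ^ 's \<Rightarrow> real" where
  "phi k a = kernel_ent (\<lambda>s. map_pmf snd (k s)) a - kernel_ent (\<lambda>s. map_pmf fst (k s)) a"

lemma phi_scale:
  assumes "\<And>s. finite (set_pmf (k s))"
  shows "phi k (c *\<^sub>R a) = c * phi k a"
  using assms by (simp add: phi_def kernel_ent_scale right_diff_distrib)

text \<open>Without a restriction on the pieces a vector is its own decomposition. This instance
  gives the bare cardinality bounds.\<close>

lemma reduction_trivial:
  assumes "\<And>s. finite (set_pmf (k s))"
  shows "reduction (phi k) (\<lambda>_. True)"
proof (rule reductionI)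
  fix a :: "real ^ 'a" assume a: "\<And>s. a $ s \<ge> 0"
  show "\<exists>(n::nat) d. (\<forall>i<n. True \<and> (\<forall>s. d i $ s \<ge> 0)) \<and> (\<Sum>i<n. d i) = a \<and> (\<Sum>i<n. phi k (d i)) \<le> phi k a"
    using a by (intro exI[of _ "1::nat"] exI[of _ "\<lambda>_. a"]) auto
qed (simp_all add: phi_scale assms)

text \<open>For the vector of masses at fixed \<open>(u, v)\<close> and \<open>Z = f(X,Y)\<close>,
  this says that \<open>Z\<close> identifies \<open>(X, Y)\<close> once \<open>(u, v)\<close> is
  known.\<close>

definition selects :: "('s \<Rightarrow> 'z) \<Rightarrow> real ^ 's \<Rightarrow> bool" where
  "selects f a \<longleftrightarrow> (\<forall>s s'. a $ s > 0 \<longrightarrow> a $ s' > 0 \<longrightarrow> f s = f s' \<longrightarrow> s = s')"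

text \<open>When \<open>Z = f s\<close>, moving mass inside a fibre of \<open>f\<close> does not change the law of \<open>Z\<close>, so \<open>phi\<close> is
  concave in these directions and splitting into extreme points does not increase it.\<close>

lemma selects_decomposition:
  fixes a :: "real ^ 's::finite"
  assumes fin: "\<And>s. finite (set_pmf (k s))" and f: "\<And>s. map_pmf fst (k s) = return_pmf (f s)"
    and "\<And>s. a $ s \<ge> 0"
  shows "\<exists>ds. (\<forall>d\<in>set ds. selects f d \<and> (\<forall>s. d $ s \<ge> 0)) \<and> sum_list ds = a \<and> (\<Sum>d\<leftarrow>ds. phi k d) \<le> phi k a"
  using assms(3)
proof (induction "card {s. a $ s > 0}" arbitrary: a rule: less_induct)
  case less
  show ?case
  proof (cases "selects f a")
    case True
    thus ?thesis using less.prems by (intro exI[of _ "[a]"]) auto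
  next
    case False
    then obtain s t where st: "a $ s > 0" "a $ t > 0" "f s = f t" "s \<noteq> t" by (auto simp: selects_def)
    \<comment> \<open>\<open>b\<close> and \<open>c\<close> move the joint mass \<open>m\<close> of
      the points \<open>s\<close> and \<open>t\<close> entirely onto \<open>s\<close> or onto
      \<open>t\<close>. Their mixture with weight \<open>l\<close> is \<open>a\<close>, and each has
      one positive entry fewer, which drives the induction.\<close>
    define m where "m = a $ s + a $ t"
    define l where "l = a $ s / m"
    have m: "m > 0" and l: "0 < l" "l < 1" using st by (auto simp: m_def l_def)
    have lm: "l * m = a $ s" "(1 - l) * m = a $ t" using m by (auto simp: l_def m_def field_simps)
    define b where "b = (\<chi> u. if u = s then m else if u = t then 0 else a $ u)"
    define c where "c = (\<chi> u. if u = s then 0 else if u = t then m else a $ u)"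
    have a: "a = l *\<^sub>R b + (1 - l) *\<^sub>R c"
      using lm st by (auto simp: vec_eq_iff b_def c_def algebra_simps)
    have nn: "b $ u \<ge> 0" "c $ u \<ge> 0" for u using less.prems m by (auto simp: b_def c_def)
    have "{u. b $ u > 0} \<subset> {u. a $ u > 0}" using st m by (auto simp: b_def split: if_splits)
    hence cb: "card {u. (l *\<^sub>R b) $ u > 0} < card {u. a $ u > 0}"
      using l by (intro psubset_card_mono) (auto simp: zero_less_mult_iff)
    have "{u. c $ u > 0} \<subset> {u. a $ u > 0}" using st m by (auto simp: c_def split: if_splits)
    hence cc: "card {u. ((1 - l) *\<^sub>R c) $ u > 0} < card {u. a $ u > 0}"
      using l by (intro psubset_card_mono) (auto simp: zero_less_mult_iff)
    from less.hyps[OF cb] obtain ds where ds: "\<forall>d\<in>set ds. selects f d \<and> (\<forall>s. d $ s \<ge> 0)"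
      "sum_list ds = l *\<^sub>R b" "(\<Sum>d\<leftarrow>ds. phi k d) \<le> phi k (l *\<^sub>R b)" using nn l by auto
    from less.hyps[OF cc] obtain es where es: "\<forall>d\<in>set es. selects f d \<and> (\<forall>s. d $ s \<ge> 0)"
      "sum_list es = (1 - l) *\<^sub>R c" "(\<Sum>d\<leftarrow>es. phi k d) \<le> phi k ((1 - l) *\<^sub>R c)" using nn l by auto
    \<comment> \<open>Since \<open>f s = f t\<close>, moving mass between the two points leaves the
      mass of every fibre unchanged.\<close>
    have fibre: "(\<Sum>u\<in>UNIV. b $ u * pmf (return_pmf (f u)) z) = (\<Sum>u\<in>UNIV. a $ u * pmf (return_pmf (f u)) z)"
      "(\<Sum>u\<in>UNIV. c $ u * pmf (return_pmf (f u)) z) = (\<Sum>u\<in>UNIV. a $ u * pmf (return_pmf (f u)) z)" for z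
    proof -
      have *: "(\<Sum>u\<in>UNIV. h u) = h s + h t + (\<Sum>u\<in>UNIV - {s, t}. h u)" for h :: "'s \<Rightarrow> real"
        using st by (subst sum.subset_diff[of "{s, t}"]) auto
      show "(\<Sum>u\<in>UNIV. b $ u * pmf (return_pmf (f u)) z) = (\<Sum>u\<in>UNIV. a $ u * pmf (return_pmf (f u)) z)"
        "(\<Sum>u\<in>UNIV. c $ u * pmf (return_pmf (f u)) z) = (\<Sum>u\<in>UNIV. a $ u * pmf (return_pmf (f u)) z)"
        unfolding * using st(3,4) by (auto simp: b_def c_def m_def algebra_simps intro!: sum.cong)
    qed
    have Z: "kernel_ent (\<lambda>s. map_pmf fst (k s)) b = kernel_ent (\<lambda>s. map_pmf fst (k s)) a"
      "kernel_ent (\<lambda>s. map_pmf fst (k s)) c = kernel_ent (\<lambda>s. map_pmf fst (k s)) a"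
      unfolding kernel_ent_def f by (simp_all only: fibre)
    have "phi k (l *\<^sub>R b) + phi k ((1 - l) *\<^sub>R c) = l * phi k b + (1 - l) * phi k c"
      by (simp add: phi_scale fin)
    also have "\<dots> = l * kernel_ent (\<lambda>s. map_pmf snd (k s)) b + (1 - l) * kernel_ent (\<lambda>s. map_pmf snd (k s)) c
       - kernel_ent (\<lambda>s. map_pmf fst (k s)) a" by (simp add: phi_def Z algebra_simps)
    also have "\<dots> \<le> phi k a"
      using kernel_ent_concave[of l b c "\<lambda>s. map_pmf snd (k s)"] l nn unfolding phi_def a[symmetric] by simp
    finally show ?thesis using ds es a by (intro exI[of _ "ds @ es"]) auto
  qed
qed

lemma reduction_selects:
  assumes fin: "\<And>s. finite (set_pmf (k s))" and f: "\<And>s. map_pmf fst (k s) = return_pmf (f s)"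
  shows "reduction (phi k) (selects f)"
proof (rule reductionI)
  fix a :: "real ^ 'a" assume a: "\<And>s. a $ s \<ge> 0"
  from selects_decomposition[of k f, OF fin f a] obtain ds where ds:
    "\<forall>d\<in>set ds. selects f d \<and> (\<forall>s. d $ s \<ge> 0)" "sum_list ds = a" "(\<Sum>d\<leftarrow>ds. phi k d) \<le> phi k a" by blast
  show "\<exists>(n::nat) d. (\<forall>i<n. selects f (d i) \<and> (\<forall>s. d i $ s \<ge> 0)) \<and> (\<Sum>i<n. d i) = a \<and> (\<Sum>i<n. phi k (d i)) \<le> phi k a"
    using ds by (intro exI[of _ "length ds"] exI[of _ "\<lambda>i. ds ! i"])
      (auto simp: sum_list_sum_nth atLeast0LessThan)
next
  fix c :: real and a :: "real ^ 'a" assume "c \<ge> 0" "selects f a"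
  thus "selects f (c *\<^sub>R a)" by (auto simp: selects_def zero_less_mult_iff)
qed (simp add: phi_scale assms)

section \<open>Admissible laws as families of weight vectors\<close>

lemma pmf_map_eq_sum_superset:
  assumes "finite S" "set_pmf q \<subseteq> S"
  shows "pmf (map_pmf f q) x = (\<Sum>w | w \<in> S \<and> f w = x. pmf q w)"
proof -
  have "pmf (map_pmf f q) x = (\<Sum>w | w \<in> set_pmf q \<and> f w = x. pmf q w)"
    using assms by (intro pmf_map_eq_sum) (auto intro: finite_subset)
  also have "\<dots> = (\<Sum>w | w \<in> S \<and> f w = x. pmf q w)"
    using assms by (intro sum.mono_neutral_left) (auto simp: set_pmf_iff)
  finally show ?thesis .
qed

lemma pmf_of_weights:
  assumes "finite S" "\<And>x. x \<in> S \<Longrightarrow> f x \<ge> 0" "(\<Sum>x\<in>S. f x) = (1 :: real)"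
  obtains M where "set_pmf M \<subseteq> S" "\<And>x. x \<in> S \<Longrightarrow> pmf M x = f x"
proof -
  let ?f = "\<lambda>x. if x \<in> S then f x else 0"
  have "(\<integral>\<^sup>+ x. ennreal (?f x) \<partial>count_space UNIV) = (\<Sum>x\<in>S. ennreal (?f x))"
    using assms by (intro nn_integral_count_space'[where A = S]) auto
  also have "\<dots> = ennreal (\<Sum>x\<in>S. f x)"
    using assms by (subst sum_ennreal[symmetric]) (auto intro!: sum.cong)
  finally have 1: "(\<integral>\<^sup>+ x. ennreal (?f x) \<partial>count_space UNIV) = 1" using assms by simp
  have p: "pmf (embed_pmf ?f) x = ?f x" for x
    using assms 1 by (intro pmf_embed_pmf) auto
  show ?thesis by (rule that[of "embed_pmf ?f"]) (auto simp: set_pmf_iff p split: if_splits)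
qed

text \<open>All requirements of \<open>feasible\<close> except the inequality with
  \<open>\<Delta>\<close>. Laws obtained from a sequence of codes lie in this set before any of them
  meets the limiting constraint.\<close>

definition feasible0 ::
    "('x::finite \<times> 'y::finite \<times> 'z::finite \<times> nat) pmf \<Rightarrow> ('x \<times> 'y \<times> 'z \<times> nat \<times> nat \<times> nat) pmf \<Rightarrow> bool" where
  "feasible0 pJ q \<longleftrightarrow>
     map_pmf (\<lambda>(x, y, z, j, u, v). (x, y, z, j)) q = pJ \<and>
     pmf_cond_indep q (\<lambda>(x, y, z, j, u, v). (u, v)) (\<lambda>(x, y, z, j, u, v). (j, z))
                      (\<lambda>(x, y, z, j, u, v). (x, y)) \<and>
     (\<lambda>(x, y, z, j, u, v). v) ` set_pmf q \<subseteq> {..<CARD('x) * CARD('y) + 1} \<and>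
     (\<lambda>(x, y, z, j, u, v). u) ` set_pmf q \<subseteq> {..<CARD('x) * CARD('y)}"

text \<open>Expanded, this is \<open>H(V,J) - H(V,Z) - H(J)\<close>: the constraint moved to one
  side, with \<open>- \<Delta>\<close> as its bound.\<close>

definition slack :: "('x::finite \<times> 'y::finite \<times> 'z::finite \<times> nat \<times> nat \<times> nat) pmf \<Rightarrow> real" where
  "slack q = pmf_mutual_info q (\<lambda>(x, y, z, j, u, v). v) (\<lambda>(x, y, z, j, u, v). z)
    - pmf_mutual_info q (\<lambda>(x, y, z, j, u, v). v) (\<lambda>(x, y, z, j, u, v). j)
    - pmf_entropy q (\<lambda>(x, y, z, j, u, v). z)"

lemma feasible_iff: "feasible \<Delta> pJ q \<longleftrightarrow> feasible0 pJ q \<and> slack q \<le> - \<Delta>"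
  unfolding feasible_def feasible0_def slack_def by auto

lemma finite_extension:
  assumes "is_extension p (pJ :: ('x::finite \<times> 'y::finite \<times> 'z::finite \<times> nat) pmf)"
  shows "finite (set_pmf pJ)"
proof -
  have "set_pmf pJ \<subseteq> UNIV \<times> UNIV \<times> UNIV \<times> ((\<lambda>(x, y, z, j). j) ` set_pmf pJ)" by force
  moreover have "finite ((\<lambda>(x, y, z, j). j) ` set_pmf pJ)" using assms by (simp add: is_extension_def)
  ultimately show ?thesis by (meson finite_SigmaI finite_subset finite_code)
qed

lemma feasible0_support:
  assumes "feasible0 (pJ :: ('x::finite \<times> 'y::finite \<times> 'z::finite \<times> nat) pmf) q"
  shows "set_pmf q \<subseteq> UNIV \<times> UNIV \<times> UNIV \<times> ((\<lambda>(x, y, z, j). j) ` set_pmf pJ) \<times> {..<CARD('x) * CARD('y)} \<times> {..<CARD('x) * CARD('y) + 1}"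
  using assms unfolding feasible0_def by force

lemma finite_feasible0:
  assumes "feasible0 pJ q" "finite (set_pmf pJ)"
  shows "finite (set_pmf q)"
  using feasible0_support[OF assms(1)] by (rule finite_subset) (use assms in auto)

text \<open>The shape forced by the Markov condition: \<open>(U, V, X, Y)\<close> is free with law
  \<open>M\<close>, and \<open>(Z, J)\<close> is drawn from the kernel at
  \<open>(X, Y)\<close>.\<close>

definition joint :: "('x \<times> 'y \<Rightarrow> ('z \<times> nat) pmf) \<Rightarrow> (nat \<times> nat \<times> 'x \<times> 'y) pmf \<Rightarrow> ('x \<times> 'y \<times> 'z \<times> nat \<times> nat \<times> nat) pmf" where
  "joint k M = bind_pmf M (\<lambda>(u, v, x, y). map_pmf (\<lambda>(z, j). (x, y, z, j, u, v)) (k (x, y)))"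

definition extend_by :: "('x \<times> 'y \<Rightarrow> ('z \<times> nat) pmf) \<Rightarrow> ('x \<times> 'y) pmf \<Rightarrow> ('x \<times> 'y \<times> 'z \<times> nat) pmf" where
  "extend_by k P = bind_pmf P (\<lambda>(x, y). map_pmf (\<lambda>(z, j). (x, y, z, j)) (k (x, y)))"

text \<open>The kernel is the conditional law of \<open>(Z, J)\<close> given \<open>(X, Y)\<close>.
  Off the support it is a point mass with a freely chosen \<open>Z\<close>-part \<open>f\<close>;
  when \<open>Z\<close> is a function of \<open>(X, Y)\<close>, choosing that function makes the
  identity hold at every pair, also at those of probability zero.\<close>

lemma exists_kernel:
  fixes pJ :: "('x::finite \<times> 'y::finite \<times> 'z \<times> nat) pmf"
  assumes "finite (set_pmf pJ)"
  obtains k where "\<And>s. finite (set_pmf (k s))"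
    "\<And>s. s \<notin> (\<lambda>(x, y, z, j). (x, y)) ` set_pmf pJ \<Longrightarrow> k s = return_pmf (f s, 0)"
    "\<And>x y z j. (z, j) \<in> set_pmf (k (x, y)) \<Longrightarrow> (x, y) \<in> (\<lambda>(x, y, z, j). (x, y)) ` set_pmf pJ \<Longrightarrow> (x, y, z, j) \<in> set_pmf pJ"
    "pJ = extend_by k (map_pmf (\<lambda>(x, y, z, j). (x, y)) pJ)"
proof -
  let ?h = "\<lambda>(x :: 'x, y :: 'y, z :: 'z, j :: nat). (x, y)"
  let ?P = "map_pmf ?h pJ"
  define k where "k s = (if s \<in> ?h ` set_pmf pJ then map_pmf (\<lambda>(x, y, z, j). (z, j)) (cond_pmf pJ {w. ?h w = s})
    else return_pmf (f s, 0))" for s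
  have ne: "set_pmf pJ \<inter> {w. ?h w = s} \<noteq> {}" if "s \<in> ?h ` set_pmf pJ" for s using that by blast
  have "pJ = bind_pmf ?P (\<lambda>s. cond_pmf pJ {w. ?h w = s})"
  proof (rule bind_cond_pmf_cancel[symmetric])
    fix s w assume "?h w = s"
    have "{s. ?h w = s} = {s}" using \<open>?h w = s\<close> by auto
    moreover have "{w. ?h w = s} = ?h -` {s}" by auto
    ultimately show "measure_pmf.prob pJ {w. ?h w = s} = measure_pmf.prob ?P {s. ?h w = s}"
      by (simp only: measure_map_pmf)
  qed (use ne in auto)
  also have "\<dots> = extend_by k ?P"
    unfolding extend_by_def
  proof (intro bind_pmf_cong refl)
    fix s assume "s \<in> set_pmf ?P"
    hence s: "s \<in> ?h ` set_pmf pJ" by simp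
    obtain x y where xy: "s = (x, y)" by (cases s)
    have "map_pmf (\<lambda>(z, j). (x, y, z, j)) (k s) = map_pmf (\<lambda>(_, _, z, j). (x, y, z, j)) (cond_pmf pJ {w. ?h w = s})"
      using s by (simp add: k_def map_pmf_comp case_prod_unfold)
    also have "\<dots> = map_pmf (\<lambda>w. w) (cond_pmf pJ {w. ?h w = s})"
      using set_cond_pmf[OF ne[OF s]] xy by (intro map_pmf_cong refl) auto
    finally show "cond_pmf pJ {w. ?h w = s} = (case s of (x, y) \<Rightarrow> map_pmf (\<lambda>(z, j). (x, y, z, j)) (k (x, y)))"
      by (simp add: xy del: map_pmf_ident) simp
  qed
  finally have 1: "pJ = extend_by k ?P" .
  show ?thesis
  proof (rule that[of k, OF _ _ _ 1])
    show "finite (set_pmf (k s))" for s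
      using assms by (auto simp: k_def set_cond_pmf[OF ne])
    show "(x, y, z, j) \<in> set_pmf pJ" if "(z, j) \<in> set_pmf (k (x, y))" "(x, y) \<in> ?h ` set_pmf pJ" for x y z j
      using that by (auto simp: k_def set_cond_pmf[OF ne])
  qed (simp add: k_def)
qed

lemma pmf_joint:
  fixes k :: "('x \<times> 'y) \<Rightarrow> ('z \<times> nat) pmf"
  shows "pmf (joint k M) (x, y, z, j, u, v) = pmf M (u, v, x, y) * pmf (k (x, y)) (z, j)"
proof -
  let ?g = "\<lambda>((u :: nat, v :: nat, x :: 'x, y :: 'y), (z :: 'z, j :: nat)). (x, y, z, j, u, v)"
  have "joint k M = map_pmf ?g (bind_pmf M (\<lambda>a. map_pmf (Pair a) (case a of (u, v, x, y) \<Rightarrow> k (x, y))))"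
    unfolding joint_def map_bind_pmf by (intro bind_pmf_cong refl) (auto simp: map_pmf_comp intro!: map_pmf_cong)
  moreover have "inj ?g" by (auto simp: inj_def)
  ultimately show ?thesis
    using pmf_map_inj'[of ?g _ "((u, v, x, y), (z, j))"]
    by (simp add: pmf_bind_Pair)
qed

lemma pmf_extend_by:
  fixes k :: "('x \<times> 'y) \<Rightarrow> ('z \<times> nat) pmf"
  shows "pmf (extend_by k P) (x, y, z, j) = pmf P (x, y) * pmf (k (x, y)) (z, j)"
proof -
  let ?g = "\<lambda>((x :: 'x, y :: 'y), (z :: 'z, j :: nat)). (x, y, z, j)"
  have "extend_by k P = map_pmf ?g (bind_pmf P (\<lambda>a. map_pmf (Pair a) (k a)))"
    unfolding extend_by_def map_bind_pmf by (intro bind_pmf_cong refl) (auto simp: map_pmf_comp intro!: map_pmf_cong)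
  moreover have "inj ?g" by (auto simp: inj_def)
  ultimately show ?thesis
    using pmf_map_inj'[of ?g _ "((x, y), (z, j))"]
    by (simp add: pmf_bind_Pair)
qed

lemma joint_marginals:
  "map_pmf (\<lambda>(x, y, z, j, u, v). (u, v, x, y)) (joint k M) = M"
  "map_pmf (\<lambda>(x, y, z, j, u, v). (x, y, z, j)) (joint k M) = extend_by k (map_pmf (\<lambda>(u, v, x, y). (x, y)) M)"
  "map_pmf (\<lambda>(x, y, z, j, u, v). (x, y)) (joint k M) = map_pmf (\<lambda>(u, v, x, y). (x, y)) M"
proof -
  have "map_pmf (\<lambda>(x, y, z, j, u, v). (u, v, x, y)) (joint k M) = bind_pmf M return_pmf"
    unfolding joint_def map_bind_pmf
    by (intro bind_pmf_cong refl) (auto simp: map_pmf_comp case_prod_unfold)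
  thus "map_pmf (\<lambda>(x, y, z, j, u, v). (u, v, x, y)) (joint k M) = M" by (simp add: bind_return_pmf')
  show "map_pmf (\<lambda>(x, y, z, j, u, v). (x, y, z, j)) (joint k M) = extend_by k (map_pmf (\<lambda>(u, v, x, y). (x, y)) M)"
    unfolding joint_def extend_by_def map_bind_pmf bind_map_pmf
    by (intro bind_pmf_cong refl) (auto simp: map_pmf_comp case_prod_unfold)
  show "map_pmf (\<lambda>(x, y, z, j, u, v). (x, y)) (joint k M) = map_pmf (\<lambda>(u, v, x, y). (x, y)) M"
    unfolding joint_def map_bind_pmf map_pmf_def[of "\<lambda>(u, v, x, y). (x, y)"]
    by (intro bind_pmf_cong refl) (auto simp: map_pmf_comp case_prod_unfold)
qed

text \<open>The Markov condition becomes a system of polynomial equations between masses. This form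
  serves both to reconstruct the law from its marginals and to prove closedness.\<close>

lemma pmf_cond_indep_iff:
  "pmf_cond_indep q (\<lambda>(x, y, z, j, u, v). (u, v)) (\<lambda>(x, y, z, j, u, v). (j, z)) (\<lambda>(x, y, z, j, u, v). (x, y)) \<longleftrightarrow>
   (\<forall>x y z j u v. pmf q (x, y, z, j, u, v) * pmf (map_pmf (\<lambda>(x, y, z, j, u, v). (x, y)) q) (x, y) =
      pmf (map_pmf (\<lambda>(x, y, z, j, u, v). (u, v, x, y)) q) (u, v, x, y) *
      pmf (map_pmf (\<lambda>(x, y, z, j, u, v). (x, y, z, j)) q) (x, y, z, j))"
  (is "?L \<longleftrightarrow> ?R")
proof -
  have A: "\<P>(w in q. (\<lambda>(x, y, z, j, u, v). (u, v)) w = (u, v) \<and> (\<lambda>(x, y, z, j, u, v). (j, z)) w = (j, z) \<and> (\<lambda>(x, y, z, j, u, v). (x, y)) w = (x, y)) = pmf q (x, y, z, j, u, v)"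
    for x y z j u v by (auto simp: measure_pmf_single[symmetric] intro!: arg_cong[where f="measure _"])
  have B: "\<P>(w in q. (\<lambda>(x, y, z, j, u, v). (x, y)) w = (x, y)) = pmf (map_pmf (\<lambda>(x, y, z, j, u, v). (x, y)) q) (x, y)"
    for x y by (auto simp: pmf_map intro!: arg_cong[where f="measure _"])
  have C: "\<P>(w in q. (\<lambda>(x, y, z, j, u, v). (u, v)) w = (u, v) \<and> (\<lambda>(x, y, z, j, u, v). (x, y)) w = (x, y)) = pmf (map_pmf (\<lambda>(x, y, z, j, u, v). (u, v, x, y)) q) (u, v, x, y)"
    for x y u v by (auto simp: pmf_map intro!: arg_cong[where f="measure _"])
  have D: "\<P>(w in q. (\<lambda>(x, y, z, j, u, v). (j, z)) w = (j, z) \<and> (\<lambda>(x, y, z, j, u, v). (x, y)) w = (x, y)) = pmf (map_pmf (\<lambda>(x, y, z, j, u, v). (x, y, z, j)) q) (x, y, z, j)"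
    for x y j z by (auto simp: pmf_map intro!: arg_cong[where f="measure _"])
  show ?thesis
    unfolding pmf_cond_indep_def split_paired_All A B C D by blast
qed

lemma pmf_map_zero: 
  assumes "pmf (map_pmf f q) (f w) = 0" shows "pmf q w = 0"
  using assms by (metis imageI set_map_pmf set_pmf_iff)

lemma cond_indep_joint:
  "pmf_cond_indep (joint k M) (\<lambda>(x, y, z, j, u, v). (u, v)) (\<lambda>(x, y, z, j, u, v). (j, z)) (\<lambda>(x, y, z, j, u, v). (x, y))"
  unfolding pmf_cond_indep_iff joint_marginals pmf_joint pmf_extend_by by simp

text \<open>Dividing the Markov equation by \<open>pmf P (x, y)\<close> expresses the law through
  that of \<open>(U, V, X, Y)\<close> and the kernel.\<close>

lemma feasible0_joint:
  fixes k :: "('x::finite \<times> 'y::finite) \<Rightarrow> ('z::finite \<times> nat) pmf"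
  assumes "feasible0 (extend_by k P) q"
  shows "q = joint k (map_pmf (\<lambda>(x, y, z, j, u, v). (u, v, x, y)) q)" and
    "map_pmf (\<lambda>(x, y, z, j, u, v). (x, y)) q = P"
proof -
  let ?M = "map_pmf (\<lambda>(x, y, z, j, u, v). (u, v, x, y)) q"
  have m: "map_pmf (\<lambda>(x, y, z, j, u, v). (x, y, z, j)) q = extend_by k P"
    using assms by (simp add: feasible0_def)
  have "map_pmf (\<lambda>(x, y, z, j, u, v). (x, y)) q = map_pmf (\<lambda>(x, y, z, j). (x, y)) (map_pmf (\<lambda>(x, y, z, j, u, v). (x, y, z, j)) q)"
    by (simp add: map_pmf_comp case_prod_unfold)
  also have "\<dots> = bind_pmf P return_pmf"
    unfolding m extend_by_def map_bind_pmf by (intro bind_pmf_cong refl) (auto simp: map_pmf_comp case_prod_unfold)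
  finally show P: "map_pmf (\<lambda>(x, y, z, j, u, v). (x, y)) q = P" by (simp add: bind_return_pmf')
  have ci: "\<forall>x y z j u v. pmf q (x, y, z, j, u, v) * pmf (map_pmf (\<lambda>(x, y, z, j, u, v). (x, y)) q) (x, y) =
      pmf ?M (u, v, x, y) * pmf (map_pmf (\<lambda>(x, y, z, j, u, v). (x, y, z, j)) q) (x, y, z, j)"
    using assms unfolding feasible0_def pmf_cond_indep_iff by (elim conjE)
  show "q = joint k ?M"
  proof (rule pmf_eqI)
    fix w :: "'x \<times> 'y \<times> 'z \<times> nat \<times> nat \<times> nat"
    obtain x y z j u v where w: "w = (x, y, z, j, u, v)" by (cases w)
    have ci: "pmf q w * pmf P (x, y) = pmf ?M (u, v, x, y) * (pmf P (x, y) * pmf (k (x, y)) (z, j))"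
      using ci[rule_format, of x y z j u v] by (simp only: P m pmf_extend_by w)
    show "pmf q w = pmf (joint k ?M) w"
    proof (cases "pmf P (x, y) = 0")
      case False
      thus ?thesis using ci by (simp add: w pmf_joint)
    next
      \<comment> \<open>Division is impossible here, but both masses vanish because each has a
        marginal that is zero.\<close>
      case True
      hence "pmf q w = 0" using pmf_map_zero[of "\<lambda>(x, y, z, j, u, v). (x, y)" q w] by (simp add: P w)
      moreover have "map_pmf (\<lambda>(u, v, x, y). (x, y)) ?M = P"
        using P by (simp add: map_pmf_comp case_prod_unfold)
      hence "pmf ?M (u, v, x, y) = 0"
        using True pmf_map_zero[of "\<lambda>(u, v, x, y). (x, y)" ?M "(u, v, x, y)"] by simp
      ultimately show ?thesis by (simp add: w pmf_joint)
    qed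
  qed
qed

text \<open>The function \<open>h\<close> lets one statement cover \<open>V\<close> alone and the
  pair \<open>(U, V)\<close>.\<close>

lemma ent_joint:
  fixes k :: "('x::finite \<times> 'y::finite) \<Rightarrow> ('z \<times> nat) pmf"
  assumes k: "\<And>s. finite (set_pmf (k s))" and A: "finite A" "\<And>u v s. (u, v, s) \<in> set_pmf M \<Longrightarrow> h u v \<in> A"
  shows "ent (map_pmf (\<lambda>(x, y, z, j, u, v). (h u v, j)) (joint k M)) - ent (map_pmf (\<lambda>(x, y, z, j, u, v). (h u v, z)) (joint k M))
    = (\<Sum>a\<in>A. phi k (\<chi> s. pmf (map_pmf (\<lambda>(u, v, s). (h u v, s)) M) (a, s)))"
proof -
  let ?M = "map_pmf (\<lambda>(u, v, s). (h u v, s)) M"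
  have 1: "map_pmf (\<lambda>(x, y, z, j, u, v). (h u v, j)) (joint k M) = bind_pmf ?M (\<lambda>(a, s). map_pmf (Pair a) (map_pmf snd (k s)))"
    and 2: "map_pmf (\<lambda>(x, y, z, j, u, v). (h u v, z)) (joint k M) = bind_pmf ?M (\<lambda>(a, s). map_pmf (Pair a) (map_pmf fst (k s)))"
    unfolding joint_def map_bind_pmf bind_map_pmf
    by (intro bind_pmf_cong refl; auto simp: map_pmf_comp case_prod_unfold)+
  have A': "fst ` set_pmf ?M \<subseteq> A" using A(2) by auto
  show ?thesis
    unfolding 1 2 phi_def sum_subtractf using k A(1) A'
    by (simp add: ent_bind_kernel)
qed

lemma finite_extend_by:
  fixes k :: "('x::finite \<times> 'y::finite) \<Rightarrow> ('z \<times> nat) pmf"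
  assumes "\<And>s. finite (set_pmf (k s))"
  shows "finite (set_pmf (extend_by k P))"
  using assms by (auto simp: extend_by_def)

text \<open>\<open>J\<close> and \<open>Z\<close> occur with opposite signs, so \<open>H(V)\<close>
  and \<open>H(U,V)\<close> cancel. What remains are \<open>H(V,J) - H(V,Z)\<close> and
  \<open>H(U,V,J) - H(U,V,Z)\<close>, each a sum of \<open>phi\<close> over the corresponding
  vectors; \<open>I(X;Y|J)\<close> only depends on the law of \<open>(X, Y, J)\<close>.\<close>

lemma feasible0_values:
  fixes k :: "('x::finite \<times> 'y::finite) \<Rightarrow> ('z::finite \<times> nat) pmf"
  assumes k: "\<And>s. finite (set_pmf (k s))" and q: "feasible0 (extend_by k P) q"
  defines "M \<equiv> map_pmf (\<lambda>(x, y, z, j, u, v). (u, v, x, y)) q"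
    and "m \<equiv> CARD('x) * CARD('y)"
  shows "slack q = (\<Sum>v<m + 1. phi k (\<Sum>u<m. \<chi> s. pmf M (u, v, s))) - ent (map_pmf (\<lambda>(x, y, z, j). j) (extend_by k P))" (is ?slack)
    and "objective q = pmf_cond_mutual_info (extend_by k P) (\<lambda>(x, y, z, j). x) (\<lambda>(x, y, z, j). y) (\<lambda>(x, y, z, j). j)
      + (\<Sum>v<m + 1. phi k (\<Sum>u<m. \<chi> s. pmf M (u, v, s))) - (\<Sum>v<m + 1. \<Sum>u<m. phi k (\<chi> s. pmf M (u, v, s)))" (is ?obj)
proof -
  have fin: "finite (set_pmf q)" using finite_feasible0[OF q finite_extend_by] k by blast
  have qM: "q = joint k M" unfolding M_def by (rule feasible0_joint[OF q])
  have sub: "u < m" "v < m + 1" if "(u, v, s) \<in> set_pmf M" for u v s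
    using that q unfolding M_def m_def feasible0_def by auto
  let ?S = "{..<m} \<times> {..<m + 1} \<times> (UNIV :: ('x \<times> 'y) set)"
  have S: "set_pmf M \<subseteq> ?S" using sub by auto
  have vec1: "(\<chi> s. pmf (map_pmf (\<lambda>(u, v, s). (v, s)) M) (v, s)) = (\<Sum>u<m. \<chi> s. pmf M (u, v, s))" if "v < m + 1" for v
  proof (simp only: vec_eq_iff vec_lambda_beta sum_component, intro allI)
    fix s
    have "pmf (map_pmf (\<lambda>(u, v, s). (v, s)) M) (v, s) = (\<Sum>w | w \<in> ?S \<and> (\<lambda>(u, v, s). (v, s)) w = (v, s). pmf M w)"
      using S by (intro pmf_map_eq_sum_superset) auto
    also have "{w. w \<in> ?S \<and> (\<lambda>(u, v, s). (v, s)) w = (v, s)} = (\<lambda>u. (u, v, s)) ` {..<m}" using that by auto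
    also have "sum (pmf M) \<dots> = (\<Sum>u<m. pmf M (u, v, s))" by (simp add: sum.reindex inj_on_def)
    finally show "pmf (map_pmf (\<lambda>(u, v, s). (v, s)) M) (v, s) = (\<Sum>u<m. pmf M (u, v, s))" .
  qed
  have vec2: "pmf (map_pmf (\<lambda>(u, v, s). ((u, v), s)) M) (a, s) = pmf M (fst a, snd a, s)" for a s
    using pmf_map_inj'[of "\<lambda>(u, v, s). ((u, v), s)" M "(fst a, snd a, s)"] by (simp add: inj_def)
  have H1: "ent (map_pmf (\<lambda>(x, y, z, j, u, v). (v, j)) q) - ent (map_pmf (\<lambda>(x, y, z, j, u, v). (v, z)) q)
     = (\<Sum>v<m + 1. phi k (\<Sum>u<m. \<chi> s. pmf M (u, v, s)))"
    unfolding qM by (subst ent_joint[OF k, where A = "{..<m + 1}"]) (use sub vec1 in auto)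
  have "ent (map_pmf (\<lambda>(x, y, z, j, u, v). ((u, v), j)) q) - ent (map_pmf (\<lambda>(x, y, z, j, u, v). ((u, v), z)) q)
     = (\<Sum>a\<in>{..<m} \<times> {..<m + 1}. phi k (\<chi> s. pmf M (fst a, snd a, s)))"
    unfolding qM by (subst ent_joint[OF k, where A = "{..<m} \<times> {..<m + 1}"]) (use sub vec2 in auto)
  also have "\<dots> = (\<Sum>u<m. \<Sum>v<m + 1. phi k (\<chi> s. pmf M (u, v, s)))"
    by (subst sum.cartesian_product) (simp add: case_prod_unfold)
  finally have H2: "ent (map_pmf (\<lambda>(x, y, z, j, u, v). ((u, v), j)) q) - ent (map_pmf (\<lambda>(x, y, z, j, u, v). ((u, v), z)) q)
     = (\<Sum>v<m + 1. \<Sum>u<m. phi k (\<chi> s. pmf M (u, v, s)))" by (subst sum.swap)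
  have pJ: "extend_by k P = map_pmf (\<lambda>(x, y, z, j, u, v). (x, y, z, j)) q"
    using q by (simp add: feasible0_def)
  have "ent (map_pmf (\<lambda>(x, y, z, j). j) (extend_by k P)) = ent (map_pmf (\<lambda>(x, y, z, j, u, v). j) q)"
    unfolding pJ by (simp add: map_pmf_comp case_prod_unfold)
  thus ?slack unfolding H1[symmetric] slack_def pmf_mutual_info_eq[OF fin] pmf_entropy_eq[OF fin]
    by (simp add: case_prod_unfold)
  have "ent (map_pmf (\<lambda>w. (case w of (x, y, z, j, u, v) \<Rightarrow> u, case w of (x, y, z, j, u, v) \<Rightarrow> j, case w of (x, y, z, j, u, v) \<Rightarrow> v)) q)
      = ent (map_pmf (\<lambda>(x, y, z, j, u, v). ((u, v), j)) q)"
    "ent (map_pmf (\<lambda>w. (case w of (x, y, z, j, u, v) \<Rightarrow> u, case w of (x, y, z, j, u, v) \<Rightarrow> z, case w of (x, y, z, j, u, v) \<Rightarrow> v)) q)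
      = ent (map_pmf (\<lambda>(x, y, z, j, u, v). ((u, v), z)) q)"
    "ent (map_pmf (\<lambda>w. (case w of (x, y, z, j, u, v) \<Rightarrow> j, case w of (x, y, z, j, u, v) \<Rightarrow> v)) q)
      = ent (map_pmf (\<lambda>(x, y, z, j, u, v). (v, j)) q)"
    "ent (map_pmf (\<lambda>w. (case w of (x, y, z, j, u, v) \<Rightarrow> z, case w of (x, y, z, j, u, v) \<Rightarrow> v)) q)
      = ent (map_pmf (\<lambda>(x, y, z, j, u, v). (v, z)) q)"
    by (rule ent_map_cong[OF fin]; auto)+
  note R = this
  have I0: "pmf_cond_mutual_info (extend_by k P) (\<lambda>(x, y, z, j). x) (\<lambda>(x, y, z, j). y) (\<lambda>(x, y, z, j). j)
    = pmf_cond_mutual_info q (\<lambda>(x, y, z, j, u, v). x) (\<lambda>(x, y, z, j, u, v). y) (\<lambda>(x, y, z, j, u, v). j)"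
    unfolding pmf_cond_mutual_info_eq[OF finite_extend_by[OF k]] pmf_cond_mutual_info_eq[OF fin]
    unfolding pJ by (simp add: map_pmf_comp case_prod_unfold)
  show ?obj
    unfolding objective_def I0 H1[symmetric] H2[symmetric] pmf_cond_mutual_info_eq[OF fin, of "\<lambda>(x, y, z, j, u, v). u"] R
    by simp
qed

lemma feasible0_total:
  fixes P :: "('x::finite \<times> 'y::finite) pmf" and q :: "('x \<times> 'y \<times> 'z::finite \<times> nat \<times> nat \<times> nat) pmf"
  assumes q: "feasible0 (extend_by k P) q"
  defines "M \<equiv> map_pmf (\<lambda>(x, y, z, j, u, v). (u, v, x, y)) q"
    and "m \<equiv> CARD('x) * CARD('y)"
  shows "(\<Sum>v<m + 1. \<Sum>u<m. \<chi> s. pmf M (u, v, s)) = (\<chi> s. pmf P s)"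
proof (simp only: vec_eq_iff vec_lambda_beta sum_component, intro allI)
  fix s
  have P: "P = map_pmf (\<lambda>(u, v, s). s) M"
    using feasible0_joint(2)[OF q] by (simp add: M_def map_pmf_comp case_prod_unfold)
  let ?S = "{..<m} \<times> {..<m + 1} \<times> (UNIV :: ('x \<times> 'y) set)"
  have S: "set_pmf M \<subseteq> ?S" using q unfolding M_def m_def feasible0_def by auto
  have "pmf P s = (\<Sum>w | w \<in> ?S \<and> (\<lambda>(u, v, s). s) w = s. pmf M w)"
    unfolding P using S by (intro pmf_map_eq_sum_superset) auto
  also have "{w. w \<in> ?S \<and> (\<lambda>(u, v, s). s) w = s} = (\<lambda>(v, u). (u, v, s)) ` ({..<m + 1} \<times> {..<m})" by force
  also have "sum (pmf M) \<dots> = (\<Sum>(v, u)\<in>{..<m + 1} \<times> {..<m}. pmf M (u, v, s))"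
    by (subst sum.reindex) (auto simp: inj_on_def case_prod_unfold)
  finally show "(\<Sum>v<m + 1. \<Sum>u<m. pmf M (u, v, s)) = pmf P s"
    by (simp add: sum.cartesian_product)
qed

text \<open>The way back from vectors to random variables: the reduced family, read as masses of
  \<open>(u, v, s)\<close>, is a law with the required alphabets. The constraint value is kept
  exactly, and the objective can only grow.\<close>

lemma family_to_feasible:
  fixes k :: "('x::finite \<times> 'y::finite) \<Rightarrow> ('z::finite \<times> nat) pmf"
  assumes k: "\<And>s. finite (set_pmf (k s))" and red: "reduction (phi k) D"
    and finV: "finite V" and finU: "\<And>v. v \<in> V \<Longrightarrow> finite (U v)"
    and nn: "\<And>v u s. v \<in> V \<Longrightarrow> u \<in> U v \<Longrightarrow> a v u $ s \<ge> 0"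
    and total: "(\<Sum>v\<in>V. \<Sum>u\<in>U v. a v u) = (\<chi> s. pmf P s)"
  obtains M where "feasible0 (extend_by k P) (joint k M)" "\<And>u v. D (\<chi> s. pmf M (u, v, s))"
    "slack (joint k M) = (\<Sum>v\<in>V. phi k (\<Sum>u\<in>U v. a v u)) - ent (map_pmf (\<lambda>(x, y, z, j). j) (extend_by k P))"
    "objective (joint k M) \<ge> pmf_cond_mutual_info (extend_by k P) (\<lambda>(x, y, z, j). x) (\<lambda>(x, y, z, j). y) (\<lambda>(x, y, z, j). j)
      + (\<Sum>v\<in>V. phi k (\<Sum>u\<in>U v. a v u)) - (\<Sum>v\<in>V. \<Sum>u\<in>U v. phi k (a v u))"
proof -
  define m where "m = CARD('x) * CARD('y)"
  obtain b :: "nat \<Rightarrow> nat \<Rightarrow> real ^ ('x \<times> 'y)" where b: "\<And>v u s. b v u $ s \<ge> 0" "\<And>v u. D (b v u)"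
    "(\<Sum>v<m + 1. \<Sum>u<m. b v u) = (\<chi> s. pmf P s)"
    "(\<Sum>v<m + 1. phi k (\<Sum>u<m. b v u)) = (\<Sum>v\<in>V. phi k (\<Sum>u\<in>U v. a v u))"
    "(\<Sum>v<m + 1. \<Sum>u<m. phi k (b v u)) \<le> (\<Sum>v\<in>V. \<Sum>u\<in>U v. phi k (a v u))"
    by (rule reduction_family[OF red finV, where U = U and a = a, OF finU nn, unfolded total card_prod, folded m_def])
      ((rule that; assumption) | assumption)+
  let ?S = "{..<m} \<times> {..<m + 1} \<times> (UNIV :: ('x \<times> 'y) set)"
  have comp: "(\<Sum>v<m + 1. \<Sum>u<m. b v u $ s) = pmf P s" for s
    using arg_cong[OF b(3), of "\<lambda>a. a $ s"] by (simp add: sum_component)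
  have "(\<Sum>(u, v, s)\<in>?S. b v u $ s) = (\<Sum>u<m. \<Sum>v<m + 1. \<Sum>s\<in>UNIV. b v u $ s)"
    by (simp only: sum.cartesian_product)
  also have "\<dots> = (\<Sum>v<m + 1. \<Sum>u<m. \<Sum>s\<in>UNIV. b v u $ s)" by (rule sum.swap)
  also have "\<dots> = (\<Sum>v<m + 1. \<Sum>s\<in>UNIV. \<Sum>u<m. b v u $ s)" by (intro sum.cong refl sum.swap)
  also have "\<dots> = (\<Sum>s\<in>UNIV. \<Sum>v<m + 1. \<Sum>u<m. b v u $ s)" by (rule sum.swap)
  also have "\<dots> = 1" unfolding comp by (rule sum_pmf_eq_1) auto
  finally have 1: "(\<Sum>w\<in>?S. (\<lambda>(u, v, s). b v u $ s) w) = 1" by (simp add: case_prod_unfold)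
  obtain M where M: "set_pmf M \<subseteq> ?S" "\<And>w. w \<in> ?S \<Longrightarrow> pmf M w = (\<lambda>(u, v, s). b v u $ s) w"
    using pmf_of_weights[OF _ _ 1] b(1) by (auto simp: case_prod_unfold)
  have Mb: "pmf M (u, v, s) = b v u $ s" if "u < m" "v < m + 1" for u v s
    using M(2)[of "(u, v, s)"] that by simp
  have M0: "pmf M (u, v, s) = 0" if "\<not> (u < m \<and> v < m + 1)" for u v s
    using M(1) that by (auto simp: set_pmf_iff)
  have P: "map_pmf (\<lambda>(u, v, x, y). (x, y)) M = P"
  proof (rule pmf_eqI)
    fix s
    have "pmf (map_pmf (\<lambda>(u, v, x, y). (x, y)) M) s = (\<Sum>w | w \<in> ?S \<and> (\<lambda>(u, v, x, y). (x, y)) w = s. pmf M w)"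
      using M(1) by (intro pmf_map_eq_sum_superset) auto
    also have "{w. w \<in> ?S \<and> (\<lambda>(u, v, x, y). (x, y)) w = s} = (\<lambda>(v, u). (u, v, s)) ` ({..<m + 1} \<times> {..<m})" by force
    also have "sum (pmf M) \<dots> = (\<Sum>(v, u)\<in>{..<m + 1} \<times> {..<m}. pmf M (u, v, s))"
      by (subst sum.reindex) (auto simp: inj_on_def case_prod_unfold)
    also have "\<dots> = (\<Sum>(v, u)\<in>{..<m + 1} \<times> {..<m}. b v u $ s)"
      by (rule sum.cong) (auto intro!: Mb)
    also have "\<dots> = (\<Sum>v<m + 1. \<Sum>u<m. b v u $ s)" by (rule sum.cartesian_product[symmetric])
    finally show "pmf (map_pmf (\<lambda>(u, v, x, y). (x, y)) M) s = pmf P s" by (simp only: comp)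
  qed
  have feas: "feasible0 (extend_by k P) (joint k M)"
    unfolding feasible0_def joint_marginals P m_def[symmetric]
    using cond_indep_joint[of k M] M(1) by (auto simp: joint_def)
  have vec: "(\<chi> s. pmf M (u, v, s)) = b v u" if "u < m" "v < m + 1" for u v
    using Mb that by (simp add: vec_eq_iff)
  \<comment> \<open>Labels outside the alphabets carry the zero vector, for which \<open>D 0\<close>
    is needed.\<close>
  have D: "D (\<chi> s. pmf M (u, v, s))" for u v
  proof (cases "u < m \<and> v < m + 1")
    case False
    hence "(\<chi> s. pmf M (u, v, s)) = 0" by (simp add: vec_eq_iff M0)
    thus ?thesis using reduction_D_0[OF red] by simp
  qed (use vec b(2) in simp)
  have s1: "(\<Sum>v<m + 1. phi k (\<Sum>u<m. \<chi> s. pmf M (u, v, s))) = (\<Sum>v\<in>V. phi k (\<Sum>u\<in>U v. a v u))"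
    using vec b(4) by simp
  have s2: "(\<Sum>v<m + 1. \<Sum>u<m. phi k (\<chi> s. pmf M (u, v, s))) \<le> (\<Sum>v\<in>V. \<Sum>u\<in>U v. phi k (a v u))"
    using vec b(5) by simp
  show ?thesis
    by (rule that[OF feas D]) (use feasible0_values[OF k feas, unfolded joint_marginals, folded m_def] s1 s2 in auto)
qed

text \<open>Two support points with equal \<open>(u, v, z)\<close> have their pairs
  \<open>(x, y)\<close> in one fibre of \<open>f\<close>, both with positive mass at
  \<open>(u, v)\<close>, so the pairs agree. Adding \<open>(X, Y)\<close> to
  \<open>(U, V, Z)\<close> thus does not refine the partition of the support.\<close>

lemma xy_determined_joint:
  fixes k :: "('x::finite \<times> 'y::finite) \<Rightarrow> ('z::finite \<times> nat) pmf"
  assumes fin: "finite (set_pmf (joint k M))" and f: "\<And>s. map_pmf fst (k s) = return_pmf (f s)"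
    and M: "\<And>u v. selects f (\<chi> s. pmf M (u, v, s))"
  shows "xy_determined (joint k M)"
proof -
  let ?A = "\<lambda>(x, y, z, j, u, v). (x, y)" and ?B = "\<lambda>(x, y, z, j, u, v). (u, v, z)"
  have z: "z = f (x, y)" if "(z, j) \<in> set_pmf (k (x, y))" for x y z j
  proof -
    have "z \<in> set_pmf (map_pmf fst (k (x, y)))" using that by force
    thus ?thesis unfolding f by simp
  qed
  have "ent (map_pmf (\<lambda>w. (?A w, ?B w)) (joint k M)) = ent (map_pmf ?B (joint k M))"
  proof (rule ent_map_cong[OF fin])
    fix w w' assume w: "w \<in> set_pmf (joint k M)" "w' \<in> set_pmf (joint k M)"
    obtain x y z j u v where W: "w = (x, y, z, j, u, v)" by (cases w)
    obtain x' y' z' j' u' v' where W': "w' = (x', y', z', j', u', v')" by (cases w')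
    have 1: "pmf M (u, v, x, y) > 0" "z = f (x, y)" and 2: "pmf M (u', v', x', y') > 0" "z' = f (x', y')"
      using w z unfolding W W' by (auto simp: joint_def pmf_positive)
    show "(?A w, ?B w) = (?A w', ?B w') \<longleftrightarrow> ?B w = ?B w'"
      using M[of u v] 1 2 unfolding W W' selects_def by fastforce
  qed
  thus ?thesis unfolding xy_determined_def pmf_cond_entropy_eq[OF fin] by simp
qed

section \<open>Compactness\<close>

text \<open>Only the point 0 needs an argument: \<open>x log x\<close> tends to 0 from the
  right.\<close>

lemma continuous_on_neg_xlogx: "continuous_on {0..} neg_xlogx"
proof -
  have "((\<lambda>x::real. - (x * (ln x / ln 2))) \<longlongrightarrow> 0) (at_right 0)" by real_asymp
  hence 0: "(neg_xlogx \<longlongrightarrow> neg_xlogx 0) (at 0 within {0..})"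
    unfolding neg_xlogx_def log_def by (simp add: at_within_Ici_at_right)
  have "isCont neg_xlogx x" if "x > 0" for x
    using that unfolding neg_xlogx_def log_def by (auto intro!: continuous_intros)
  thus ?thesis using 0 unfolding continuous_on_eq_continuous_within
    by (metis atLeast_iff continuous_at_imp_continuous_at_within continuous_within le_less)
qed

lemma continuous_on_coordinate: "continuous_on T (\<lambda>f :: _ \<Rightarrow> real. f w)"
  by (rule continuous_on_subset[OF continuous_on_product_coordinates]) simp

text \<open>Entropy as a function of the mass function, so that continuity refers to the product
  topology on real-valued functions.\<close>

definition ent_fun :: "'w set \<Rightarrow> ('w \<Rightarrow> 'a) \<Rightarrow> ('w \<Rightarrow> real) \<Rightarrow> real" where
  "ent_fun S A f = (\<Sum>a\<in>A ` S. neg_xlogx (\<Sum>w | w \<in> S \<and> A w = a. f w))"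

lemma ent_map_eq_ent_fun:
  assumes "finite S" "set_pmf q \<subseteq> S"
  shows "ent (map_pmf A q) = ent_fun S A (pmf q)"
proof -
  have "ent (map_pmf A q) = (\<Sum>a\<in>A ` S. neg_xlogx (pmf (map_pmf A q) a))"
    using assms by (intro ent_eq_sum_neg_xlogx) auto
  thus ?thesis by (simp add: ent_fun_def pmf_map_eq_sum_superset[OF assms])
qed

lemma continuous_on_ent_fun:
  assumes "\<And>f w. f \<in> T \<Longrightarrow> w \<in> S \<Longrightarrow> f w \<ge> 0"
  shows "continuous_on T (ent_fun S A)"
  unfolding ent_fun_def
  by (intro continuous_on_sum continuous_on_compose2[OF continuous_on_neg_xlogx] continuous_on_coordinate)
    (use assms in \<open>auto intro!: sum_nonneg\<close>)

text \<open>Values outside \<open>S\<close> are pinned to 0, which makes the set a closed part of a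
  product of compact sets over all of \<open>'w\<close>.\<close>

definition simplex_on :: "'w set \<Rightarrow> ('w \<Rightarrow> real) set" where
  "simplex_on S = {f. (\<forall>w. f w \<in> (if w \<in> S then {0..1} else {0})) \<and> (\<Sum>w\<in>S. f w) = 1}"

lemma compact_simplex_on: "compact (simplex_on S)"
proof -
  let ?B = "\<lambda>w. if w \<in> S then {0..1} else {0::real}"
  have "compactin (product_topology (\<lambda>_. euclidean) UNIV) (Pi\<^sub>E UNIV ?B)"
    by (subst compactin_PiE) auto
  hence "compact (Pi\<^sub>E UNIV ?B)"
    by (simp add: euclidean_product_topology)
  moreover have "closed {f :: _ \<Rightarrow> real. (\<Sum>w\<in>S. f w) = 1}"
    by (intro closed_Collect_eq continuous_on_sum continuous_on_coordinate continuous_on_const)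
  ultimately have "compact (Pi\<^sub>E UNIV ?B \<inter> {f. (\<Sum>w\<in>S. f w) = 1})" by (rule compact_Int_closed)
  also have "Pi\<^sub>E UNIV ?B \<inter> {f. (\<Sum>w\<in>S. f w) = 1} = simplex_on S"
    by (auto simp: simplex_on_def PiE_def Pi_def)
  finally show ?thesis .
qed

lemma continuous_on_simplex_ent_fun: "continuous_on (simplex_on S \<inter> C) (ent_fun S A)"
proof (rule continuous_on_ent_fun)
  fix f w assume "f \<in> simplex_on S \<inter> C" "w \<in> S"
  thus "f w \<ge> 0" by (auto simp: simplex_on_def dest!: spec[of _ w])
qed

lemma simplex_on_eq:
  assumes "finite S"
  shows "simplex_on S = pmf ` {q. set_pmf q \<subseteq> S}"
proof (intro equalityI subsetI)
  fix f assume f: "f \<in> simplex_on S"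
  hence nn: "f w \<ge> 0" and z: "w \<notin> S \<Longrightarrow> f w = 0" for w by (auto simp: simplex_on_def split: if_splits dest!: spec[of _ w])
  obtain q where q: "set_pmf q \<subseteq> S" "\<And>x. x \<in> S \<Longrightarrow> pmf q x = f x"
    using pmf_of_weights[OF assms, of f] nn f by (auto simp: simplex_on_def)
  have "f = pmf q"
  proof
    fix w show "f w = pmf q w"
      using q z[of w] by (cases "w \<in> S") (auto simp: set_pmf_iff subset_iff)
  qed
  thus "f \<in> pmf ` {q. set_pmf q \<subseteq> S}" using q by blast
next
  fix f assume "f \<in> pmf ` {q. set_pmf q \<subseteq> S}"
  then obtain q where "set_pmf q \<subseteq> S" "f = pmf q" by auto
  thus "f \<in> simplex_on S"
    using sum_pmf_eq_1[OF assms, of q]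
    by (auto simp: simplex_on_def pmf_le_1 set_pmf_iff subset_iff)
qed

lemma image_Collect_Int: "f ` {q. Q q} \<inter> C = f ` {q. Q q \<and> f q \<in> C}"
  by blast

text \<open>The mass functions of these laws form a closed subset of a simplex, on which both values
  are continuous. The values are kept as a pair because a limit has to respect rate and constraint
  simultaneously.\<close>

lemma compact_values:
  fixes pJ :: "('x::finite \<times> 'y::finite \<times> 'z::finite \<times> nat) pmf"
  assumes fin: "finite (set_pmf pJ)"
  shows "compact ((\<lambda>q. (objective q, slack q)) ` {q. feasible0 pJ q})"
proof -
  let ?S = "(UNIV :: 'x set) \<times> (UNIV :: 'y set) \<times> (UNIV :: 'z set) \<times> ((\<lambda>(x, y, z, j). j) ` set_pmf pJ)
     \<times> {..<CARD('x) * CARD('y)} \<times> {..<CARD('x) * CARD('y) + 1}"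
  let ?m = "\<lambda>f A a. \<Sum>w | w \<in> ?S \<and> A w = a. f w :: real"
  \<comment> \<open>The marginal condition and the Markov condition, as polynomial equations in the
    masses.\<close>
  let ?C = "{f. (\<forall>w. ?m f (\<lambda>(x, y, z, j, u, v). (x, y, z, j)) w = pmf pJ w)} \<inter>
    {f. \<forall>x y z j u v. f (x, y, z, j, u, v) * ?m f (\<lambda>(x, y, z, j, u, v). (x, y)) (x, y) =
      ?m f (\<lambda>(x, y, z, j, u, v). (u, v, x, y)) (u, v, x, y) * ?m f (\<lambda>(x, y, z, j, u, v). (x, y, z, j)) (x, y, z, j)}"
  have finS: "finite ?S" using fin by auto
  have closed: "closed ?C"
    by (intro closed_Int closed_Collect_all closed_Collect_eq continuous_intros continuous_on_coordinate)
  have feas: "feasible0 pJ q \<longleftrightarrow> set_pmf q \<subseteq> ?S \<and> pmf q \<in> ?C" for q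
  proof (cases "set_pmf q \<subseteq> ?S")
    case True
    have "(\<lambda>(x, y, z, j, u, v). v) ` set_pmf q \<subseteq> {..<CARD('x) * CARD('y) + 1}" "(\<lambda>(x, y, z, j, u, v). u) ` set_pmf q \<subseteq> {..<CARD('x) * CARD('y)}"
      using True by auto
    moreover have "map_pmf (\<lambda>(x, y, z, j, u, v). (x, y, z, j)) q = pJ \<longleftrightarrow>
      (\<forall>w. ?m (pmf q) (\<lambda>(x, y, z, j, u, v). (x, y, z, j)) w = pmf pJ w)"
      unfolding pmf_eq_iff pmf_map_eq_sum_superset[OF finS True] ..
    ultimately show ?thesis using True unfolding feasible0_def pmf_cond_indep_iff pmf_map_eq_sum_superset[OF finS True]
      by simp
  next
    case False
    thus ?thesis using feasible0_support by blast
  qed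
  let ?E = "\<lambda>A f. ent_fun ?S A f"
  let ?V = "\<lambda>(x, y, z, j, u, v). v" and ?U = "\<lambda>(x, y, z, j, u, v). u" and ?J = "\<lambda>(x, y, z, j, u, v). j"
    and ?Z = "\<lambda>(x, y, z, j, u, v). z" and ?Y = "\<lambda>(x, y, z, j, u, v). y" and ?X = "\<lambda>(x, y, z, j, u, v). x"
  let ?I = "\<lambda>A B C f. ?E (\<lambda>w. (A w, C w)) f + ?E (\<lambda>w. (B w, C w)) f - ?E (\<lambda>w. (A w, B w, C w)) f - ?E C f"
  let ?I2 = "\<lambda>A B f. ?E A f + ?E B f - ?E (\<lambda>w. (A w, B w)) f"
  let ?F = "\<lambda>f. (?I ?X ?Y ?J f + ?I ?U ?J ?V f - ?I ?U ?Z ?V f, ?I2 ?V ?Z f - ?I2 ?V ?J f - ?E ?Z f)"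
  have val: "(objective q, slack q) = ?F (pmf q)" if "set_pmf q \<subseteq> ?S" for q
  proof -
    have fq: "finite (set_pmf q)" using that finS by (rule finite_subset)
    show ?thesis
      unfolding objective_def slack_def pmf_cond_mutual_info_eq[OF fq] pmf_mutual_info_eq[OF fq] pmf_entropy_eq[OF fq]
        ent_map_eq_ent_fun[OF finS that] ..
  qed
  have sub: "set_pmf q \<subseteq> ?S" if "feasible0 pJ q" for q using that unfolding feas by (rule conjunct1)
  define T where "T = simplex_on ?S \<inter> ?C"
  have "T = pmf ` {q. set_pmf q \<subseteq> ?S \<and> pmf q \<in> ?C}"
    unfolding T_def simplex_on_eq[OF finS] by (rule image_Collect_Int)
  hence T: "T = pmf ` {q. feasible0 pJ q}" unfolding feas .
  have "(\<lambda>q. (objective q, slack q)) ` {q. feasible0 pJ q} = ?F ` T"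
    unfolding T image_image by (intro image_cong refl val sub) (simp only: mem_Collect_eq)
  moreover have "compact (?F ` T)"
    unfolding T_def
  proof (rule compact_continuous_image)
    show "continuous_on (simplex_on ?S \<inter> ?C) ?F"
      by (intro continuous_on_Pair continuous_on_add continuous_on_diff continuous_on_simplex_ent_fun)
    show "compact (simplex_on ?S \<inter> ?C)" by (intro compact_Int_closed compact_simplex_on closed)
  qed
  ultimately show ?thesis by (simp only:)
qed

section \<open>Public discussion\<close>

text \<open>Conditional mutual information as a combination of \<open>ent\<close>, for codomains of
  arbitrary type.\<close>

definition cmi :: "'w pmf \<Rightarrow> ('w \<Rightarrow> 'a) \<Rightarrow> ('w \<Rightarrow> 'b) \<Rightarrow> ('w \<Rightarrow> 'c) \<Rightarrow> real" where
  "cmi q A B C = ent (map_pmf (\<lambda>w. (A w, C w)) q) + ent (map_pmf (\<lambda>w. (B w, C w)) q)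
    - ent (map_pmf (\<lambda>w. (A w, B w, C w)) q) - ent (map_pmf C q)"

lemma cmi_cong:
  assumes "finite (set_pmf q)"
    and "\<And>w w'. w \<in> set_pmf q \<Longrightarrow> w' \<in> set_pmf q \<Longrightarrow> A w = A w' \<longleftrightarrow> A' w = A' w'"
    and "\<And>w w'. w \<in> set_pmf q \<Longrightarrow> w' \<in> set_pmf q \<Longrightarrow> B w = B w' \<longleftrightarrow> B' w = B' w'"
    and "\<And>w w'. w \<in> set_pmf q \<Longrightarrow> w' \<in> set_pmf q \<Longrightarrow> C w = C w' \<longleftrightarrow> C' w = C' w'"
  shows "cmi q A B C = cmi q A' B' C'"
proof -
  have "ent (map_pmf (\<lambda>w. (A w, C w)) q) = ent (map_pmf (\<lambda>w. (A' w, C' w)) q)"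
    "ent (map_pmf (\<lambda>w. (B w, C w)) q) = ent (map_pmf (\<lambda>w. (B' w, C' w)) q)"
    "ent (map_pmf (\<lambda>w. (A w, B w, C w)) q) = ent (map_pmf (\<lambda>w. (A' w, B' w, C' w)) q)"
    "ent (map_pmf C q) = ent (map_pmf C' q)"
    by (rule ent_map_cong[OF assms(1)]; simp add: assms(2-4))+
  thus ?thesis by (simp add: cmi_def)
qed

lemma cmi_map: "cmi (map_pmf g q) A B C = cmi q (\<lambda>w. A (g w)) (\<lambda>w. B (g w)) (\<lambda>w. C (g w))"
  by (simp add: cmi_def map_pmf_comp)

lemma cmi_commute:
  assumes "finite (set_pmf q)"
  shows "cmi q A B C = cmi q B A C"
proof -
  have "ent (map_pmf (\<lambda>w. (A w, B w, C w)) q) = ent (map_pmf (\<lambda>w. (B w, A w, C w)) q)"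
    by (rule ent_map_cong[OF assms]) auto
  thus ?thesis by (simp add: cmi_def)
qed

text \<open>Local randomness enters here: \<open>snd w\<close> is drawn by the kernel, and the
  earlier sample is kept as \<open>fst w\<close>.\<close>

definition attach :: "'w pmf \<Rightarrow> ('w \<Rightarrow> 'm pmf) \<Rightarrow> ('w \<times> 'm) pmf" where
  "attach q \<kappa> = bind_pmf q (\<lambda>w. map_pmf (Pair w) (\<kappa> w))"

lemma finite_attach:
  assumes "finite (set_pmf q)" "\<And>w. w \<in> set_pmf q \<Longrightarrow> finite (set_pmf (\<kappa> w))"
  shows "finite (set_pmf (attach q \<kappa>))"
  using assms by (auto simp: attach_def)

lemma map_fst_attach: "map_pmf (\<lambda>w. A (fst w)) (attach q \<kappa>) = map_pmf A q"
  by (simp add: attach_def map_bind_pmf map_pmf_comp map_pmf_def[of A])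

text \<open>By \<open>det\<close> the message depends on the sample only through \<open>A\<close>,
  so the chain rule applies at \<open>A\<close>. The increment is the same for every such
  \<open>A\<close>.\<close>

lemma ent_attach:
  assumes fin: "finite (set_pmf q)" "\<And>w. w \<in> set_pmf q \<Longrightarrow> finite (set_pmf (\<kappa> w))"
    and det: "\<And>w. \<kappa> w = \<kappa>' (A w)"
  shows "ent (map_pmf (\<lambda>w. (A (fst w), snd w)) (attach q \<kappa>)) = ent (map_pmf A q) + (\<Sum>w\<in>set_pmf q. pmf q w * ent (\<kappa> w))"
proof -
  have "map_pmf (\<lambda>w. (A (fst w), snd w)) (attach q \<kappa>) = bind_pmf (map_pmf A q) (\<lambda>a. map_pmf (Pair a) (\<kappa>' a))"
    by (simp add: attach_def map_bind_pmf map_pmf_comp bind_map_pmf det)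
  also have "ent \<dots> = ent (map_pmf A q) + (\<Sum>a\<in>set_pmf (map_pmf A q). pmf (map_pmf A q) a * ent (\<kappa>' a))"
    using fin by (intro ent_bind_Pair) (auto simp: det)
  also have "(\<Sum>a\<in>set_pmf (map_pmf A q). pmf (map_pmf A q) a * ent (\<kappa>' a)) = (\<Sum>w\<in>set_pmf q. pmf q w * ent (\<kappa>' (A w)))"
    by (rule sum_map_pmf[OF fin(1)])
  finally show ?thesis by (simp only: det[symmetric])
qed

lemma attach_entropies:
  assumes fin: "finite (set_pmf q)" "\<And>w. w \<in> set_pmf q \<Longrightarrow> finite (set_pmf (\<kappa> w))"
    and det: "\<And>w. \<kappa> w = \<kappa>' (A w) (C w)"
  defines "e \<equiv> \<Sum>w\<in>set_pmf q. pmf q w * ent (\<kappa> w)"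
  shows "ent (map_pmf (\<lambda>w. (A (fst w), (C (fst w), snd w))) (attach q \<kappa>)) = ent (map_pmf (\<lambda>w. (A w, C w)) q) + e"
    and "ent (map_pmf (\<lambda>w. (A (fst w), B (fst w), (C (fst w), snd w))) (attach q \<kappa>)) = ent (map_pmf (\<lambda>w. (A w, B w, C w)) q) + e"
proof -
  have fin': "finite (set_pmf (attach q \<kappa>))" using fin by (rule finite_attach)
  have "ent (map_pmf (\<lambda>w. (A (fst w), (C (fst w), snd w))) (attach q \<kappa>)) = ent (map_pmf (\<lambda>w. ((A (fst w), C (fst w)), snd w)) (attach q \<kappa>))"
    by (rule ent_map_cong[OF fin']) auto
  also have "\<dots> = ent (map_pmf (\<lambda>w. (A w, C w)) q) + e"
    unfolding e_def by (rule ent_attach[OF fin, where A = "\<lambda>w. (A w, C w)" and \<kappa>' = "\<lambda>(a, c). \<kappa>' a c"]) (auto simp: det)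
  finally show "ent (map_pmf (\<lambda>w. (A (fst w), (C (fst w), snd w))) (attach q \<kappa>)) = ent (map_pmf (\<lambda>w. (A w, C w)) q) + e" .
  have "ent (map_pmf (\<lambda>w. (A (fst w), B (fst w), (C (fst w), snd w))) (attach q \<kappa>)) = ent (map_pmf (\<lambda>w. ((A (fst w), B (fst w), C (fst w)), snd w)) (attach q \<kappa>))"
    by (rule ent_map_cong[OF fin']) auto
  also have "\<dots> = ent (map_pmf (\<lambda>w. (A w, B w, C w)) q) + e"
    unfolding e_def by (rule ent_attach[OF fin, where A = "\<lambda>w. (A w, B w, C w)" and \<kappa>' = "\<lambda>(a, b, c). \<kappa>' a c"]) (auto simp: det)
  finally show "ent (map_pmf (\<lambda>w. (A (fst w), B (fst w), (C (fst w), snd w))) (attach q \<kappa>)) = ent (map_pmf (\<lambda>w. (A w, B w, C w)) q) + e" .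
qed

text \<open>Given \<open>C\<close>, the message \<open>M\<close> is a noisy function of
  \<open>A\<close>. Its noise adds the same amount to \<open>H(A,C)\<close> and
  \<open>H(A,B,C)\<close> and cancels; what is left is \<open>H(B|C,M) \<le> H(B|C)\<close>.\<close>

lemma cmi_message:
  assumes fin: "finite (set_pmf q)" "\<And>w. w \<in> set_pmf q \<Longrightarrow> finite (set_pmf (\<kappa> w))"
    and det: "\<And>w. \<kappa> w = \<kappa>' (A w) (C w)"
  shows "cmi (attach q \<kappa>) (\<lambda>w. A (fst w)) (\<lambda>w. B (fst w)) (\<lambda>w. (C (fst w), snd w)) \<le> cmi q A B C"
proof -
  have fin': "finite (set_pmf (attach q \<kappa>))" using fin by (rule finite_attach)
  have "ent (map_pmf (\<lambda>w. (B (fst w), snd w, C (fst w))) (attach q \<kappa>)) + ent (map_pmf (\<lambda>w. C (fst w)) (attach q \<kappa>))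
     \<le> ent (map_pmf (\<lambda>w. (B (fst w), C (fst w))) (attach q \<kappa>)) + ent (map_pmf (\<lambda>w. (snd w, C (fst w))) (attach q \<kappa>))"
    by (rule ent_submodular[OF fin'])
  moreover have "ent (map_pmf (\<lambda>w. (B (fst w), snd w, C (fst w))) (attach q \<kappa>)) = ent (map_pmf (\<lambda>w. (B (fst w), (C (fst w), snd w))) (attach q \<kappa>))"
    "ent (map_pmf (\<lambda>w. (snd w, C (fst w))) (attach q \<kappa>)) = ent (map_pmf (\<lambda>w. (C (fst w), snd w)) (attach q \<kappa>))"
    by (rule ent_map_cong[OF fin']; auto)+
  ultimately show ?thesis
    using attach_entropies(1)[where A = A and C = C and \<kappa>' = \<kappa>', OF fin det]
      attach_entropies(2)[where A = A and B = B and C = C and \<kappa>' = \<kappa>', OF fin det] map_fst_attach[of C q \<kappa>] map_fst_attach[of "\<lambda>w. (B w, C w)" q \<kappa>]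
    by (simp add: cmi_def)
qed

text \<open>Given \<open>C\<close>, the variable \<open>B\<close>, the variable \<open>A\<close> and
  the message \<open>M\<close> form a Markov chain; the loss is \<open>I(A;B|C,M)\<close>, which is
  nonnegative by submodularity.\<close>

lemma cmi_data_processing:
  assumes fin: "finite (set_pmf q)" "\<And>w. w \<in> set_pmf q \<Longrightarrow> finite (set_pmf (\<kappa> w))"
    and det: "\<And>w. \<kappa> w = \<kappa>' (A w) (C w)"
  shows "cmi (attach q \<kappa>) snd (\<lambda>w. B (fst w)) (\<lambda>w. C (fst w)) \<le> cmi q A B C"
proof -
  have fin': "finite (set_pmf (attach q \<kappa>))" using fin by (rule finite_attach)
  have "ent (map_pmf (\<lambda>w. (A (fst w), B (fst w), (C (fst w), snd w))) (attach q \<kappa>)) + ent (map_pmf (\<lambda>w. (C (fst w), snd w)) (attach q \<kappa>))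
     \<le> ent (map_pmf (\<lambda>w. (A (fst w), (C (fst w), snd w))) (attach q \<kappa>)) + ent (map_pmf (\<lambda>w. (B (fst w), (C (fst w), snd w))) (attach q \<kappa>))"
    by (rule ent_submodular[OF fin'])
  moreover have "ent (map_pmf (\<lambda>w. (snd w, B (fst w), C (fst w))) (attach q \<kappa>)) = ent (map_pmf (\<lambda>w. (B (fst w), (C (fst w), snd w))) (attach q \<kappa>))"
    "ent (map_pmf (\<lambda>w. (snd w, C (fst w))) (attach q \<kappa>)) = ent (map_pmf (\<lambda>w. (C (fst w), snd w)) (attach q \<kappa>))"
    by (rule ent_map_cong[OF fin']; auto)+
  ultimately show ?thesis
    using attach_entropies(1)[where A = A and C = C and \<kappa>' = \<kappa>', OF fin det]
      attach_entropies(2)[where A = A and B = B and C = C and \<kappa>' = \<kappa>', OF fin det] map_fst_attach[of C q \<kappa>] map_fst_attach[of "\<lambda>w. (B w, C w)" q \<kappa>]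
    by (simp add: cmi_def)
qed

lemma ent_map_replicate:
  assumes "finite (set_pmf p)"
  shows "ent (map_pmf (map f) (replicate_pmf n p)) = n * ent (map_pmf f p)"
  unfolding map_replicate_pmf using assms by (intro ent_replicate) auto

text \<open>A tuple of lists carries the same information as the list of tuples, and the latter is
  again i.i.d.\<close>

lemma cmi_replicate:
  assumes "finite (set_pmf p)"
  shows "cmi (replicate_pmf n p) (map A) (map B) (map C) = n * cmi p A B C"
proof -
  have fin: "finite (set_pmf (replicate_pmf n p))" using assms by (rule finite_set_replicate_pmf)
  have "ent (map_pmf (\<lambda>w. (map A w, map C w)) (replicate_pmf n p)) = ent (map_pmf (map (\<lambda>w. (A w, C w))) (replicate_pmf n p))"
    "ent (map_pmf (\<lambda>w. (map B w, map C w)) (replicate_pmf n p)) = ent (map_pmf (map (\<lambda>w. (B w, C w))) (replicate_pmf n p))"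
    "ent (map_pmf (\<lambda>w. (map A w, map B w, map C w)) (replicate_pmf n p)) = ent (map_pmf (map (\<lambda>w. (A w, B w, C w))) (replicate_pmf n p))"
    by (rule ent_map_cong[OF fin]; auto simp: list_eq_iff_nth_eq)+
  thus ?thesis unfolding cmi_def by (simp add: ent_map_replicate[OF assms] algebra_simps)
qed

section \<open>Protocol runs with side information \<open>J\<close>\<close>

abbreviation "Xp \<equiv> \<lambda>(x, y, z, j). x"
abbreviation "Yp \<equiv> \<lambda>(x, y, z, j). y"
abbreviation "Zp \<equiv> \<lambda>(x, y, z, j). z"
abbreviation "Jp \<equiv> \<lambda>(x, y, z, j). j"

text \<open>The joint law of the source block \<open>(X\<^sup>n, Y\<^sup>n, Z\<^sup>n, J\<^sup>n)\<close> and the first \<open>i\<close> messages.\<close>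

definition run_J :: "('x \<times> 'y \<times> 'z \<times> 'j) pmf \<Rightarrow> nat \<Rightarrow> ('x, 'y) protocol \<Rightarrow> nat \<Rightarrow> (('x \<times> 'y \<times> 'z \<times> 'j) list \<times> nat list) pmf" where
  "run_J pJ n C i = attach (replicate_pmf n pJ) (\<lambda>w. transcript C (map Xp w) (map Yp w) i)"

definition run_JA :: "('x \<times> 'y \<times> 'z \<times> 'j) pmf \<Rightarrow> nat \<Rightarrow> ('x, 'y) protocol \<Rightarrow> ((('x \<times> 'y \<times> 'z \<times> 'j) list \<times> nat list) \<times> nat) pmf" where
  "run_JA pJ n C = attach (run_J pJ n C (rounds C)) (\<lambda>(w, f). key_A C (map Xp w) f)"

definition run_JAB :: "('x \<times> 'y \<times> 'z \<times> 'j) pmf \<Rightarrow> nat \<Rightarrow> ('x, 'y) protocol \<Rightarrow> (((('x \<times> 'y \<times> 'z \<times> 'j) list \<times> nat list) \<times> nat) \<times> nat) pmf" where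
  "run_JAB pJ n C = attach (run_JA pJ n C) (\<lambda>((w, f), ka). key_B C (map Yp w) f)"

lemma finite_kernels:
  assumes "valid_protocol C"
  shows "finite (set_pmf (msg_A C xs f))" "finite (set_pmf (msg_B C ys f))"
    "finite (set_pmf (key_A C xs f))" "finite (set_pmf (key_B C ys f))"
  using assms unfolding valid_protocol_def by (meson finite_subset)+

lemma finite_transcript: "valid_protocol C \<Longrightarrow> finite (set_pmf (transcript C xs ys i))"
  by (induction i) (auto simp: finite_kernels)

lemma finite_runs:
  assumes "valid_protocol C" "finite (set_pmf pJ)"
  shows "finite (set_pmf (run_J pJ n C i))" "finite (set_pmf (run_JA pJ n C))" "finite (set_pmf (run_JAB pJ n C))"
proof -
  show 1: "finite (set_pmf (run_J pJ n C i))" for i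
    unfolding run_J_def using assms by (intro finite_attach finite_set_replicate_pmf finite_transcript)
  show 2: "finite (set_pmf (run_JA pJ n C))"
    unfolding run_JA_def using assms by (intro finite_attach 1) (auto simp: finite_kernels)
  show "finite (set_pmf (run_JAB pJ n C))"
    unfolding run_JAB_def using assms by (intro finite_attach 2) (auto simp: finite_kernels)
qed

lemma run_J_Suc:
  "run_J pJ n C (Suc i) = map_pmf (\<lambda>((w, f), m). (w, f @ [m]))
     (attach (run_J pJ n C i) (\<lambda>(w, f). if even i then msg_A C (map Xp w) f else msg_B C (map Yp w) f))"
  by (simp add: run_J_def attach_def map_pmf_def bind_assoc_pmf bind_return_pmf)

text \<open>Each message is drawn from one party's block and the transcript, so every round is an
  instance of \<open>cmi_message\<close>, with the parties exchanged at odd positions. The block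
  \<open>J^n\<close> stays in the conditioning and is never seen by a kernel.\<close>

lemma cmi_run_J:
  assumes C: "valid_protocol C" and pJ: "finite (set_pmf pJ)"
  shows "cmi (run_J pJ n C i) (\<lambda>w. map Xp (fst w)) (\<lambda>w. map Yp (fst w)) (\<lambda>w. (map Jp (fst w), snd w)) \<le> n * cmi pJ Xp Yp Jp"
proof (induction i)
  case 0
  have "run_J pJ n C 0 = map_pmf (\<lambda>w. (w, [] :: nat list)) (replicate_pmf n pJ)"
    by (simp add: run_J_def attach_def map_pmf_def bind_return_pmf)
  hence "cmi (run_J pJ n C 0) (\<lambda>w. map Xp (fst w)) (\<lambda>w. map Yp (fst w)) (\<lambda>w. (map Jp (fst w), snd w))
    = cmi (replicate_pmf n pJ) (map Xp) (map Yp) (\<lambda>w. (map Jp w, [] :: nat list))"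
    by (simp add: cmi_map)
  also have "\<dots> = cmi (replicate_pmf n pJ) (map Xp) (map Yp) (map Jp)"
    by (rule cmi_cong) (use pJ finite_set_replicate_pmf in auto)
  finally show ?case unfolding cmi_replicate[OF pJ] by (rule eq_refl)
next
  case (Suc i)
  let ?q = "run_J pJ n C i"
  let ?\<kappa> = "\<lambda>(w, f). if even i then msg_A C (map Xp w) f else msg_B C (map Yp w) f"
  let ?A = "\<lambda>w. map Xp (fst w)" and ?B = "\<lambda>w. map Yp (fst w)" and ?C = "\<lambda>w. (map Jp (fst w), snd w)"
  have fq: "finite (set_pmf ?q)" using finite_runs[OF C pJ] by blast
  have f\<kappa>: "finite (set_pmf (?\<kappa> w))" for w using finite_kernels[OF C] by (cases w) auto
  have fin': "finite (set_pmf (attach ?q ?\<kappa>))" by (intro finite_attach fq f\<kappa>)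
  have "cmi (run_J pJ n C (Suc i)) ?A ?B ?C = cmi (attach ?q ?\<kappa>) (\<lambda>w. ?A (fst w)) (\<lambda>w. ?B (fst w)) (\<lambda>w. (map Jp (fst (fst w)), snd (fst w) @ [snd w]))"
    unfolding run_J_Suc cmi_map by (simp add: case_prod_unfold)
  \<comment> \<open>Appending a message to the transcript carries the same information as keeping
    the two as a pair.\<close>
  also have "\<dots> = cmi (attach ?q ?\<kappa>) (\<lambda>w. ?A (fst w)) (\<lambda>w. ?B (fst w)) (\<lambda>w. (?C (fst w), snd w))"
    by (rule cmi_cong[OF fin']) auto
  also have "\<dots> \<le> cmi ?q ?A ?B ?C"
  proof (cases "even i")
    case True
    show ?thesis
      by (rule cmi_message[OF fq f\<kappa>, where \<kappa>' = "\<lambda>xs (js, f). msg_A C xs f"]) (use True in auto)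
  next
    case False
    have "cmi (attach ?q ?\<kappa>) (\<lambda>w. ?B (fst w)) (\<lambda>w. ?A (fst w)) (\<lambda>w. (?C (fst w), snd w)) \<le> cmi ?q ?B ?A ?C"
      by (rule cmi_message[OF fq f\<kappa>, where \<kappa>' = "\<lambda>ys (js, f). msg_B C ys f"]) (use False in auto)
    thus ?thesis using cmi_commute[OF fin'] cmi_commute[OF fq] by metis
  qed
  finally show ?case using Suc by (rule order_trans)
qed

text \<open>Data processing, once for each party's key, turns the bound on
  \<open>I(X^n;Y^n|J^n,F)\<close> into one on \<open>I(K_A;K_B|J^n,F)\<close>. The gap to
  \<open>H(K_A|J^n,F)\<close> is at most \<open>H(K_A|K_B)\<close>, which is left for Fano's
  inequality.\<close>

lemma key_A_entropy_bound:
  assumes C: "valid_protocol C" and pJ: "finite (set_pmf pJ)"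
  shows "ent (map_pmf (\<lambda>(((w, f), ka), kb). (ka, map Jp w, f)) (run_JAB pJ n C)) - ent (map_pmf (\<lambda>(((w, f), ka), kb). (map Jp w, f)) (run_JAB pJ n C))
    \<le> n * cmi pJ Xp Yp Jp + (ent (map_pmf (\<lambda>(((w, f), ka), kb). (ka, kb)) (run_JAB pJ n C)) - ent (map_pmf (\<lambda>(((w, f), ka), kb). kb) (run_JAB pJ n C)))"
proof -
  let ?W = "run_J pJ n C (rounds C)" and ?q1 = "run_JA pJ n C" and ?q2 = "run_JAB pJ n C"
  let ?A = "\<lambda>w. map Xp (fst w)" and ?B = "\<lambda>w. map Yp (fst w)" and ?C = "\<lambda>w. (map Jp (fst w), snd w)"
  note fin = finite_runs[OF C pJ]
  have "cmi ?q1 snd (\<lambda>w. ?B (fst w)) (\<lambda>w. ?C (fst w)) \<le> cmi ?W ?A ?B ?C"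
    unfolding run_JA_def
    by (rule cmi_data_processing[OF fin(1), where \<kappa>' = "\<lambda>xs (js, f). key_A C xs f"]) (auto simp: finite_kernels[OF C])
  moreover have "cmi ?q2 snd (\<lambda>w. snd (fst w)) (\<lambda>w. ?C (fst (fst w))) \<le> cmi ?q1 (\<lambda>w. ?B (fst w)) snd (\<lambda>w. ?C (fst w))"
    unfolding run_JAB_def
    by (rule cmi_data_processing[OF fin(2), where \<kappa>' = "\<lambda>ys (js, f). key_B C ys f"]) (auto simp: finite_kernels[OF C])
  moreover have "cmi ?W ?A ?B ?C \<le> n * cmi pJ Xp Yp Jp" by (rule cmi_run_J[OF C pJ])
  moreover have "cmi ?q1 (\<lambda>w. ?B (fst w)) snd (\<lambda>w. ?C (fst w)) = cmi ?q1 snd (\<lambda>w. ?B (fst w)) (\<lambda>w. ?C (fst w))"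
    by (rule cmi_commute[OF fin(2)])
  moreover have "cmi ?q2 snd (\<lambda>w. snd (fst w)) (\<lambda>w. ?C (fst (fst w))) = cmi ?q2 (\<lambda>w. snd (fst w)) snd (\<lambda>w. ?C (fst (fst w)))"
    by (rule cmi_commute[OF fin(3)])
  ultimately have 1: "cmi ?q2 (\<lambda>w. snd (fst w)) snd (\<lambda>w. ?C (fst (fst w))) \<le> n * cmi pJ Xp Yp Jp" by linarith
  \<comment> \<open>Conditioning on \<open>(J^n, F)\<close> in addition to Bob's key does not
    increase the entropy of Alice's key.\<close>
  have 2: "ent (map_pmf (\<lambda>w. (snd (fst w), ?C (fst (fst w)), snd w)) ?q2) + ent (map_pmf snd ?q2)
    \<le> ent (map_pmf (\<lambda>w. (snd (fst w), snd w)) ?q2) + ent (map_pmf (\<lambda>w. (?C (fst (fst w)), snd w)) ?q2)"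
    by (rule ent_submodular[OF fin(3)])
  have "ent (map_pmf (\<lambda>w. (snd (fst w), ?C (fst (fst w)), snd w)) ?q2) = ent (map_pmf (\<lambda>w. (snd (fst w), snd w, ?C (fst (fst w)))) ?q2)"
    "ent (map_pmf (\<lambda>w. (?C (fst (fst w)), snd w)) ?q2) = ent (map_pmf (\<lambda>w. (snd w, ?C (fst (fst w)))) ?q2)"
    by (rule ent_map_cong[OF fin(3)]; auto)+
  with 1 2 show ?thesis by (simp add: cmi_def case_prod_unfold)
qed

text \<open>Summing out \<open>J^n\<close> from the extended block gives the original source block,
  and no kernel of the protocol looks at \<open>J^n\<close>.\<close>

lemma run_protocol_eq:
  assumes "map_pmf (\<lambda>(x, y, z, j). (x, y, z)) pJ = p"
  shows "run_protocol p n C = map_pmf (\<lambda>(((w, f), ka), kb). (map Xp w, map Yp w, map Zp w, f, ka, kb)) (run_JAB pJ n C)"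
proof -
  have "replicate_pmf n p = map_pmf (map (\<lambda>(x, y, z, j). (x, y, z))) (replicate_pmf n pJ)"
    by (simp add: map_replicate_pmf assms)
  thus ?thesis
    unfolding run_protocol_def run_JAB_def run_JA_def run_J_def attach_def
    by (simp add: Let_def map_pmf_def bind_assoc_pmf bind_return_pmf case_prod_unfold comp_def)
qed

section \<open>Single-letterization\<close>

abbreviation "XYp \<equiv> \<lambda>(x, y, z, j). (x, y)"

lemma map_nth_append: "length w1 = i \<Longrightarrow> (w1 @ c # w2) ! i = c"
  by (auto simp: nth_append)

text \<open>A block is generated by first drawing everything except the pair \<open>(Z\<^sub>i, J\<^sub>i)\<close>, which depends
  on the rest only through \<open>(X\<^sub>i, Y\<^sub>i)\<close>.\<close>

lemma single_letter_markov:
  fixes k :: "('x \<times> 'y) \<Rightarrow> ('z \<times> nat) pmf" and P :: "('x \<times> 'y) pmf"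
  assumes i: "i < n"
  shows "\<exists>M. map_pmf snd M = P \<and>
    map_pmf (\<lambda>(w, t). (g (take i w) (drop (Suc i) w) t, XYp (w ! i), (Zp (w ! i), Jp (w ! i))))
      (attach (replicate_pmf n (extend_by k P)) (\<lambda>w. T (map XYp w)))
    = bind_pmf M (\<lambda>(a, s). map_pmf (\<lambda>c. (a, s, c)) (k s))"
proof -
  obtain b where n: "n = i + Suc b" using i by (metis add_Suc_right less_imp_Suc_add)
  let ?pJ = "extend_by k P"
  \<comment> \<open>The law of \<open>g\<close> given the letters \<open>w1\<close> before position
    i and the pair \<open>s\<close> at position i, with the later letters averaged.\<close>
  let ?R = "\<lambda>w1 s. bind_pmf (replicate_pmf b ?pJ) (\<lambda>w2. map_pmf (\<lambda>t. g w1 w2 t) (T (map XYp w1 @ s # map XYp w2)))"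
  define M where "M = bind_pmf (replicate_pmf i ?pJ) (\<lambda>w1. bind_pmf P (\<lambda>s. map_pmf (\<lambda>a. (a, s)) (?R w1 s)))"
  have "map_pmf snd M = bind_pmf (replicate_pmf i ?pJ) (\<lambda>w1. bind_pmf P return_pmf)"
    unfolding M_def map_bind_pmf by (intro bind_pmf_cong refl) (simp add: map_pmf_comp)
  hence M: "map_pmf snd M = P" by (simp add: bind_return_pmf')
  have "map_pmf (\<lambda>(w, t). (g (take i w) (drop (Suc i) w) t, XYp (w ! i), (Zp (w ! i), Jp (w ! i))))
      (attach (replicate_pmf n ?pJ) (\<lambda>w. T (map XYp w)))
    = bind_pmf (replicate_pmf i ?pJ) (\<lambda>w1. bind_pmf ?pJ (\<lambda>c. bind_pmf (replicate_pmf b ?pJ) (\<lambda>w2.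
        map_pmf (\<lambda>t. (g (take i (w1 @ c # w2)) (drop (Suc i) (w1 @ c # w2)) t, XYp ((w1 @ c # w2) ! i), (Zp ((w1 @ c # w2) ! i), Jp ((w1 @ c # w2) ! i))))
         (T (map XYp (w1 @ c # w2))))))"
    unfolding n replicate_pmf_distrib replicate_pmf.simps attach_def
    by (simp add: bind_assoc_pmf bind_return_pmf map_bind_pmf map_pmf_comp)
  also have "\<dots> = bind_pmf (replicate_pmf i ?pJ) (\<lambda>w1. bind_pmf ?pJ (\<lambda>c. bind_pmf (replicate_pmf b ?pJ) (\<lambda>w2.
        map_pmf (\<lambda>t. (g w1 w2 t, XYp c, (Zp c, Jp c))) (T (map XYp w1 @ XYp c # map XYp w2)))))"
    by (intro bind_pmf_cong refl) (simp add: set_replicate_pmf map_nth_append)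
  also have "\<dots> = bind_pmf (replicate_pmf i ?pJ) (\<lambda>w1. bind_pmf P (\<lambda>s. bind_pmf (k s) (\<lambda>c. 
        map_pmf (\<lambda>a. (a, s, c)) (?R w1 s))))"
    unfolding extend_by_def[of k P] bind_assoc_pmf
    by (intro bind_pmf_cong refl) (simp add: case_prod_unfold bind_map_pmf map_bind_pmf map_pmf_comp extend_by_def)
  \<comment> \<open>Given \<open>s\<close>, the draw of the pair from \<open>k s\<close> and the
    draw of everything else do not feed into each other, so their order can be exchanged.\<close>
  also have "\<dots> = bind_pmf (replicate_pmf i ?pJ) (\<lambda>w1. bind_pmf P (\<lambda>s. bind_pmf (?R w1 s) (\<lambda>a. 
        map_pmf (\<lambda>c. (a, s, c)) (k s))))"
    unfolding map_pmf_def[of "\<lambda>a. (a, _, _)"] map_pmf_def[of "\<lambda>c. (_, _, c)"]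
    by (intro bind_pmf_cong refl bind_commute_pmf)
  also have "\<dots> = bind_pmf M (\<lambda>(a, s). map_pmf (\<lambda>c. (a, s, c)) (k s))"
    unfolding M_def by (simp add: bind_assoc_pmf bind_map_pmf)
  finally show ?thesis using M by blast
qed

text \<open>Counterpart of \<open>ent_joint\<close> for variables on an arbitrary sample space whose
  joint law has the Markov form.\<close>

lemma ent_markov_difference:
  fixes M :: "('a \<times> 's::finite) pmf"
  assumes k: "\<And>s. finite (set_pmf (k s))"
    and q: "map_pmf (\<lambda>w. (F w, S w, Zf w, Jf w)) q = bind_pmf M (\<lambda>(a, s). map_pmf (\<lambda>c. (a, s, c)) (k s))"
    and A: "finite A" "\<And>a s. (a, s) \<in> set_pmf M \<Longrightarrow> h a \<in> A"
  shows "ent (map_pmf (\<lambda>w. (h (F w), Jf w)) q) - ent (map_pmf (\<lambda>w. (h (F w), Zf w)) q)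
    = (\<Sum>a\<in>A. phi k (\<chi> s. pmf (map_pmf (\<lambda>(a, s). (h a, s)) M) (a, s)))"
proof -
  let ?M = "map_pmf (\<lambda>(a, s). (h a, s)) M"
  have "map_pmf (\<lambda>w. (h (F w), Jf w)) q = map_pmf (\<lambda>(a, s, z, j). (h a, j)) (map_pmf (\<lambda>w. (F w, S w, Zf w, Jf w)) q)"
    "map_pmf (\<lambda>w. (h (F w), Zf w)) q = map_pmf (\<lambda>(a, s, z, j). (h a, z)) (map_pmf (\<lambda>w. (F w, S w, Zf w, Jf w)) q)"
    by (simp_all add: map_pmf_comp)
  moreover have "map_pmf (\<lambda>(a, s, z, j). (h a, j)) (map_pmf (\<lambda>w. (F w, S w, Zf w, Jf w)) q) = bind_pmf ?M (\<lambda>(a, s). map_pmf (Pair a) (map_pmf snd (k s)))"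
    "map_pmf (\<lambda>(a, s, z, j). (h a, z)) (map_pmf (\<lambda>w. (F w, S w, Zf w, Jf w)) q) = bind_pmf ?M (\<lambda>(a, s). map_pmf (Pair a) (map_pmf fst (k s)))"
    unfolding q map_bind_pmf bind_map_pmf
    by (intro bind_pmf_cong refl; auto simp: map_pmf_comp case_prod_unfold)+
  ultimately have 1: "map_pmf (\<lambda>w. (h (F w), Jf w)) q = bind_pmf ?M (\<lambda>(a, s). map_pmf (Pair a) (map_pmf snd (k s)))"
    "map_pmf (\<lambda>w. (h (F w), Zf w)) q = bind_pmf ?M (\<lambda>(a, s). map_pmf (Pair a) (map_pmf fst (k s)))" by simp_all
  have A': "fst ` set_pmf ?M \<subseteq> A" using A(2) by auto
  show ?thesis
    unfolding 1 phi_def sum_subtractf using k A(1) A' by (simp add: ent_bind_kernel)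
qed

definition hybrid :: "nat \<Rightarrow> ('x \<times> 'y \<times> 'z \<times> 'j) list \<Rightarrow> 'j list \<times> 'z list" where
  "hybrid i w = (map Jp (take i w), map Zp (drop i w))"

text \<open>The hybrids at \<open>i\<close> and \<open>Suc i\<close> share the
  \<open>J\<close>-letters before and the \<open>Z\<close>-letters after position i and differ in
  \<open>Z_i\<close> against \<open>J_i\<close>. With the shared part and the transcript as
  \<open>V\<close>, the increments are \<open>H(V,J_i) - H(V,Z_i)\<close> and
  \<open>H(U,V,J_i) - H(U,V,Z_i)\<close>.\<close>

lemma single_letter_step:
  fixes k :: "('x::finite \<times> 'y::finite) \<Rightarrow> ('z \<times> nat) pmf" and P and T :: "_ \<Rightarrow> ('f \<times> nat) pmf"
  assumes k: "\<And>s. finite (set_pmf (k s))" and T: "\<And>ss. finite (set_pmf (T ss))" and i: "i < n"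
  defines "q \<equiv> attach (replicate_pmf n (extend_by k P)) (\<lambda>w. T (map XYp w))"
  obtains M :: "((('f \<times> nat list \<times> 'z list) \<times> nat) \<times> 'x \<times> 'y) pmf" where "finite (set_pmf M)" "map_pmf snd M = P"
    "ent (map_pmf (\<lambda>(w, f, u). (f, hybrid (Suc i) w)) q) - ent (map_pmf (\<lambda>(w, f, u). (f, hybrid i w)) q)
      = (\<Sum>\<alpha>\<in>fst ` fst ` set_pmf M. phi k (\<Sum>u\<in>snd ` fst ` set_pmf M. \<chi> s. pmf M ((\<alpha>, u), s)))"
    "ent (map_pmf (\<lambda>(w, f, u). ((f, u), hybrid (Suc i) w)) q) - ent (map_pmf (\<lambda>(w, f, u). ((f, u), hybrid i w)) q)
      = (\<Sum>\<alpha>\<in>fst ` fst ` set_pmf M. \<Sum>u\<in>snd ` fst ` set_pmf M. phi k (\<chi> s. pmf M ((\<alpha>, u), s)))"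
proof -
  let ?g = "\<lambda>w1 w2 (f, u). ((f, map Jp w1, map Zp w2), u)"
  let ?F = "\<lambda>(w, t). ?g (take i w) (drop (Suc i) w) t"
  obtain M where MP: "map_pmf snd M = P" and
    "map_pmf (\<lambda>(w, t). (?g (take i w) (drop (Suc i) w) t, XYp (w ! i), (Zp (w ! i), Jp (w ! i)))) q
      = bind_pmf M (\<lambda>(a, s). map_pmf (\<lambda>c. (a, s, c)) (k s))"
    using single_letter_markov[OF i, of P ?g k T] unfolding q_def by blast
  hence Mq: "map_pmf (\<lambda>w. (?F w, XYp (fst w ! i), Zp (fst w ! i), Jp (fst w ! i))) q = bind_pmf M (\<lambda>(a, s). map_pmf (\<lambda>c. (a, s, c)) (k s))"
    by (simp add: case_prod_unfold)
  have fin: "finite (set_pmf q)"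
    unfolding q_def by (intro finite_attach finite_set_replicate_pmf finite_extend_by k T)
  have "map_pmf (\<lambda>(a, s, c). (a, s)) (bind_pmf M (\<lambda>(a, s). map_pmf (\<lambda>c. (a, s, c)) (k s))) = bind_pmf M return_pmf"
    unfolding map_bind_pmf by (intro bind_pmf_cong refl) (auto simp: map_pmf_comp)
  \<comment> \<open>The existence statement says nothing about finiteness of \<open>M\<close>;
    exhibiting \<open>M\<close> as a marginal of the finitely supported \<open>q\<close> supplies
    it.\<close>
  hence ME: "M = map_pmf (\<lambda>(a, s, c). (a, s)) (map_pmf (\<lambda>w. (?F w, XYp (fst w ! i), Zp (fst w ! i), Jp (fst w ! i))) q)"
    unfolding Mq by (simp add: bind_return_pmf')
  have finM: "finite (set_pmf M)" by (subst ME) (simp add: fin)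
  have len: "length (fst w) = n" if "w \<in> set_pmf q" for w
    using that by (auto simp: q_def attach_def set_replicate_pmf)
  have td: "take (Suc i) w = take i w @ [w ! i]" "drop i w = w ! i # drop (Suc i) w" if "length w = n" for w :: "('x \<times> 'y \<times> 'z \<times> nat) list"
    using that i by (simp_all add: take_Suc_conv_app_nth Cons_nth_drop_Suc)
  have upd: "hybrid (Suc i) w = hybrid (Suc i) w' \<longleftrightarrow> (map Jp (take i w), map Zp (drop (Suc i) w), Jp (w ! i)) = (map Jp (take i w'), map Zp (drop (Suc i) w'), Jp (w' ! i))"
    "hybrid i w = hybrid i w' \<longleftrightarrow> (map Jp (take i w), map Zp (drop (Suc i) w), Zp (w ! i)) = (map Jp (take i w'), map Zp (drop (Suc i) w'), Zp (w' ! i))"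
    if "length w = n" "length w' = n" for w w' :: "('x \<times> 'y \<times> 'z \<times> nat) list"
    unfolding hybrid_def td[OF that(1)] td[OF that(2)] by auto
  let ?A = "fst ` fst ` set_pmf M" and ?U = "snd ` fst ` set_pmf M"
  have e1: "ent (map_pmf (\<lambda>(w, f, u). (f, hybrid (Suc i) w)) q) = ent (map_pmf (\<lambda>w. (fst (?F w), Jp (fst w ! i))) q)"
  proof (rule ent_map_cong[OF fin], goal_cases)
    case (1 w w')
    show ?case using upd[OF len[OF 1(1)] len[OF 1(2)]] by (cases w; cases w') auto
  qed
  have e2: "ent (map_pmf (\<lambda>(w, f, u). (f, hybrid i w)) q) = ent (map_pmf (\<lambda>w. (fst (?F w), Zp (fst w ! i))) q)"
  proof (rule ent_map_cong[OF fin], goal_cases)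
    case (1 w w')
    show ?case using upd[OF len[OF 1(1)] len[OF 1(2)]] by (cases w; cases w') auto
  qed
  have e3: "ent (map_pmf (\<lambda>(w, f, u). ((f, u), hybrid (Suc i) w)) q) = ent (map_pmf (\<lambda>w. (?F w, Jp (fst w ! i))) q)"
  proof (rule ent_map_cong[OF fin], goal_cases)
    case (1 w w')
    show ?case using upd[OF len[OF 1(1)] len[OF 1(2)]] by (cases w; cases w') auto
  qed
  have e4: "ent (map_pmf (\<lambda>(w, f, u). ((f, u), hybrid i w)) q) = ent (map_pmf (\<lambda>w. (?F w, Zp (fst w ! i))) q)"
  proof (rule ent_map_cong[OF fin], goal_cases)
    case (1 w w')
    show ?case using upd[OF len[OF 1(1)] len[OF 1(2)]] by (cases w; cases w') auto
  qed
  \<comment> \<open>Summing the vectors over \<open>u\<close> forgets \<open>U\<close> and leaves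
    the joint law of \<open>V\<close> and the pair at position i.\<close>
  have v: "(\<Sum>u\<in>?U. \<chi> s. pmf M ((\<alpha>, u), s)) = (\<chi> s. pmf (map_pmf (\<lambda>(a, s). (fst a, s)) M) (\<alpha>, s))" for \<alpha>
  proof (simp only: vec_eq_iff vec_lambda_beta sum_component, intro allI)
    fix s
    have "(\<Sum>u\<in>?U. pmf (map_pmf (\<lambda>w. (snd (fst w), (fst (fst w), snd w))) M) (u, (\<alpha>, s))) = pmf (map_pmf (\<lambda>w. (fst (fst w), snd w)) M) (\<alpha>, s)"
      using finM by (intro pmf_marginal) auto
    moreover have "pmf (map_pmf (\<lambda>w. (snd (fst w), (fst (fst w), snd w))) M) (u, (\<alpha>, s)) = pmf M ((\<alpha>, u), s)" for u
      using pmf_map_inj'[of "\<lambda>w. (snd (fst w), (fst (fst w), snd w))" M "((\<alpha>, u), s)"] by (simp add: inj_def prod_eq_iff)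
    ultimately show "(\<Sum>u\<in>?U. pmf M ((\<alpha>, u), s)) = pmf (map_pmf (\<lambda>(a, s). (fst a, s)) M) (\<alpha>, s)"
      by (simp add: case_prod_unfold)
  qed
  have "ent (map_pmf (\<lambda>w. (fst (?F w), Jp (fst w ! i))) q) - ent (map_pmf (\<lambda>w. (fst (?F w), Zp (fst w ! i))) q)
      = (\<Sum>\<alpha>\<in>?A. phi k (\<chi> s. pmf (map_pmf (\<lambda>(a, s). (fst a, s)) M) (\<alpha>, s)))"
    by (rule ent_markov_difference[OF k Mq]) (use finM in force)+
  moreover have "ent (map_pmf (\<lambda>w. (?F w, Jp (fst w ! i))) q) - ent (map_pmf (\<lambda>w. (?F w, Zp (fst w ! i))) q)
      = (\<Sum>a\<in>?A \<times> ?U. phi k (\<chi> s. pmf (map_pmf (\<lambda>(a, s). (a, s)) M) (a, s)))"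
    by (rule ent_markov_difference[OF k Mq, where h = "\<lambda>a. a"]) (use finM in force)+
  moreover have "\<dots> = (\<Sum>\<alpha>\<in>?A. \<Sum>u\<in>?U. phi k (\<chi> s. pmf M ((\<alpha>, u), s)))"
    by (simp add: sum.cartesian_product case_prod_unfold)
  ultimately show ?thesis by (intro that[OF finM MP]) (simp_all only: e1 e2 e3 e4 v)
qed

section \<open>The bound\<close>

text \<open>Only Alice's key is drawn, since it alone becomes \<open>U\<close>. The argument is the
  list of pairs \<open>(x, y)\<close>, which displays that neither \<open>Z\<close> nor
  \<open>J\<close> influences transcript and key.\<close>

definition alice_kernel :: "('x, 'y) protocol \<Rightarrow> ('x \<times> 'y) list \<Rightarrow> (nat list \<times> nat) pmf" where
  "alice_kernel C ss = attach (transcript C (map fst ss) (map snd ss) (rounds C)) (key_A C (map fst ss))"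

lemma attach_alice_kernel:
  "attach (replicate_pmf n pJ) (\<lambda>w. alice_kernel C (map XYp w)) = map_pmf (\<lambda>(((w, f), ka), kb). (w, f, ka)) (run_JAB pJ n C)"
  by (simp add: run_JAB_def run_JA_def run_J_def alice_kernel_def attach_def map_pmf_def bind_assoc_pmf bind_return_pmf
      case_prod_unfold comp_def)

text \<open>The uniform position is realised by weighting the law at each position with
  \<open>1 / n\<close> and indexing columns by \<open>(i, \<alpha>)\<close>. Homogeneity of
  \<open>phi\<close> pulls the weight out, and the sums over i telescope from \<open>Z^n\<close> to
  \<open>J^n\<close>.\<close>

lemma protocol_family:
  fixes k :: "('x::finite \<times> 'y::finite) \<Rightarrow> ('z::finite \<times> nat) pmf" and P
  assumes k: "\<And>s. finite (set_pmf (k s))" and T: "\<And>ss. finite (set_pmf (T ss))" and n: "n > 0"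
  defines "q \<equiv> attach (replicate_pmf n (extend_by k P)) (\<lambda>w. (T :: _ \<Rightarrow> ('f \<times> nat) pmf) (map XYp w))"
  obtains r where "feasible0 (extend_by k P) r"
    "n * slack r = ent (map_pmf (\<lambda>(w, f, u). (f, map Jp w)) q) - ent (map_pmf (\<lambda>(w, f, u). (f, map Zp w)) q) - n * ent (map_pmf Jp (extend_by k P))"
    "n * objective r \<ge> n * pmf_cond_mutual_info (extend_by k P) Xp Yp Jp 
      + (ent (map_pmf (\<lambda>(w, f, u). (f, map Jp w)) q) - ent (map_pmf (\<lambda>(w, f, u). (f, map Zp w)) q))
      - (ent (map_pmf (\<lambda>(w, f, u). ((f, u), map Jp w)) q) - ent (map_pmf (\<lambda>(w, f, u). ((f, u), map Zp w)) q))"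
proof -
  have fin: "finite (set_pmf q)"
    unfolding q_def by (intro finite_attach finite_set_replicate_pmf finite_extend_by k T)
  define t where "t i = ent (map_pmf (\<lambda>(w, f, u). (f, hybrid i w)) q)" for i
  define t' where "t' i = ent (map_pmf (\<lambda>(w, f, u). ((f, u), hybrid i w)) q)" for i
  define good where "good i M \<longleftrightarrow> finite (set_pmf M) \<and> map_pmf snd M = P \<and>
    t (Suc i) - t i = (\<Sum>\<alpha>\<in>fst ` fst ` set_pmf M. phi k (\<Sum>u\<in>snd ` fst ` set_pmf M. \<chi> s. pmf M ((\<alpha>, u), s))) \<and>
    t' (Suc i) - t' i = (\<Sum>\<alpha>\<in>fst ` fst ` set_pmf M. \<Sum>u\<in>snd ` fst ` set_pmf M. phi k (\<chi> s. pmf M ((\<alpha>, u), s)))"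
    for i and M :: "((('f \<times> nat list \<times> 'z list) \<times> nat) \<times> 'x \<times> 'y) pmf"
  have "\<exists>M. good i M" if "i < n" for i
    unfolding good_def t_def t'_def q_def
    by (rule single_letter_step[OF k T that]) (rule exI, intro conjI, assumption+)
  then obtain M where good: "\<And>i. i < n \<Longrightarrow> good i (M i)" by metis
  have M1: "finite (set_pmf (M i))" and M2: "map_pmf snd (M i) = P" and
    M3: "t (Suc i) - t i = (\<Sum>\<alpha>\<in>fst ` fst ` set_pmf (M i). phi k (\<Sum>u\<in>snd ` fst ` set_pmf (M i). \<chi> s. pmf (M i) ((\<alpha>, u), s)))" and
    M4: "t' (Suc i) - t' i = (\<Sum>\<alpha>\<in>fst ` fst ` set_pmf (M i). \<Sum>u\<in>snd ` fst ` set_pmf (M i). phi k (\<chi> s. pmf (M i) ((\<alpha>, u), s)))"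
    if "i < n" for i using good[OF that] unfolding good_def by - (elim conjE, assumption)+
  define A where "A i = fst ` fst ` set_pmf (M i)" for i
  define U where "U v = snd ` fst ` set_pmf (M (fst v))" for v :: "nat \<times> ('f \<times> nat list \<times> 'z list)"
  define a where "a v u = (1 / n) *\<^sub>R (\<chi> s. pmf (M (fst v)) ((snd v, u), s))" for v u
  let ?V = "Sigma {..<n} A"
  have S: "(\<Sum>v\<in>?V. G v) = (\<Sum>i<n. \<Sum>\<alpha>\<in>A i. G (i, \<alpha>))" for G :: "_ \<Rightarrow> real"
    using M1 by (subst sum.Sigma) (auto simp: A_def)
  have S1: "n * (\<Sum>v\<in>?V. phi k (\<Sum>u\<in>U v. a v u)) = t n - t 0"
  proof -
    have "(\<Sum>v\<in>?V. phi k (\<Sum>u\<in>U v. a v u)) = (\<Sum>i<n. (1 / n) * (t (Suc i) - t i))"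
      unfolding S
    proof (intro sum.cong refl)
      fix i assume "i \<in> {..<n}"
      hence i: "i < n" by simp
      have "phi k (\<Sum>u\<in>U (i, \<alpha>). a (i, \<alpha>) u) = (1 / n) * phi k (\<Sum>u\<in>snd ` fst ` set_pmf (M i). \<chi> s. pmf (M i) ((\<alpha>, u), s))" for \<alpha>
        by (simp only: a_def U_def fst_conv snd_conv scaleR_sum_right[symmetric] phi_scale[OF k])
      thus "(\<Sum>\<alpha>\<in>A i. phi k (\<Sum>u\<in>U (i, \<alpha>). a (i, \<alpha>) u)) = (1 / n) * (t (Suc i) - t i)"
        by (simp only: sum_distrib_left[symmetric] A_def M3[OF i])
    qed
    also have "\<dots> = (1 / n) * (t n - t 0)" by (simp only: sum_distrib_left[symmetric] sum_lessThan_telescope)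
    finally show ?thesis using n by simp
  qed
  have S2: "n * (\<Sum>v\<in>?V. \<Sum>u\<in>U v. phi k (a v u)) = t' n - t' 0"
  proof -
    have "(\<Sum>v\<in>?V. \<Sum>u\<in>U v. phi k (a v u)) = (\<Sum>i<n. (1 / n) * (t' (Suc i) - t' i))"
      unfolding S
    proof (intro sum.cong refl)
      fix i assume "i \<in> {..<n}"
      hence i: "i < n" by simp
      show "(\<Sum>\<alpha>\<in>A i. \<Sum>u\<in>U (i, \<alpha>). phi k (a (i, \<alpha>) u)) = (1 / n) * (t' (Suc i) - t' i)"
        by (simp only: a_def U_def fst_conv snd_conv phi_scale[OF k] sum_distrib_left[symmetric] A_def M4[OF i])
    qed
    also have "\<dots> = (1 / n) * (t' n - t' 0)" by (simp only: sum_distrib_left[symmetric] sum_lessThan_telescope)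
    finally show ?thesis using n by simp
  qed
  \<comment> \<open>At every position the pair has law \<open>P\<close>, so the weighted family sums
    to the vector of \<open>P\<close>.\<close>
  have letter: "(\<Sum>\<alpha>\<in>A i. \<Sum>u\<in>U (i, \<alpha>). pmf (M i) ((\<alpha>, u), s)) = pmf P s" if "i < n" for i s
  proof -
    have "(\<Sum>a\<in>A i \<times> snd ` fst ` set_pmf (M i). pmf (map_pmf (\<lambda>w. (fst w, snd w)) (M i)) (a, s)) = pmf (map_pmf snd (M i)) s"
      using M1[OF that] by (intro pmf_marginal) (force simp: A_def)+
    thus ?thesis using M2[OF that] by (simp add: U_def sum.cartesian_product case_prod_unfold)
  qed
  have total: "(\<Sum>v\<in>?V. \<Sum>u\<in>U v. a v u) = (\<chi> s. pmf P s)"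
  proof (simp only: vec_eq_iff vec_lambda_beta sum_component, intro allI)
    fix s
    have "(\<Sum>v\<in>?V. \<Sum>u\<in>U v. a v u $ s) = (\<Sum>i<n. \<Sum>\<alpha>\<in>A i. \<Sum>u\<in>U (i, \<alpha>). (1 / n) * pmf (M i) ((\<alpha>, u), s))"
      unfolding S by (simp only: a_def fst_conv snd_conv vector_scaleR_component vec_lambda_beta real_scaleR_def)
    also have "\<dots> = (\<Sum>i<n. (1 / n) * pmf P s)"
      by (intro sum.cong refl) (simp only: sum_distrib_left[symmetric] letter lessThan_iff)
    finally show "(\<Sum>v\<in>?V. \<Sum>u\<in>U v. a v u $ s) = pmf P s" using n by simp
  qed
  have fU: "finite (U v)" and nn: "a v u $ s \<ge> 0" if "v \<in> ?V" for v u s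
    using M1 that by (auto simp: A_def U_def a_def)
  have fV: "finite ?V" using M1 by (auto simp: A_def)
  obtain M' where M': "feasible0 (extend_by k P) (joint k M')"
    "slack (joint k M') = (\<Sum>v\<in>?V. phi k (\<Sum>u\<in>U v. a v u)) - ent (map_pmf Jp (extend_by k P))"
    "objective (joint k M') \<ge> pmf_cond_mutual_info (extend_by k P) Xp Yp Jp
      + (\<Sum>v\<in>?V. phi k (\<Sum>u\<in>U v. a v u)) - (\<Sum>v\<in>?V. \<Sum>u\<in>U v. phi k (a v u))"
    by (rule family_to_feasible[where V = ?V and U = U and a = a, OF k reduction_trivial[OF k] fV fU nn total])
      ((rule that; assumption) | assumption)+
  have len: "length (fst w) = n" if "w \<in> set_pmf q" for w
    using that by (auto simp: q_def attach_def set_replicate_pmf)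
  \<comment> \<open>On blocks of length n, one of the two lists of \<open>hybrid 0\<close> and of
    \<open>hybrid n\<close> is empty.\<close>
  have T: "t n = ent (map_pmf (\<lambda>(w, f, u). (f, map Jp w)) q)" "t 0 = ent (map_pmf (\<lambda>(w, f, u). (f, map Zp w)) q)"
    "t' n = ent (map_pmf (\<lambda>(w, f, u). ((f, u), map Jp w)) q)" "t' 0 = ent (map_pmf (\<lambda>(w, f, u). ((f, u), map Zp w)) q)"
    unfolding t_def t'_def by (rule ent_map_cong[OF fin]; drule len; drule len; auto simp: hybrid_def)+
  have sl: "n * slack (joint k M') = (t n - t 0) - n * ent (map_pmf Jp (extend_by k P))"
    unfolding M'(2) right_diff_distrib S1 ..
  have "n * objective (joint k M') \<ge> n * (pmf_cond_mutual_info (extend_by k P) Xp Yp Jp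
      + (\<Sum>v\<in>?V. phi k (\<Sum>u\<in>U v. a v u)) - (\<Sum>v\<in>?V. \<Sum>u\<in>U v. phi k (a v u)))"
    using M'(3) by (intro mult_left_mono) auto
  hence "n * objective (joint k M') \<ge> n * pmf_cond_mutual_info (extend_by k P) Xp Yp Jp + (t n - t 0) - (t' n - t' 0)"
    unfolding right_diff_distrib distrib_left S1 S2 .
  with M'(1) sl show ?thesis unfolding T by (rule that)
qed

text \<open>The objective is at least \<open>I(X;Y|J) + H(K|Z^n,F)/n - H(K|J^n,F)/n\<close>. Secrecy
  bounds the middle term below by \<open>R - \<delta>\<close>; the subtracted one is at most
  \<open>I(X;Y|J)\<close> plus the Fano term \<open>1 / n + \<delta> * (R + \<delta>)\<close>, in
  which \<open>n * (R + \<delta>)\<close> bounds the logarithm of the key alphabet size.\<close>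

lemma code_to_feasible:
  fixes p :: "('x::finite \<times> 'y::finite \<times> 'z::finite) pmf"
  assumes ext: "is_extension p pJ" and code: "is_code p n R \<delta> C"
  obtains q where "feasible0 pJ q" "slack q \<le> - eve_equivocation p n C" "objective q \<ge> R - \<delta> - (1 / n + \<delta> * (R + \<delta>))"
proof -
  have fpJ: "finite (set_pmf pJ)" using ext by (rule finite_extension)
  obtain k where k: "\<And>s. finite (set_pmf (k s))" and kP: "pJ = extend_by k (map_pmf (\<lambda>(x, y, z, j). (x, y)) pJ)"
    using exists_kernel[OF fpJ] by metis
  have n: "n > 0" and C: "valid_protocol C" using code by (auto simp: is_code_def)
  let ?Q = "run_JAB pJ n C"
  let ?q = "attach (replicate_pmf n pJ) (\<lambda>w. alice_kernel C (map XYp w))"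
  have finT: "finite (set_pmf (alice_kernel C ss))" for ss :: "('x \<times> 'y) list"
    unfolding alice_kernel_def by (intro finite_attach finite_transcript[OF C] finite_kernels[OF C])
  have finQ: "finite (set_pmf ?Q)" using finite_runs[OF C fpJ] by blast
  have run: "run_protocol p n C = map_pmf (\<lambda>(((w, f), ka), kb). (map Xp w, map Yp w, map Zp w, f, ka, kb)) ?Q"
    using ext unfolding is_extension_def by (intro run_protocol_eq) auto
  have finR: "finite (set_pmf (run_protocol p n C))" unfolding run using finQ by simp
  obtain r where r: "feasible0 pJ r"
    "n * slack r = ent (map_pmf (\<lambda>(w, f, u). (f, map Jp w)) ?q) - ent (map_pmf (\<lambda>(w, f, u). (f, map Zp w)) ?q) - n * ent (map_pmf Jp pJ)"
    "n * objective r \<ge> n * pmf_cond_mutual_info pJ Xp Yp Jp 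
      + (ent (map_pmf (\<lambda>(w, f, u). (f, map Jp w)) ?q) - ent (map_pmf (\<lambda>(w, f, u). (f, map Zp w)) ?q))
      - (ent (map_pmf (\<lambda>(w, f, u). ((f, u), map Jp w)) ?q) - ent (map_pmf (\<lambda>(w, f, u). ((f, u), map Zp w)) ?q))"
    by (rule protocol_family[where k = k and T = "alice_kernel C" and P = "map_pmf (\<lambda>(x, y, z, j). (x, y)) pJ", OF k finT n, folded kP])
      ((rule that; assumption) | assumption)+
  define HfJ where "HfJ = ent (map_pmf (\<lambda>(((w, f), ka), kb). (map Jp w, f)) ?Q)"
  define HfZ where "HfZ = ent (map_pmf (\<lambda>(((w, f), ka), kb). (map Zp w, f)) ?Q)"
  define HfuJ where "HfuJ = ent (map_pmf (\<lambda>(((w, f), ka), kb). (ka, map Jp w, f)) ?Q)"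
  define HfuZ where "HfuZ = ent (map_pmf (\<lambda>(((w, f), ka), kb). (ka, map Zp w, f)) ?Q)"
  define Hf where "Hf = ent (map_pmf (\<lambda>(((w, f), ka), kb). f) ?Q)"
  define Hu where "Hu = ent (map_pmf (\<lambda>(((w, f), ka), kb). ka) ?Q)"
  have 1: "ent (map_pmf (\<lambda>(w, f, u). (f, map Jp w)) ?q) = HfJ" "ent (map_pmf (\<lambda>(w, f, u). (f, map Zp w)) ?q) = HfZ"
    "ent (map_pmf (\<lambda>(w, f, u). ((f, u), map Jp w)) ?q) = HfuJ" "ent (map_pmf (\<lambda>(w, f, u). ((f, u), map Zp w)) ?q) = HfuZ"
    unfolding attach_alice_kernel map_pmf_comp HfJ_def HfZ_def HfuJ_def HfuZ_def
    by (rule ent_map_cong[OF finQ]; auto)+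
  have eve: "n * eve_equivocation p n C = HfZ - Hf"
    using n unfolding eve_equivocation_def pmf_cond_entropy_eq[OF finR] unfolding run HfZ_def Hf_def
    by (simp add: map_pmf_comp case_prod_unfold)
  have R: "real n * R = Hu" and agree: "\<P>((xs, ys, zs, f, ka, kb) in run_protocol p n C. ka = kb) \<ge> 1 - \<delta>"
    and rate: "R \<ge> log 2 (card (key_alphabet C)) / n - \<delta>"
    and sec: "pmf_mutual_info (run_protocol p n C) (\<lambda>(xs, ys, zs, f, ka, kb). ka) (\<lambda>(xs, ys, zs, f, ka, kb). (zs, f)) / n \<le> \<delta>"
    using code n unfolding is_code_def Let_def pmf_entropy_eq[OF finR] Hu_def
    by (auto simp: run map_pmf_comp case_prod_unfold)
  have "pmf_mutual_info (run_protocol p n C) (\<lambda>(xs, ys, zs, f, ka, kb). ka) (\<lambda>(xs, ys, zs, f, ka, kb). (zs, f)) = Hu + HfZ - HfuZ"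
    unfolding pmf_mutual_info_eq[OF finR] unfolding run HfZ_def Hu_def HfuZ_def
    by (simp add: map_pmf_comp case_prod_unfold)
  with sec n have sec: "Hu + HfZ - HfuZ \<le> n * \<delta>" by (simp add: field_simps)
  have KA: "(\<lambda>(((w, f), ka), kb). ka) ` set_pmf ?Q \<subseteq> key_alphabet C" and KF: "finite (key_alphabet C)"
    using C unfolding valid_protocol_def run_JAB_def run_JA_def attach_def by (auto, blast)
  have cK: "card (key_alphabet C) > 0" using KF KA set_pmf_not_empty[of ?Q] by (subst card_gt_0_iff) auto
  define e where "e = measure_pmf.prob ?Q {w. (\<lambda>(((w, f), ka), kb). ka) w \<noteq> (\<lambda>(((w, f), ka), kb). kb) w}"
  have "measure_pmf.prob (run_protocol p n C) {(xs, ys, zs, f, ka, kb). ka = kb} \<ge> 1 - \<delta>"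
    using agree by simp
  also have "measure_pmf.prob (run_protocol p n C) {(xs, ys, zs, f, ka, kb). ka = kb} = measure_pmf.prob ?Q (- {w. (\<lambda>(((w, f), ka), kb). ka) w \<noteq> (\<lambda>(((w, f), ka), kb). kb) w})"
    unfolding run measure_map_pmf by (intro arg_cong[where f = "measure _"]) auto
  also have "\<dots> = 1 - e" unfolding e_def by (subst measure_pmf.prob_compl[symmetric]) (auto simp: Compl_eq_Diff_UNIV)
  finally have e: "e \<le> \<delta>" by simp
  have lK: "log 2 (card (key_alphabet C)) \<le> n * (R + \<delta>)" using rate n by (simp add: field_simps)
  \<comment> \<open>Enlarging both factors needs \<open>\<delta> \<ge> 0\<close>, which follows from
    \<open>0 \<le> e \<le> \<delta>\<close>.\<close>
  have "e * log 2 (card (key_alphabet C)) \<le> \<delta> * (n * (R + \<delta>))"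
    using e lK cK by (intro mult_mono) (auto simp: e_def intro: order_trans[OF measure_nonneg])
  moreover have "ent (map_pmf (\<lambda>w. ((\<lambda>(((w, f), ka), kb). ka) w, (\<lambda>(((w, f), ka), kb). kb) w)) ?Q) - ent (map_pmf (\<lambda>(((w, f), ka), kb). kb) ?Q)
    \<le> 1 + e * log 2 (card (key_alphabet C))"
    unfolding e_def by (rule fano[OF finQ KF KA])
  moreover have "HfuJ - HfJ \<le> n * cmi pJ Xp Yp Jp + (ent (map_pmf (\<lambda>(((w, f), ka), kb). (ka, kb)) ?Q) - ent (map_pmf (\<lambda>(((w, f), ka), kb). kb) ?Q))"
    unfolding HfuJ_def HfJ_def by (rule key_A_entropy_bound[OF C fpJ])
  ultimately have bound: "HfuJ - HfJ \<le> n * cmi pJ Xp Yp Jp + 1 + \<delta> * (n * (R + \<delta>))"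
    by (simp add: case_prod_unfold)
  have I0: "pmf_cond_mutual_info pJ Xp Yp Jp = cmi pJ Xp Yp Jp"
    unfolding pmf_cond_mutual_info_eq[OF fpJ] cmi_def by (simp add: case_prod_unfold)
  have "n * objective r \<ge> n * (R - \<delta> - (1 / n + \<delta> * (R + \<delta>)))"
  proof -
    have "n * (R - \<delta> - (1 / n + \<delta> * (R + \<delta>))) = n * R - n * \<delta> - (1 + \<delta> * (n * (R + \<delta>)))"
      using n by (simp add: field_simps)
    thus ?thesis using r(3)[unfolded 1 I0] bound sec R by linarith
  qed
  hence obj: "objective r \<ge> R - \<delta> - (1 / n + \<delta> * (R + \<delta>))" using n by simp
  \<comment> \<open>For the constraint: \<open>H(F,J^n) \<le> H(F) + n H(J)\<close>, so
    \<open>slack\<close> is at most \<open>(H(F) - H(F,Z^n)) / n\<close>, the negative of Eve's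
    equivocation.\<close>
  have "HfJ \<le> ent (map_pmf (\<lambda>(((w, f), ka), kb). map Jp w) ?Q) + Hf"
    unfolding HfJ_def Hf_def using ent_pair_le[OF finQ, of "\<lambda>(((w, f), ka), kb). map Jp w" "\<lambda>(((w, f), ka), kb). f"]
    by (simp add: case_prod_unfold)
  also have "map_pmf (\<lambda>(((w, f), ka), kb). map Jp w) ?Q = map_pmf (map Jp) (replicate_pmf n pJ)"
    by (simp add: run_JAB_def run_JA_def run_J_def attach_def map_bind_pmf map_pmf_comp bind_assoc_pmf bind_map_pmf case_prod_unfold map_pmf_def[of "map _"])
  finally have "n * slack r \<le> n * (- eve_equivocation p n C)"
    using r(2) eve unfolding 1 ent_map_replicate[OF fpJ] by simp
  hence "slack r \<le> - eve_equivocation p n C" using n by (simp only: mult_le_cancel_left_pos of_nat_0_less_iff)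
  thus ?thesis by (intro that[OF r(1) _ obj])
qed

lemma achievable_feasible:
  fixes p :: "('x::finite \<times> 'y::finite \<times> 'z::finite) pmf"
  assumes ext: "is_extension p pJ" and ach: "achievable p \<Delta> R"
  obtains q where "feasible \<Delta> pJ q" "R \<le> objective q"
proof -
  obtain n Rs \<delta> C L where c: "\<And>k. is_code p (n k) (Rs k) (\<delta> k) (C k)" and n: "filterlim n at_top sequentially"
    and \<delta>: "\<delta> \<longlonglongrightarrow> 0" and Rs: "Rs \<longlonglongrightarrow> R" and L: "(\<lambda>k. eve_equivocation p (n k) (C k)) \<longlonglongrightarrow> L" "L \<ge> \<Delta>"
    using ach unfolding achievable_def by blast
  have "\<exists>q. feasible0 pJ q \<and> slack q \<le> - eve_equivocation p (n k) (C k) \<and>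
      objective q \<ge> Rs k - \<delta> k - (1 / n k + \<delta> k * (Rs k + \<delta> k))" for k
    by (rule code_to_feasible[OF ext c]) (intro exI conjI)
  then obtain q where q: "\<And>k. feasible0 pJ (q k)" "\<And>k. slack (q k) \<le> - eve_equivocation p (n k) (C k)"
    "\<And>k. objective (q k) \<ge> Rs k - \<delta> k - (1 / n k + \<delta> k * (Rs k + \<delta> k))" by metis
  have "\<forall>k. (objective (q k), slack (q k)) \<in> (\<lambda>q. (objective q, slack q)) ` {q. feasible0 pJ q}"
    using q(1) by auto
  \<comment> \<open>Along one common subsequence, objective and slack converge to the two values of
    a single law \<open>q0\<close>.\<close>
  with compact_values[OF finite_extension[OF ext]] obtain l r where l: "l \<in> (\<lambda>q. (objective q, slack q)) ` {q. feasible0 pJ q}"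
    and r: "strict_mono r" and lim: "((\<lambda>k. (objective (q k), slack (q k))) \<circ> r) \<longlonglongrightarrow> l"
    unfolding compact_def by meson
  from l obtain q0 where q0: "feasible0 pJ q0" "l = (objective q0, slack q0)" by auto
  have lo: "(\<lambda>k. objective (q (r k))) \<longlonglongrightarrow> objective q0" and ls: "(\<lambda>k. slack (q (r k))) \<longlonglongrightarrow> slack q0"
    using tendsto_fst[OF lim] tendsto_snd[OF lim] by (auto simp: q0(2) o_def)
  have "(\<lambda>k. 1 / real (n k)) \<longlonglongrightarrow> 0"
    using n by (intro tendsto_divide_0[OF tendsto_const] filterlim_at_top_imp_at_infinity filterlim_compose[OF filterlim_real_sequentially])
  hence "(\<lambda>k. Rs k - \<delta> k - (1 / n k + \<delta> k * (Rs k + \<delta> k))) \<longlonglongrightarrow> R - 0 - (0 + 0 * (R + 0))"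
    using \<delta> Rs by (intro tendsto_intros)
  hence b: "(\<lambda>k. Rs k - \<delta> k - (1 / n k + \<delta> k * (Rs k + \<delta> k))) \<longlonglongrightarrow> R" by simp
  have R: "R \<le> objective q0"
    using LIMSEQ_subseq_LIMSEQ[OF b r] lo by (rule LIMSEQ_le) (use q(3) in auto)
  have "slack q0 \<le> - L"
    using ls tendsto_minus[OF LIMSEQ_subseq_LIMSEQ[OF L(1) r]] by (rule LIMSEQ_le) (use q(2) in auto)
  hence "feasible \<Delta> pJ q0" using q0(1) L(2) by (simp add: feasible_iff)
  thus ?thesis using R by (rule that)
qed

section \<open>Attainment of the maxima\<close>

lemma inner_max_attained:
  fixes p :: "('x::finite \<times> 'y::finite \<times> 'z::finite) pmf"
  assumes ext: "is_extension p pJ"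
  shows "is_max (objective ` {q. feasible \<Delta> pJ q}) (inner_max \<Delta> pJ)"
proof (cases "{q. feasible \<Delta> pJ q} = {}")
  case True
  thus ?thesis by (simp add: is_max_def inner_max_def bot_ereal_def)
next
  case False
  \<comment> \<open>The constraint intersects the compact set of value pairs with a closed
    half-plane, so the first coordinate attains its maximum.\<close>
  let ?S = "(\<lambda>q. (objective q, slack q)) ` {q. feasible0 pJ q} \<inter> UNIV \<times> {..- \<Delta>}"
  have "compact ?S"
    by (intro compact_Int_closed compact_values finite_extension[OF ext] closed_Times) auto
  hence "compact (fst ` ?S)" by (intro compact_continuous_image continuous_intros)
  moreover have eq: "fst ` ?S = objective ` {q. feasible \<Delta> pJ q}"
    unfolding feasible_iff by force
  ultimately obtain s where s: "s \<in> objective ` {q. feasible \<Delta> pJ q}" "\<forall>t\<in>objective ` {q. feasible \<Delta> pJ q}. t \<le> s"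
    using compact_attains_sup[of "fst ` ?S"] False by auto
  have "inner_max \<Delta> pJ = ereal s"
    unfolding inner_max_def by (rule antisym) (use s in \<open>auto intro!: SUP_least SUP_upper\<close>)
  thus ?thesis using s False unfolding is_max_def by auto
qed

text \<open>The vectors of the given law are put through the reduction with pieces restricted by
  \<open>selects\<close>. The slack is kept exactly, so the constraint with \<open>\<Delta>\<close>
  survives.\<close>

lemma determined_improvement:
  fixes p :: "('x::finite \<times> 'y::finite \<times> 'z::finite) pmf"
  assumes ext: "is_extension p pJ" and f: "\<And>x y z. (x, y, z) \<in> set_pmf p \<Longrightarrow> z = f x y" and q: "feasible \<Delta> pJ q"
  obtains q' where "feasible \<Delta> pJ q'" "xy_determined q'" "objective q \<le> objective q'"
proof -
  have fpJ: "finite (set_pmf pJ)" using ext by (rule finite_extension)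
  let ?P = "map_pmf (\<lambda>(x, y, z, j). (x, y)) pJ" and ?f = "\<lambda>(x, y). f x y"
  obtain k where k: "\<And>s. finite (set_pmf (k s))"
    and k1: "\<And>s. s \<notin> (\<lambda>(x, y, z, j). (x, y)) ` set_pmf pJ \<Longrightarrow> k s = return_pmf (?f s, 0)"
    and k2: "\<And>x y z j. (z, j) \<in> set_pmf (k (x, y)) \<Longrightarrow> (x, y) \<in> (\<lambda>(x, y, z, j). (x, y)) ` set_pmf pJ \<Longrightarrow> (x, y, z, j) \<in> set_pmf pJ"
    and kP: "pJ = extend_by k ?P"
    by (rule exists_kernel[OF fpJ, where f = ?f]) (rule that; assumption)
  have fst_k: "map_pmf fst (k s) = return_pmf (?f s)" for s
  proof (cases "s \<in> (\<lambda>(x, y, z, j). (x, y)) ` set_pmf pJ")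
    case False
    thus ?thesis using k1 by simp
  next
    case True
    obtain x y where s: "s = (x, y)" by (cases s)
    have "z = f x y" if "(z, j) \<in> set_pmf (k (x, y))" for z j
    proof -
      have "(x, y, z, j) \<in> set_pmf pJ" using k2[OF that] True unfolding s by blast
      hence "(x, y, z) \<in> set_pmf (map_pmf (\<lambda>(x, y, z, j). (x, y, z)) pJ)" by force
      moreover have "map_pmf (\<lambda>(x, y, z, j). (x, y, z)) pJ = p" using ext by (simp add: is_extension_def)
      ultimately have "(x, y, z) \<in> set_pmf p" by (simp only:)
      thus ?thesis by (rule f)
    qed
    hence "map_pmf fst (k s) = map_pmf (\<lambda>_. f x y) (k s)" by (intro map_pmf_cong) (auto simp: s)
    thus ?thesis by (simp add: s)
  qed
  have q0: "feasible0 (extend_by k ?P) q" and sl: "slack q \<le> - \<Delta>" using q unfolding feasible_iff kP[symmetric] by - (elim conjE, assumption)+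
  define m where "m = CARD('x) * CARD('y)"
  define M where "M = map_pmf (\<lambda>(x, y, z, j, u, v). (u, v, x, y)) q"
  note vals = feasible0_values[OF k q0, folded m_def M_def kP]
  note total = feasible0_total[OF q0, folded m_def M_def]
  obtain M' where M': "feasible0 pJ (joint k M')" "\<And>u v. selects ?f (\<chi> s. pmf M' (u, v, s))"
    "slack (joint k M') = slack q" "objective (joint k M') \<ge> objective q"
    unfolding vals
    by (rule family_to_feasible[where k = k and V = "{..<m + 1}" and U = "\<lambda>_. {..<m}" and a = "\<lambda>v u. \<chi> s. pmf M (u, v, s)",
          OF k reduction_selects[where k = k and f = ?f, OF k fst_k] _ _ _ total, folded kP])
      ((rule that; assumption) | simp)+
  have "xy_determined (joint k M')"
    by (rule xy_determined_joint[OF finite_feasible0[OF M'(1) fpJ] fst_k M'(2)])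
  thus ?thesis using M' sl by (intro that[of "joint k M'"]) (simp_all add: feasible_iff)
qed

text \<open>The constraint \<open>H(X,Y|U,V,Z) = 0\<close> is closed as well, so the maximum under it is attained for every \<open>J\<close>,
  not only when \<open>Z\<close> is a function of \<open>(X,Y)\<close>.\<close>

lemma compact_determined_values:
  fixes pJ :: "('x::finite \<times> 'y::finite \<times> 'z::finite \<times> nat) pmf"
  assumes fin: "finite (set_pmf pJ)"
  shows "compact ((\<lambda>q. (objective q, slack q, pmf_cond_entropy q (\<lambda>(x, y, z, j, u, v). (x, y)) (\<lambda>(x, y, z, j, u, v). (u, v, z)))) ` {q. feasible0 pJ q})"
proof -
  let ?S = "(UNIV :: 'x set) \<times> (UNIV :: 'y set) \<times> (UNIV :: 'z set) \<times> ((\<lambda>(x, y, z, j). j) ` set_pmf pJ)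
     \<times> {..<CARD('x) * CARD('y)} \<times> {..<CARD('x) * CARD('y) + 1}"
  let ?m = "\<lambda>f A a. \<Sum>w | w \<in> ?S \<and> A w = a. f w :: real"
  let ?C = "{f. (\<forall>w. ?m f (\<lambda>(x, y, z, j, u, v). (x, y, z, j)) w = pmf pJ w)} \<inter>
    {f. \<forall>x y z j u v. f (x, y, z, j, u, v) * ?m f (\<lambda>(x, y, z, j, u, v). (x, y)) (x, y) =
      ?m f (\<lambda>(x, y, z, j, u, v). (u, v, x, y)) (u, v, x, y) * ?m f (\<lambda>(x, y, z, j, u, v). (x, y, z, j)) (x, y, z, j)}"
  have finS: "finite ?S" using fin by auto
  have closed: "closed ?C"
    by (intro closed_Int closed_Collect_all closed_Collect_eq continuous_intros continuous_on_coordinate)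
  have feas: "feasible0 pJ q \<longleftrightarrow> set_pmf q \<subseteq> ?S \<and> pmf q \<in> ?C" for q
  proof (cases "set_pmf q \<subseteq> ?S")
    case True
    have "(\<lambda>(x, y, z, j, u, v). v) ` set_pmf q \<subseteq> {..<CARD('x) * CARD('y) + 1}" "(\<lambda>(x, y, z, j, u, v). u) ` set_pmf q \<subseteq> {..<CARD('x) * CARD('y)}"
      using True by auto
    moreover have "map_pmf (\<lambda>(x, y, z, j, u, v). (x, y, z, j)) q = pJ \<longleftrightarrow>
      (\<forall>w. ?m (pmf q) (\<lambda>(x, y, z, j, u, v). (x, y, z, j)) w = pmf pJ w)"
      unfolding pmf_eq_iff pmf_map_eq_sum_superset[OF finS True] ..
    ultimately show ?thesis using True unfolding feasible0_def pmf_cond_indep_iff pmf_map_eq_sum_superset[OF finS True]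
      by simp
  next
    case False
    thus ?thesis using feasible0_support by blast
  qed
  let ?E = "\<lambda>A f. ent_fun ?S A f"
  let ?V = "\<lambda>(x, y, z, j, u, v). v" and ?U = "\<lambda>(x, y, z, j, u, v). u" and ?J = "\<lambda>(x, y, z, j, u, v). j"
    and ?Z = "\<lambda>(x, y, z, j, u, v). z" and ?Y = "\<lambda>(x, y, z, j, u, v). y" and ?X = "\<lambda>(x, y, z, j, u, v). x"
    and ?XY = "\<lambda>(x, y, z, j, u, v). (x, y)" and ?UVZ = "\<lambda>(x, y, z, j, u, v). (u, v, z)"
  let ?I = "\<lambda>A B C f. ?E (\<lambda>w. (A w, C w)) f + ?E (\<lambda>w. (B w, C w)) f - ?E (\<lambda>w. (A w, B w, C w)) f - ?E C f"
  let ?I2 = "\<lambda>A B f. ?E A f + ?E B f - ?E (\<lambda>w. (A w, B w)) f"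
  \<comment> \<open>The third coordinate is \<open>H(X,Y,U,V,Z) - H(U,V,Z)\<close>, again continuous
    in the masses.\<close>
  let ?F = "\<lambda>f. (?I ?X ?Y ?J f + ?I ?U ?J ?V f - ?I ?U ?Z ?V f, ?I2 ?V ?Z f - ?I2 ?V ?J f - ?E ?Z f,
    ?E (\<lambda>w. (?XY w, ?UVZ w)) f - ?E ?UVZ f)"
  have val: "(objective q, slack q, pmf_cond_entropy q (\<lambda>(x, y, z, j, u, v). (x, y)) (\<lambda>(x, y, z, j, u, v). (u, v, z))) = ?F (pmf q)" if "set_pmf q \<subseteq> ?S" for q
  proof -
    have fq: "finite (set_pmf q)" using that finS by (rule finite_subset)
    show ?thesis
      unfolding objective_def slack_def pmf_cond_mutual_info_eq[OF fq] pmf_mutual_info_eq[OF fq] pmf_entropy_eq[OF fq] pmf_cond_entropy_eq[OF fq]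
        ent_map_eq_ent_fun[OF finS that] ..
  qed
  have sub: "set_pmf q \<subseteq> ?S" if "feasible0 pJ q" for q using that unfolding feas by (rule conjunct1)
  define T where "T = simplex_on ?S \<inter> ?C"
  have "T = pmf ` {q. set_pmf q \<subseteq> ?S \<and> pmf q \<in> ?C}"
    unfolding T_def simplex_on_eq[OF finS] by (rule image_Collect_Int)
  hence T: "T = pmf ` {q. feasible0 pJ q}" unfolding feas .
  have "(\<lambda>q. (objective q, slack q, pmf_cond_entropy q (\<lambda>(x, y, z, j, u, v). (x, y)) (\<lambda>(x, y, z, j, u, v). (u, v, z)))) ` {q. feasible0 pJ q} = ?F ` T"
    unfolding T image_image by (intro image_cong refl val sub) (simp only: mem_Collect_eq)
  moreover have "compact (?F ` T)"
    unfolding T_def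
  proof (rule compact_continuous_image)
    show "continuous_on (simplex_on ?S \<inter> ?C) ?F"
      by (intro continuous_on_Pair continuous_on_add continuous_on_diff continuous_on_simplex_ent_fun)
    show "compact (simplex_on ?S \<inter> ?C)" by (intro compact_Int_closed compact_simplex_on closed)
  qed
  ultimately show ?thesis by (simp only:)
qed

theorem theorem6:
  fixes p :: "('x::finite \<times> 'y::finite \<times> 'z::finite) pmf" and \<Delta> :: real
  shows "(\<forall>pJ. is_extension p pJ \<longrightarrow>
            is_max (objective ` {q. feasible \<Delta> pJ q}) (inner_max \<Delta> pJ)) \<and>
         key_capacity p \<Delta> \<le> Psi p \<Delta> \<and>
         ((\<exists>f. \<forall>(x, y, z) \<in> set_pmf p. z = f x y) \<longrightarrow>
            (\<forall>pJ. is_extension p pJ \<longrightarrow>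
               is_max (objective ` {q. feasible \<Delta> pJ q \<and> xy_determined q}) (inner_max \<Delta> pJ)))"
proof (intro conjI allI impI)
  show "is_max (objective ` {q. feasible \<Delta> pJ q}) (inner_max \<Delta> pJ)" if "is_extension p pJ" for pJ
    using that by (rule inner_max_attained)
  show "key_capacity p \<Delta> \<le> Psi p \<Delta>"
    unfolding key_capacity_def Psi_def
  proof (intro SUP_least INF_greatest)
    fix R pJ assume "R \<in> {R. achievable p \<Delta> R}" "pJ \<in> {pJ. is_extension p pJ}"
    then obtain q where "feasible \<Delta> pJ q" "R \<le> objective q" by (auto elim: achievable_feasible)
    thus "ereal R \<le> inner_max \<Delta> pJ" unfolding inner_max_def by (intro SUP_upper2[of q]) auto
  qed
next
  fix pJ assume "\<exists>f. \<forall>(x, y, z) \<in> set_pmf p. z = f x y" and ext: "is_extension p pJ"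
  then obtain f where f: "\<And>x y z. (x, y, z) \<in> set_pmf p \<Longrightarrow> z = f x y" by blast
  let ?S = "objective ` {q. feasible \<Delta> pJ q}" and ?D = "objective ` {q. feasible \<Delta> pJ q \<and> xy_determined q}"
  have max: "is_max ?S (inner_max \<Delta> pJ)" by (rule inner_max_attained[OF ext])
  show "is_max ?D (inner_max \<Delta> pJ)"
  \<comment> \<open>Without admissible laws both sets of values are empty and both maxima are
    \<open>-\<infinity>\<close>.\<close>
  proof (cases "{q. feasible \<Delta> pJ q} = {}")
    case True
    thus ?thesis using max by (simp add: is_max_def)
  next
    case False
    hence "(?S = {}) = False" by simp
    with max have "\<exists>s\<in>?S. inner_max \<Delta> pJ = ereal s \<and> (\<forall>t\<in>?S. t \<le> s)" by (simp only: is_max_def if_False)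
    then obtain q where q: "feasible \<Delta> pJ q" "inner_max \<Delta> pJ = ereal (objective q)"
      "\<And>q'. feasible \<Delta> pJ q' \<Longrightarrow> objective q' \<le> objective q"
      by blast
    \<comment> \<open>A maximiser is replaced by a law that meets the extra constraint; as this
      cannot exceed the maximum, the values agree.\<close>
    obtain q' where "feasible \<Delta> pJ q'" "xy_determined q'" "objective q \<le> objective q'"
      by (rule determined_improvement[OF ext f q(1)])
    with q(3)[of q'] have "objective q \<in> ?D" by (intro image_eqI[of _ _ q']) auto
    thus ?thesis using q unfolding is_max_def by auto
  qed
qed

end
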